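(* Let $M\in{}^*\mathbb N\setminus\mathbb N$ satisfy $M\varepsilon\approx0$, and let $h:\mathbb X\to{}^*\mathbb R$ be the grid function $$h(x)=\begin{cases}0& x\le0\\ x/(M\varepsilon)&0<x<M\varepsilon\\ 1&x\ge M\varepsilon.\end{cases}$$ Then: 1. $[h^m]=H$ and $[\mathbb D(h^m)]=\delta_0$ for all $m\in{}^*\mathbb N$, $m\ge1$; 2. $h^m\ne h^n$ whenever $m\ne n$ ($m,n\in{}^*\mathbb N$, $m,n\geq 1$); 3. $\langle h^m-h^n,\mathbb Dh\rangle\approx\frac1{m+1}-\frac1{n+1}$ for all $m,n\in{}^*\mathbb N$, $m,n\ge1$.
   Context: Work in a nonstandard extension of the standard universe; $x\approx y$ means $x-y$ is infinitesimal; ${}^\circ x$ is the standard part of a finite $x$. Fix an infinite $N_0\in{}^*\mathbb N$, let $N=N_0!$, $\varepsilon=1/N$, and $\mathbb X=\{n\varepsilon: n\in{}^*\mathbb Z,\ -N^2\le n\le N^2\}$. Grid functions are internal functions $\mathbb X\to{}^*\mathbb R$. $\mathbb Df(x)=\varepsilon^{-1}(f(x+\varepsilon)-f(x))$ is the forward difference, and $\langle f,g\rangle=\varepsilon\sum_{x\in\mathbb X}f(x)g(x)$. A test function is a grid function $\varphi$ vanishing outside $[-r,r]$ for some standard $r$ and such that, for every standard $n\ge0$, $\mathbb D^n\varphi$ is finite at finite points of $\mathbb X$ and $\mathbb D^n\varphi(x)\approx\mathbb D^n\varphi(y)$ for all finite $x\approx y$ in $\mathbb X$. For such $\varphi$,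 ${}^\circ\varphi\in\mathscr D(\mathbb R)$ is defined by ${}^\circ\varphi({}^\circ x)={}^\circ(\varphi(x))$. For a grid function $f$ and a distribution $T\in\mathscr D'(\mathbb R)$, $[f]=T$ means that $\langle f,\varphi\rangle$ is finite with ${}^\circ\langle f,\varphi\rangle=\langle T,{}^\circ\varphi\rangle$ for all test functions $\varphi$. $H$ is the Heaviside function ($0$ for $x\le0$, $1$ for $x>0$) and $\delta_0$ is the Dirac distribution at $0$. *)

theory Defs
  imports "HOL-Analysis.Analysis"
begin

text \<open>
  \<^bold>\<open>Nonstandard extensions.\<close>
  The part of the standard universe that is extended is the full two-sorted structure consisting
  of the reals, all functions from reals to reals, and all finitary relations between such
  objects.  A formula is a first-order formula in which every relation of that structure may occur
  as an atom.  \<open>Rel P xs fs\<close> applies \<open>P\<close> to the real variables with indices \<open>xs\<close> and the function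
  variables with indices \<open>fs\<close>; parameters enter through the valuations.
\<close>

type_synonym std_rel = "real list \<Rightarrow> (real \<Rightarrow> real) list \<Rightarrow> bool"

datatype formula =
    Rel std_rel "nat list" "nat list"
  | Neg formula
  | Conj formula formula
  | ExReal nat formula
  | ExFun nat formula

text \<open>
  Satisfaction in a structure with individuals \<open>'a\<close>, functions \<open>F\<close> and interpretation \<open>I\<close> of
  the relation symbols.
\<close>

primrec sat ::
  "formula \<Rightarrow> (std_rel \<Rightarrow> 'a list \<Rightarrow> ('a \<Rightarrow> 'a) list \<Rightarrow> bool) \<Rightarrow> ('a \<Rightarrow> 'a) set
    \<Rightarrow> (nat \<Rightarrow> 'a) \<Rightarrow> (nat \<Rightarrow> 'a \<Rightarrow> 'a) \<Rightarrow> bool"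
where
  "sat (Rel P xs fs) I F u v \<longleftrightarrow> I P (map u xs) (map v fs)"
| "sat (Neg A) I F u v \<longleftrightarrow> \<not> sat A I F u v"
| "sat (Conj A B) I F u v \<longleftrightarrow> sat A I F u v \<and> sat B I F u v"
| "sat (ExReal i A) I F u v \<longleftrightarrow> (\<exists>x. sat A I F (u(i := x)) v)"
| "sat (ExFun i A) I F u v \<longleftrightarrow> (\<exists>f\<in>F. sat A I F u (v(i := f)))"

text \<open>
  The type \<open>'a\<close> is the field of hyperreals, \<open>internal\<close> the set of internal functions from
  hyperreals to hyperreals, and \<open>star_rel P\<close> the star of the relation \<open>P\<close>.  The axioms after
  \<open>transfer\<close> say that the star of equality, addition, multiplication, order and function
  application are the actual ones.  That the extension is proper is not an axiom; it follows from
  the existence of an infinite hypernatural number.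
\<close>

class nonstandard_extension = linordered_field +
  fixes star_real :: "real \<Rightarrow> 'a"
    and star_fun :: "(real \<Rightarrow> real) \<Rightarrow> 'a \<Rightarrow> 'a"
    and internal :: "('a \<Rightarrow> 'a) set"
    and star_rel :: "std_rel \<Rightarrow> 'a list \<Rightarrow> ('a \<Rightarrow> 'a) list \<Rightarrow> bool"
  assumes internal_star_fun: "star_fun f \<in> internal"
    and transfer:
      "sat A star_rel internal (\<lambda>i. star_real (u i)) (\<lambda>i. star_fun (v i))
        \<longleftrightarrow> sat A (\<lambda>P. P) UNIV u v"
    and star_eq: "star_rel (\<lambda>xs fs. xs ! 0 = xs ! 1) [x, y] [] \<longleftrightarrow> x = y"
    and star_plus: "star_rel (\<lambda>xs fs. xs ! 0 + xs ! 1 = xs ! 2) [x, y, z] [] \<longleftrightarrow> x + y = z"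
    and star_times: "star_rel (\<lambda>xs fs. xs ! 0 * xs ! 1 = xs ! 2) [x, y, z] [] \<longleftrightarrow> x * y = z"
    and star_le: "star_rel (\<lambda>xs fs. xs ! 0 \<le> xs ! 1) [x, y] [] \<longleftrightarrow> x \<le> y"
    and star_app:
      "g \<in> internal \<Longrightarrow> star_rel (\<lambda>xs fs. (fs ! 0) (xs ! 0) = xs ! 1) [x, y] [g] \<longleftrightarrow> g x = y"

text \<open>
  The star of a standard functional \<open>\<Phi>\<close> (with real and function arguments), obtained from the star
  of its graph.
\<close>

definition star_op ::
  "(real list \<Rightarrow> (real \<Rightarrow> real) list \<Rightarrow> real) \<Rightarrow> 'a list \<Rightarrow> ('a \<Rightarrow> 'a) list
    \<Rightarrow> 'a::nonstandard_extension"
where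
  "star_op \<Phi> xs fs = (THE y. star_rel (\<lambda>zs gs. zs ! 0 = \<Phi> (tl zs) gs) (y # xs) fs)"

definition hypernats :: "'a::nonstandard_extension set" where
  "hypernats = {x. star_rel (\<lambda>xs fs. xs ! 0 \<in> \<nat>) [x] []}"

definition hyperints :: "'a::nonstandard_extension set" where
  "hyperints = {x. star_rel (\<lambda>xs fs. xs ! 0 \<in> \<int>) [x] []}"

definition hyperfact :: "'a \<Rightarrow> 'a::nonstandard_extension" where
  "hyperfact n = star_op (\<lambda>xs fs. fact (nat \<lfloor>xs ! 0\<rfloor>)) [n] []"

definition hyperpow :: "'a \<Rightarrow> 'a \<Rightarrow> 'a::nonstandard_extension" where
  "hyperpow x m = star_op (\<lambda>xs fs. (xs ! 0) ^ nat \<lfloor>xs ! 1\<rfloor>) [x, m] []"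

text \<open>The hyperfinite sum of an internal \<open>f\<close> over the hyperintegers between \<open>a\<close> and \<open>b\<close>.\<close>

definition hypersum :: "('a \<Rightarrow> 'a) \<Rightarrow> 'a \<Rightarrow> 'a \<Rightarrow> 'a::nonstandard_extension" where
  "hypersum f a b =
    star_op (\<lambda>xs fs. \<Sum>k\<in>{\<lfloor>xs ! 0\<rfloor>..\<lfloor>xs ! 1\<rfloor>}. (fs ! 0) (of_int k)) [a, b] [f]"

definition infinitesimal :: "'a::nonstandard_extension \<Rightarrow> bool" where
  "infinitesimal x \<longleftrightarrow> (\<forall>r>0. \<bar>x\<bar> < star_real r)"

definition near :: "'a::nonstandard_extension \<Rightarrow> 'a \<Rightarrow> bool"  (infix "near" 50) where
  "x near y \<longleftrightarrow> infinitesimal (x - y)"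

definition limited :: "'a::nonstandard_extension \<Rightarrow> bool" where
  "limited x \<longleftrightarrow> (\<exists>r. \<bar>x\<bar> \<le> star_real r)"

definition st :: "'a::nonstandard_extension \<Rightarrow> real" where
  "st x = (THE r. x near star_real r)"

text \<open>
  \<^bold>\<open>Grid functions.\<close>
  The grid depends on the hypernatural \<open>N\<close>, its step is \<open>1 / N\<close>.  Internal functions on the grid
  are represented by their extensions by \<open>0\<close> to all hyperreals.  Consequently the forward difference
  at the right end point \<open>N\<close> of the grid reads the missing value \<open>f (N + 1 / N)\<close> as \<open>0\<close>.
\<close>

definition grid :: "'a::nonstandard_extension \<Rightarrow> 'a set" where
  "grid N = {n * (1 / N) |n. n \<in> hyperints \<and> - (N ^ 2) \<le> n \<and> n \<le> N ^ 2}"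

definition grid_functions :: "'a::nonstandard_extension \<Rightarrow> ('a \<Rightarrow> 'a) set" where
  "grid_functions N = {f \<in> internal. \<forall>x. x \<notin> grid N \<longrightarrow> f x = 0}"

definition fdiff :: "'a::nonstandard_extension \<Rightarrow> ('a \<Rightarrow> 'a) \<Rightarrow> 'a \<Rightarrow> 'a" where
  "fdiff N f x = (if x \<in> grid N then (f (x + 1 / N) - f x) / (1 / N) else 0)"

definition grid_inner :: "'a::nonstandard_extension \<Rightarrow> ('a \<Rightarrow> 'a) \<Rightarrow> ('a \<Rightarrow> 'a) \<Rightarrow> 'a" where
  "grid_inner N f g =
    (1 / N) * hypersum (\<lambda>n. f (n * (1 / N)) * g (n * (1 / N))) (- (N ^ 2)) (N ^ 2)"

definition grid_pow :: "('a \<Rightarrow> 'a) \<Rightarrow> 'a \<Rightarrow> 'a \<Rightarrow> 'a::nonstandard_extension" where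
  "grid_pow f m = (\<lambda>x. hyperpow (f x) m)"

definition grid_test_functions :: "'a::nonstandard_extension \<Rightarrow> ('a \<Rightarrow> 'a) set" where
  "grid_test_functions N = {\<phi> \<in> grid_functions N.
    (\<exists>r. \<forall>x\<in>grid N. star_real r < \<bar>x\<bar> \<longrightarrow> \<phi> x = 0) \<and>
    (\<forall>n. (\<forall>x\<in>grid N. limited x \<longrightarrow> limited ((fdiff N ^^ n) \<phi> x)) \<and>
         (\<forall>x\<in>grid N. \<forall>y\<in>grid N. limited x \<and> limited y \<and> x near y
            \<longrightarrow> (fdiff N ^^ n) \<phi> x near (fdiff N ^^ n) \<phi> y))}"

definition std_part_fun ::
  "'a \<Rightarrow> ('a \<Rightarrow> 'a::nonstandard_extension) \<Rightarrow> real \<Rightarrow> real"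
where
  "std_part_fun N \<phi> t =
    (THE s. \<forall>x\<in>grid N. limited x \<and> st x = t \<longrightarrow> st (\<phi> x) = s)"

text \<open>
  \<^bold>\<open>Distributions\<close> on the real line: linear functionals on the smooth compactly supported functions
  that are sequentially continuous.  They are rendered as functions on all real functions, whose
  values outside the space of test functions are irrelevant.
\<close>

definition std_test_functions :: "(real \<Rightarrow> real) set" where
  "std_test_functions = {\<phi>.
    (\<forall>n x. (deriv ^^ n) \<phi> field_differentiable (at x)) \<and>
    (\<exists>r. \<forall>x. r < \<bar>x\<bar> \<longrightarrow> \<phi> x = 0)}"

definition test_convergent :: "(nat \<Rightarrow> real \<Rightarrow> real) \<Rightarrow> (real \<Rightarrow> real) \<Rightarrow> bool" where
  "test_convergent \<phi> \<psi> \<longleftrightarrow>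
    (\<forall>k. \<phi> k \<in> std_test_functions) \<and> \<psi> \<in> std_test_functions \<and>
    (\<exists>r. \<forall>k x. r < \<bar>x\<bar> \<longrightarrow> \<phi> k x = 0) \<and>
    (\<forall>n. uniform_limit UNIV (\<lambda>k. (deriv ^^ n) (\<phi> k)) ((deriv ^^ n) \<psi>) sequentially)"

definition distribution :: "((real \<Rightarrow> real) \<Rightarrow> real) \<Rightarrow> bool" where
  "distribution T \<longleftrightarrow>
    (\<forall>\<phi>\<in>std_test_functions. \<forall>\<psi>\<in>std_test_functions. \<forall>a b.
       T (\<lambda>x. a * \<phi> x + b * \<psi> x) = a * T \<phi> + b * T \<psi>) \<and>
    (\<forall>\<phi> \<psi>. test_convergent \<phi> \<psi> \<longrightarrow> (\<lambda>k. T (\<phi> k)) \<longlonglongrightarrow> T \<psi>)"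

definition regular_distribution :: "(real \<Rightarrow> real) \<Rightarrow> (real \<Rightarrow> real) \<Rightarrow> real" where
  "regular_distribution g \<phi> = (LINT x|lborel. g x * \<phi> x)"

definition dirac :: "real \<Rightarrow> (real \<Rightarrow> real) \<Rightarrow> real" where
  "dirac a \<phi> = \<phi> a"

definition heaviside :: "real \<Rightarrow> real" where
  "heaviside x = (if x \<le> 0 then 0 else 1)"

text \<open>\<open>represents N f T\<close> is the relation \<open>[f] = T\<close>.\<close>

definition represents ::
  "'a \<Rightarrow> ('a \<Rightarrow> 'a::nonstandard_extension) \<Rightarrow> ((real \<Rightarrow> real) \<Rightarrow> real) \<Rightarrow> bool"
where
  "represents N f T \<longleftrightarrow>
    f \<in> grid_functions N \<and> distribution T \<and>
    (\<forall>\<phi>\<in>grid_test_functions N.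
       limited (grid_inner N f \<phi>) \<and> st (grid_inner N f \<phi>) = T (std_part_fun N \<phi>))"

end

theory Submission
  imports Defs
begin

text \<open>
  A test function \<open>\<phi>\<close> is infinitely close, at the limited grid points, to the star of its standard
  part \<open>g\<close>, which is continuous by underspill.  The function \<open>h\<^sup>m\<close> takes values in \<open>[0, 1]\<close> and
  differs from the grid version of \<open>H\<close> only on an interval of infinitesimal length, so pairing it
  with \<open>\<phi>\<close> gives, up to an infinitesimal, a hyperfinite Riemann sum for the integral of \<open>g\<close> over
  the positive half-line.  Only continuity of \<open>g\<close> matters here, not its smoothness.  The pairing of
  \<open>\<phi>\<close> with the difference quotient of \<open>h\<^sup>m\<close> is a weighted mean of values of \<open>\<phi>\<close> infinitely close to \<open>0\<close>.
  The third claim is the estimate \<open>\<bar>(1 / M) * (\<Sum>k<M. (k / M) ^ m) - 1 / (m + 1)\<bar> \<le> 1 / M\<close>, which is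
  uniform in \<open>m\<close> and therefore transfers to infinite exponents.
\<close>

subsection \<open>A syntax-directed transfer principle\<close>

text \<open>The axiom \<open>transfer\<close> is hard to use directly: it concerns formulas whose
  only atoms are relation symbols, under valuations by standard objects, and \<open>star_rel\<close>
  of a compound relation has a priori no link to the logical form of that relation. Compositional
  rules supply this link. They cannot express external notions such as \<open>near\<close>,
  \<open>limited\<close> or \<open>st\<close>, nor bind a variable inside a sum. Hence each fact
  about sums is an inequality with explicit constants and a separate function variable for the
  summand; infinitesimals enter only after transfer. A second obstacle is the right end of the grid.
  Functions are extended by \<open>0\<close>, so h^m drops from 1 to 0 just past the end point N and
  its difference quotient there is -N. This huge value always meets a factor that vanishes: \<phi>,
  because N lies beyond its support, or h^m - h^n, because both powers are 1 there.\<close>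

definition Iff :: "formula \<Rightarrow> formula \<Rightarrow> formula" where
  "Iff A B = Neg (Conj (Neg (Conj A B)) (Neg (Conj (Neg A) (Neg B))))"

lemma sat_Iff [simp]: "sat (Iff A B) I F u v \<longleftrightarrow> (sat A I F u v \<longleftrightarrow> sat B I F u v)"
  by (auto simp: Iff_def)

lemma sat_all_real: "sat (Neg (ExReal i (Neg A))) I F u v \<longleftrightarrow> (\<forall>x. sat A I F (u(i := x)) v)"
  by simp

lemma sat_all_fun: "sat (Neg (ExFun i (Neg A))) I F u v \<longleftrightarrow> (\<forall>f\<in>F. sat A I F u (v(i := f)))"
  by simp

text \<open>\<open>transfer\<close> admits only valuations by standard objects; arbitrary hyperreals
  become reachable once the first \<open>n\<close> variables are universally quantified.\<close>

definition AllReals :: "nat \<Rightarrow> formula \<Rightarrow> formula" where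
  "AllReals n A = foldr (\<lambda>i B. Neg (ExReal i (Neg B))) [0..<n] A"

definition AllFuns :: "nat \<Rightarrow> formula \<Rightarrow> formula" where
  "AllFuns n A = foldr (\<lambda>i B. Neg (ExFun i (Neg B))) [0..<n] A"

lemma sat_AllReals:
  "sat (AllReals n A) I F u v \<longleftrightarrow> (\<forall>u'. (\<forall>i\<ge>n. u' i = u i) \<longrightarrow> sat A I F u' v)"
proof -
  have "sat (foldr (\<lambda>i B. Neg (ExReal i (Neg B))) is A) I F u v \<longleftrightarrow>
      (\<forall>u'. (\<forall>i. i \<notin> set is \<longrightarrow> u' i = u i) \<longrightarrow> sat A I F u' v)" for "is"
  proof (induction "is" arbitrary: u)
    case Nil
    then show ?case by (auto simp: fun_eq_iff[symmetric])
  next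
    case (Cons j js)
    have "(\<forall>x u'. (\<forall>i. i \<notin> set js \<longrightarrow> u' i = (u(j := x)) i) \<longrightarrow> sat A I F u' v) \<longleftrightarrow>
      (\<forall>u'. (\<forall>i. i \<notin> set (j # js) \<longrightarrow> u' i = u i) \<longrightarrow> sat A I F u' v)" (is "?L \<longleftrightarrow> ?R")
    proof
      assume L: ?L
      show ?R
      proof (intro allI impI)
        fix u' assume "\<forall>i. i \<notin> set (j # js) \<longrightarrow> u' i = u i"
        then show "sat A I F u' v" using L[rule_format, of u' "u' j"] by auto
      qed
    next
      assume ?R
      then show ?L by (auto simp: fun_upd_def)
    qed
    then show ?case by (simp only: foldr.simps comp_def sat_all_real Cons.IH)
  qed
  from this[of "[0..<n]"] show ?thesis by (simp add: AllReals_def not_less)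
qed

lemma sat_AllFuns:
  assumes "\<And>i. v i \<in> F"
  shows "sat (AllFuns n A) I F u v \<longleftrightarrow>
    (\<forall>v'. (\<forall>i. v' i \<in> F) \<longrightarrow> (\<forall>i\<ge>n. v' i = v i) \<longrightarrow> sat A I F u v')"
proof -
  have "sat (foldr (\<lambda>i B. Neg (ExFun i (Neg B))) is A) I F u v \<longleftrightarrow>
      (\<forall>v'. (\<forall>i. v' i \<in> F) \<longrightarrow> (\<forall>i. i \<notin> set is \<longrightarrow> v' i = v i) \<longrightarrow> sat A I F u v')" for "is"
    using assms
  proof (induction "is" arbitrary: v)
    case Nil
    then show ?case by (auto simp: fun_eq_iff[symmetric])
  next
    case (Cons j js)
    have IH: "sat (foldr (\<lambda>i B. Neg (ExFun i (Neg B))) js A) I F u (v(j := x)) \<longleftrightarrow>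
      (\<forall>v'. (\<forall>i. v' i \<in> F) \<longrightarrow> (\<forall>i. i \<notin> set js \<longrightarrow> v' i = (v(j := x)) i) \<longrightarrow> sat A I F u v')"
      if "x \<in> F" for x
      using Cons.prems that by (intro Cons.IH) auto
    have "(\<forall>x\<in>F. \<forall>v'. (\<forall>i. v' i \<in> F) \<longrightarrow> (\<forall>i. i \<notin> set js \<longrightarrow> v' i = (v(j := x)) i) \<longrightarrow> sat A I F u v') \<longleftrightarrow>
      (\<forall>v'. (\<forall>i. v' i \<in> F) \<longrightarrow> (\<forall>i. i \<notin> set (j # js) \<longrightarrow> v' i = v i) \<longrightarrow> sat A I F u v')"
      (is "?L \<longleftrightarrow> ?R")
    proof
      assume L: ?L
      show ?R
      proof (intro allI impI)
        fix v' assume "\<forall>i. v' i \<in> F" "\<forall>i. i \<notin> set (j # js) \<longrightarrow> v' i = v i"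
        then show "sat A I F u v'" using L[rule_format, of "v' j" v'] by auto
      qed
    next
      assume ?R
      then show ?L by (auto simp: fun_upd_def)
    qed
    then show ?case using IH by (simp only: foldr.simps comp_def sat_all_fun cong: ball_cong)
  qed
  from this[of "[0..<n]"] show ?thesis by (simp add: AllFuns_def not_less)
qed

text \<open>Only the first \<open>n\<close> real and the first \<open>k\<close> function variables
  may take nonstandard values. The others are pinned to standard constants, because they stay free
  in the quantified formula and are handled by the axiom itself.\<close>

lemma transfer_valid:
  fixes u' :: "nat \<Rightarrow> 'a::nonstandard_extension"
  assumes "\<And>u v. (\<forall>i\<ge>n. u i = c i) \<Longrightarrow> (\<forall>i\<ge>k. v i = d i) \<Longrightarrow> sat A (\<lambda>P. P) UNIV u v"
    and "\<And>i. i \<ge> n \<Longrightarrow> u' i = star_real (c i)"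
    and "\<And>i. i \<ge> k \<Longrightarrow> v' i = star_fun (d i)"
    and "\<And>i. v' i \<in> internal"
  shows "sat A star_rel internal u' v'"
proof -
  have "sat (AllFuns k (AllReals n A)) (\<lambda>P. P) UNIV c d"
    using assms(1) by (simp add: sat_AllFuns sat_AllReals)
  then have "sat (AllFuns k (AllReals n A)) star_rel internal
      (\<lambda>i. star_real (c i) :: 'a) (\<lambda>i. star_fun (d i))"
    by (simp add: transfer)
  then show ?thesis
    using assms(2-4) by (simp add: sat_AllFuns sat_AllReals internal_star_fun)
qed

text \<open>Valuations are total while relations take lists; padding by standard constants meets the
  pinning required in \<open>transfer_valid\<close>.\<close>

lemma transfer_valid_lists:
  fixes xs :: "'a::nonstandard_extension list"
  assumes "\<And>u v. sat A (\<lambda>P. P) UNIV u v" and "set fs \<subseteq> internal"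
  shows "sat A star_rel internal (\<lambda>i. if i < length xs then xs ! i else star_real 0)
    (\<lambda>i. if i < length fs then fs ! i else star_fun (\<lambda>_. 0))"
  using assms
  by (intro transfer_valid[where n = "length xs" and k = "length fs"
        and c = "\<lambda>_. 0" and d = "\<lambda>_ _. 0"]) (auto simp: internal_star_fun)

section \<open>Stars of compound relations\<close>

lemma map_if_nth [simp]:
  "map (\<lambda>i. if i < length xs then xs ! i else f i) [0..<length xs] = xs"
  by (rule nth_equalityI) auto

text \<open>An equivalence between one atom for the compound relation and the same connective
  applied to atoms for its parts is valid in the standard structure by definition, so it transfers.
  Conjunction and both quantifiers follow this pattern.\<close>

lemma star_rel_Neg:
  assumes "set fs \<subseteq> internal"
  shows "star_rel (\<lambda>xs fs. \<not> R xs fs) xs fs \<longleftrightarrow> \<not> star_rel R xs fs"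
  using transfer_valid_lists[of "Iff (Rel (\<lambda>xs fs. \<not> R xs fs) [0..<length xs] [0..<length fs])
    (Neg (Rel R [0..<length xs] [0..<length fs]))" fs xs] assms
  by simp

lemma star_rel_Conj:
  assumes "set fs \<subseteq> internal"
  shows "star_rel (\<lambda>xs fs. R xs fs \<and> S xs fs) xs fs \<longleftrightarrow> star_rel R xs fs \<and> star_rel S xs fs"
  using transfer_valid_lists[of "Iff (Rel (\<lambda>xs fs. R xs fs \<and> S xs fs) [0..<length xs] [0..<length fs])
    (Conj (Rel R [0..<length xs] [0..<length fs]) (Rel S [0..<length xs] [0..<length fs]))" fs xs]
    assms
  by simp

lemma map_upd_upt: "map (f(n := x)) [0..<n] = map f [0..<n]"
  by simp

text \<open>The bound variable gets the index \<open>length xs\<close>, the first one free, although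
  its value is placed at the head of the argument list.\<close>

lemma star_rel_ExReal:
  assumes "set fs \<subseteq> internal"
  shows "star_rel (\<lambda>xs fs. \<exists>y. R (y # xs) fs) xs fs \<longleftrightarrow> (\<exists>y. star_rel R (y # xs) fs)"
  using transfer_valid_lists[of "Iff (Rel (\<lambda>xs fs. \<exists>y. R (y # xs) fs) [0..<length xs] [0..<length fs])
    (ExReal (length xs) (Rel R (length xs # [0..<length xs]) [0..<length fs]))" fs xs] assms
  by (simp add: map_upd_upt del: map_fun_upd)

lemma star_rel_ExFun:
  assumes "set fs \<subseteq> internal"
  shows "star_rel (\<lambda>xs fs. \<exists>g. R xs (g # fs)) xs fs \<longleftrightarrow> (\<exists>g\<in>internal. star_rel R xs (g # fs))"
  using transfer_valid_lists[of "Iff (Rel (\<lambda>xs fs. \<exists>g. R xs (g # fs)) [0..<length xs] [0..<length fs])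
    (ExFun (length fs) (Rel R [0..<length xs] (length fs # [0..<length fs])))" fs xs] assms
  by (simp add: map_upd_upt del: map_fun_upd)

text \<open>Permuting, repeating or dropping arguments commutes with the star. The rules for
  \<open>transfers\<close> rely on this to rename variables and to bring relations to a common
  arity.\<close>

lemma star_rel_reindex:
  assumes "set fs \<subseteq> internal" "set is \<subseteq> {..<length xs}" "set js \<subseteq> {..<length fs}"
  shows "star_rel (\<lambda>xs fs. R (map ((!) xs) is) (map ((!) fs) js)) xs fs \<longleftrightarrow>
    star_rel R (map ((!) xs) is) (map ((!) fs) js)"
proof -
  have eq: "map (\<lambda>i. if i < length ys then ys ! i else z) ks = map ((!) ys) ks"
    if "set ks \<subseteq> {..<length ys}" for ys :: "'b list" and ks z
    using that by (intro map_cong) auto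
  have eq': "map ((!) (map u [0..<n])) ks = map u ks"
    if "set ks \<subseteq> {..<n}" for u :: "nat \<Rightarrow> 'b" and ks n
    using that by (auto simp: in_set_conv_nth subset_iff intro!: nth_equalityI)
  have "\<And>u v. sat (Iff (Rel (\<lambda>xs fs. R (map ((!) xs) is) (map ((!) fs) js)) [0..<length xs] [0..<length fs])
    (Rel R is js)) (\<lambda>P. P) UNIV u v"
    using assms by (simp add: eq')
  from transfer_valid_lists[OF this assms(1), of xs] assms show ?thesis
    by (simp add: eq)
qed

text \<open>
  The standard predicate \<open>P\<close> and the nonstandard predicate \<open>Q\<close> of a valuation are given by the same
  relation of finitely many variables.  Binders are nameless: they bind variable \<open>0\<close> and shift the
  valuation.
\<close>

definition transfers ::
  "((nat \<Rightarrow> real) \<Rightarrow> (nat \<Rightarrow> real \<Rightarrow> real) \<Rightarrow> bool) \<Rightarrow>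
   ((nat \<Rightarrow> 'a::nonstandard_extension) \<Rightarrow> (nat \<Rightarrow> 'a \<Rightarrow> 'a) \<Rightarrow> bool) \<Rightarrow> bool"
where
  "transfers P Q \<longleftrightarrow> (\<exists>n k R.
    (\<forall>u v. P u v \<longleftrightarrow> R (map u [0..<n]) (map v [0..<k])) \<and>
    (\<forall>u v. range v \<subseteq> internal \<longrightarrow> (Q u v \<longleftrightarrow> star_rel R (map u [0..<n]) (map v [0..<k]))))"

text \<open>A term is handled through its graph, because \<open>transfers\<close> concerns truth
  values: variable \<open>0\<close> carries the value and the variables of the term are shifted past
  it.\<close>

definition transfers_term ::
  "((nat \<Rightarrow> real) \<Rightarrow> (nat \<Rightarrow> real \<Rightarrow> real) \<Rightarrow> real) \<Rightarrow>
   ((nat \<Rightarrow> 'a::nonstandard_extension) \<Rightarrow> (nat \<Rightarrow> 'a \<Rightarrow> 'a) \<Rightarrow> 'a) \<Rightarrow> bool"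
where
  "transfers_term t s \<longleftrightarrow>
    transfers (\<lambda>u v. u 0 = t (\<lambda>i. u (Suc i)) v) (\<lambda>u v. u 0 = s (\<lambda>i. u (Suc i)) v)"

lemma transfersI:
  assumes "\<And>u v. P u v \<longleftrightarrow> R (map u [0..<n]) (map v [0..<k])"
    and "\<And>u v. range v \<subseteq> internal \<Longrightarrow> Q u v \<longleftrightarrow> star_rel R (map u [0..<n]) (map v [0..<k])"
  shows "transfers P Q"
  unfolding transfers_def using assms by blast

lemma transfers_valid:
  assumes "transfers P Q" "\<And>u v. P u v" "range v \<subseteq> internal"
  shows "Q u v"
proof -
  obtain n k R where R: "\<And>u v. P u v \<longleftrightarrow> R (map u [0..<n]) (map v [0..<k])"
    "\<And>u v. range v \<subseteq> internal \<Longrightarrow> (Q u v \<longleftrightarrow> star_rel R (map u [0..<n]) (map v [0..<k]))"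
    using assms(1) unfolding transfers_def by blast
  have v: "set (map v [0..<k]) \<subseteq> internal" using assms(3) by auto
  have eq: "map (\<lambda>i. if i < m then map w [0..<m] ! i else z) [0..<m] = map w [0..<m]"
    for m and w :: "nat \<Rightarrow> 'c" and z
    by (intro map_cong) auto
  have "star_rel R (map u [0..<n]) (map v [0..<k])"
    using transfer_valid_lists[of "Rel R [0..<n] [0..<k]", OF _ v, of "map u [0..<n]"] R(1) assms(2)
    by (simp add: eq)
  then show ?thesis using R(2) assms(3) by blast
qed

lemma transfers_rename:
  assumes "transfers P Q"
  shows "transfers (\<lambda>u v. P (\<lambda>i. u (\<rho> i)) (\<lambda>i. v (\<sigma> i))) (\<lambda>u v. Q (\<lambda>i. u (\<rho> i)) (\<lambda>i. v (\<sigma> i)))"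
proof -
  obtain n k R where R: "\<And>u v. P u v \<longleftrightarrow> R (map u [0..<n]) (map v [0..<k])"
    "\<And>u v. range v \<subseteq> internal \<Longrightarrow> (Q u v \<longleftrightarrow> star_rel R (map u [0..<n]) (map v [0..<k]))"
    using assms(1) unfolding transfers_def by blast
  \<comment> \<open>The new arity must exceed every renamed index in use; \<open>insert 0\<close>
    keeps \<open>Max\<close> meaningful when there are none.\<close>
  define n' where "n' = Suc (Max (insert 0 (\<rho> ` {..<n})))"
  define k' where "k' = Suc (Max (insert 0 (\<sigma> ` {..<k})))"
  have n': "\<rho> i < n'" if "i < n" for i
    unfolding n'_def using that by (auto intro!: le_imp_less_Suc Max_ge)
  have k': "\<sigma> i < k'" if "i < k" for i
    unfolding k'_def using that by (auto intro!: le_imp_less_Suc Max_ge)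
  have eqn: "map (\<lambda>i. u (\<rho> i)) [0..<n] = map ((!) (map u [0..<n'])) (map \<rho> [0..<n])" for u :: "nat \<Rightarrow> 'c"
    using n' by simp
  have eqk: "map (\<lambda>i. v (\<sigma> i)) [0..<k] = map ((!) (map v [0..<k'])) (map \<sigma> [0..<k])" for v :: "nat \<Rightarrow> 'c"
    using k' by simp
  show ?thesis
  proof (rule transfersI[where n = n' and k = k' and
        R = "\<lambda>xs fs. R (map ((!) xs) (map \<rho> [0..<n])) (map ((!) fs) (map \<sigma> [0..<k]))"])
    show "P (\<lambda>i. u (\<rho> i)) (\<lambda>i. v (\<sigma> i)) \<longleftrightarrow>
      R (map ((!) (map u [0..<n'])) (map \<rho> [0..<n])) (map ((!) (map v [0..<k'])) (map \<sigma> [0..<k]))" for u v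
      unfolding R(1) eqn[symmetric] eqk[symmetric] ..
    fix u :: "nat \<Rightarrow> 'a" and v :: "nat \<Rightarrow> 'a \<Rightarrow> 'a" assume v: "range v \<subseteq> internal"
    have "Q (\<lambda>i. u (\<rho> i)) (\<lambda>i. v (\<sigma> i)) \<longleftrightarrow>
      star_rel R (map (\<lambda>i. u (\<rho> i)) [0..<n]) (map (\<lambda>i. v (\<sigma> i)) [0..<k])"
      using v by (intro R(2)) auto
    also have "\<dots> \<longleftrightarrow> star_rel (\<lambda>xs fs. R (map ((!) xs) (map \<rho> [0..<n])) (map ((!) fs) (map \<sigma> [0..<k])))
        (map u [0..<n']) (map v [0..<k'])"
      unfolding eqn eqk using v n' k' by (intro star_rel_reindex[symmetric]) auto
    finally show "Q (\<lambda>i. u (\<rho> i)) (\<lambda>i. v (\<sigma> i)) \<longleftrightarrow> \<dots>" .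
  qed
qed

text \<open>Padding with dummy arguments raises the arities beyond any bound: a binder needs at
  least one variable to bind, and a conjunction needs one arity for both parts.\<close>

lemma transfers_obtain:
  assumes "transfers P Q"
  obtains n k R where "n \<ge> a" "k \<ge> b" "\<And>u v. P u v \<longleftrightarrow> R (map u [0..<n]) (map v [0..<k])"
    "\<And>u v. range v \<subseteq> internal \<Longrightarrow> (Q u v \<longleftrightarrow> star_rel R (map u [0..<n]) (map v [0..<k]))"
proof -
  obtain n k R where R: "\<And>u v. P u v \<longleftrightarrow> R (map u [0..<n]) (map v [0..<k])"
    "\<And>u v. range v \<subseteq> internal \<Longrightarrow> (Q u v \<longleftrightarrow> star_rel R (map u [0..<n]) (map v [0..<k]))"
    using assms(1) unfolding transfers_def by blast
  define n' where "n' = max n a"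
  define k' where "k' = max k b"
  have eqn: "map u [0..<n] = map ((!) (map u [0..<n'])) [0..<n]" for u :: "nat \<Rightarrow> 'c"
    by (simp add: n'_def)
  have eqk: "map v [0..<k] = map ((!) (map v [0..<k'])) [0..<k]" for v :: "nat \<Rightarrow> 'c"
    by (simp add: k'_def)
  show ?thesis
  proof (rule that[of n' k' "\<lambda>xs fs. R (map ((!) xs) [0..<n]) (map ((!) fs) [0..<k])"])
    show "a \<le> n'" "b \<le> k'" by (simp_all add: n'_def k'_def)
    show "P u v \<longleftrightarrow> R (map ((!) (map u [0..<n'])) [0..<n]) (map ((!) (map v [0..<k'])) [0..<k])" for u v
      unfolding R(1) eqn[symmetric] eqk[symmetric] ..
    fix u :: "nat \<Rightarrow> 'a" and v :: "nat \<Rightarrow> 'a \<Rightarrow> 'a" assume v: "range v \<subseteq> internal"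
    show "Q u v \<longleftrightarrow> star_rel (\<lambda>xs fs. R (map ((!) xs) [0..<n]) (map ((!) fs) [0..<k]))
        (map u [0..<n']) (map v [0..<k'])"
      unfolding R(2)[OF v] eqn[of u] eqk[of v] using v
      by (intro star_rel_reindex[symmetric]) (auto simp: n'_def k'_def)
  qed
qed

lemma transfers_not:
  assumes "transfers P Q"
  shows "transfers (\<lambda>u v. \<not> P u v) (\<lambda>u v. \<not> Q u v)"
proof -
  obtain n k R where R: "\<And>u v. P u v \<longleftrightarrow> R (map u [0..<n]) (map v [0..<k])"
    "\<And>u v. range v \<subseteq> internal \<Longrightarrow> (Q u v \<longleftrightarrow> star_rel R (map u [0..<n]) (map v [0..<k]))"
    using assms(1) unfolding transfers_def by blast
  show ?thesis
    by (rule transfersI[where n = n and k = k and R = "\<lambda>xs fs. \<not> R xs fs"])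
      (auto simp: R star_rel_Neg image_subset_iff)
qed

lemma transfers_conj:
  assumes "transfers P Q" "transfers P' Q'"
  shows "transfers (\<lambda>u v. P u v \<and> P' u v) (\<lambda>u v. Q u v \<and> Q' u v)"
proof -
  obtain n k R where R: "\<And>u v. P u v \<longleftrightarrow> R (map u [0..<n]) (map v [0..<k])"
    "\<And>u v. range v \<subseteq> internal \<Longrightarrow> (Q u v \<longleftrightarrow> star_rel R (map u [0..<n]) (map v [0..<k]))"
    using assms(1) unfolding transfers_def by blast
  obtain n' k' R' where R': "n' \<ge> n" "k' \<ge> k" "\<And>u v. P' u v \<longleftrightarrow> R' (map u [0..<n']) (map v [0..<k'])"
    "\<And>u v. range v \<subseteq> internal \<Longrightarrow> (Q' u v \<longleftrightarrow> star_rel R' (map u [0..<n']) (map v [0..<k']))"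
    using transfers_obtain[OF assms(2)] by metis
  have eqn: "map u [0..<n] = map ((!) (map u [0..<n'])) [0..<n]" for u :: "nat \<Rightarrow> 'c"
    using R'(1) by simp
  have eqk: "map v [0..<k] = map ((!) (map v [0..<k'])) [0..<k]" for v :: "nat \<Rightarrow> 'c"
    using R'(2) by simp
  show ?thesis
  proof (rule transfersI[where n = n' and k = k' and
        R = "\<lambda>xs fs. R (map ((!) xs) [0..<n]) (map ((!) fs) [0..<k]) \<and> R' xs fs"])
    show "(P u v \<and> P' u v) \<longleftrightarrow> (R (map ((!) (map u [0..<n'])) [0..<n]) (map ((!) (map v [0..<k'])) [0..<k])
       \<and> R' (map u [0..<n']) (map v [0..<k']))" for u v
      unfolding R(1) R'(3) eqn[symmetric] eqk[symmetric] ..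
    fix u :: "nat \<Rightarrow> 'a" and v :: "nat \<Rightarrow> 'a \<Rightarrow> 'a" assume v: "range v \<subseteq> internal"
    then have v': "set (map v [0..<k']) \<subseteq> internal" by auto
    have "star_rel (\<lambda>xs fs. R (map ((!) xs) [0..<n]) (map ((!) fs) [0..<k]))
        (map u [0..<n']) (map v [0..<k']) = Q u v"
      unfolding R(2)[OF v] eqn[of u] eqk[of v] using v R'(1,2)
      by (intro star_rel_reindex) auto
    then show "Q u v \<and> Q' u v \<longleftrightarrow> star_rel (\<lambda>xs fs. R (map ((!) xs) [0..<n]) (map ((!) fs) [0..<k]) \<and> R' xs fs)
        (map u [0..<n']) (map v [0..<k'])"
      unfolding R'(4)[OF v] star_rel_Conj[OF v'] by simp
  qed
qed

lemma map_case_nat_upt: "map (case_nat y u) [0..<Suc m] = y # map u [0..<m]"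
proof -
  have upt: "[0..<Suc m] = 0 # map Suc [0..<m]"
    unfolding map_Suc_upt by (rule upt_conv_Cons) (rule zero_less_Suc)
  show ?thesis unfolding upt list.map map_map comp_def nat.case ..
qed

lemma transfers_ex:
  assumes "transfers (\<lambda>u v. P (\<lambda>i. u (Suc i)) v (u 0)) (\<lambda>u v. Q (\<lambda>i. u (Suc i)) v (u 0))"
  shows "transfers (\<lambda>u v. \<exists>x. P u v x) (\<lambda>u v. \<exists>x. Q u v x)"
proof -
  obtain n k R where R: "n \<ge> 1" "\<And>u v. P (\<lambda>i. u (Suc i)) v (u 0) \<longleftrightarrow> R (map u [0..<n]) (map v [0..<k])"
    "\<And>u v. range v \<subseteq> internal \<Longrightarrow>
      (Q (\<lambda>i. u (Suc i)) v (u 0) \<longleftrightarrow> star_rel R (map u [0..<n]) (map v [0..<k]))"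
    using transfers_obtain[OF assms, of 1 0] by metis
  obtain m where m: "n = Suc m" using R(1) by (cases n) auto
  have P: "P u v y \<longleftrightarrow> R (y # map u [0..<m]) (map v [0..<k])" for u v y
    using R(2)[of "case_nat y u" v] unfolding m map_case_nat_upt by simp
  have Q: "range v \<subseteq> internal \<Longrightarrow> Q u v y \<longleftrightarrow> star_rel R (y # map u [0..<m]) (map v [0..<k])" for u v y
    using R(3)[of v "case_nat y u"] unfolding m map_case_nat_upt by simp
  show ?thesis
    by (rule transfersI[where n = m and k = k and R = "\<lambda>xs fs. \<exists>y. R (y # xs) fs"])
      (auto simp: P Q star_rel_ExReal image_subset_iff)
qed

text \<open>On the nonstandard side function quantifiers are bounded by \<open>internal\<close>;
  this is why every function put into a transferred sentence later comes with a proof that it is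
  internal.\<close>

lemma transfers_bex_internal:
  assumes "transfers (\<lambda>u v. P u (\<lambda>i. v (Suc i)) (v 0)) (\<lambda>u v. Q u (\<lambda>i. v (Suc i)) (v 0))"
  shows "transfers (\<lambda>u v. \<exists>f. P u v f) (\<lambda>u v. \<exists>f\<in>internal. Q u v f)"
proof -
  obtain n k R where R: "k \<ge> 1" "\<And>u v. P u (\<lambda>i. v (Suc i)) (v 0) \<longleftrightarrow> R (map u [0..<n]) (map v [0..<k])"
    "\<And>u v. range v \<subseteq> internal \<Longrightarrow>
      (Q u (\<lambda>i. v (Suc i)) (v 0) \<longleftrightarrow> star_rel R (map u [0..<n]) (map v [0..<k]))"
    using transfers_obtain[OF assms, of 0 1] by metis
  obtain m where m: "k = Suc m" using R(1) by (cases k) auto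
  have P: "P u v y \<longleftrightarrow> R (map u [0..<n]) (y # map v [0..<m])" for u v y
    using R(2)[of u "case_nat y v"] unfolding m map_case_nat_upt by simp
  have Q: "Q u v y \<longleftrightarrow> star_rel R (map u [0..<n]) (y # map v [0..<m])"
    if "range v \<subseteq> internal" "y \<in> internal" for u v y
    using R(3)[of "case_nat y v" u] that unfolding m map_case_nat_upt
    by (auto simp: image_subset_iff split: nat.splits)
  show ?thesis
    by (rule transfersI[where n = n and k = m and R = "\<lambda>xs fs. \<exists>y. R xs (y # fs)"])
      (auto simp: P Q star_rel_ExFun image_subset_iff)
qed

lemma transfers_disj:
  assumes "transfers P Q" "transfers P' Q'"
  shows "transfers (\<lambda>u v. P u v \<or> P' u v) (\<lambda>u v. Q u v \<or> Q' u v)"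
proof -
  have "transfers (\<lambda>u v. \<not> (\<not> P u v \<and> \<not> P' u v)) (\<lambda>u v. \<not> (\<not> Q u v \<and> \<not> Q' u v))"
    by (intro transfers_not transfers_conj assms)
  then show ?thesis by (simp only: de_Morgan_conj not_not)
qed

lemma transfers_imp:
  assumes "transfers P Q" "transfers P' Q'"
  shows "transfers (\<lambda>u v. P u v \<longrightarrow> P' u v) (\<lambda>u v. Q u v \<longrightarrow> Q' u v)"
  unfolding imp_conv_disj by (intro transfers_disj transfers_not assms)

lemma transfers_all:
  assumes "transfers (\<lambda>u v. P (\<lambda>i. u (Suc i)) v (u 0)) (\<lambda>u v. Q (\<lambda>i. u (Suc i)) v (u 0))"
  shows "transfers (\<lambda>u v. \<forall>x. P u v x) (\<lambda>u v. \<forall>x. Q u v x)"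
proof -
  have "transfers (\<lambda>u v. \<not> (\<exists>x. \<not> P u v x)) (\<lambda>u v. \<not> (\<exists>x. \<not> Q u v x))"
    by (intro transfers_not transfers_ex assms)
  then show ?thesis by (simp only: not_ex not_not)
qed

lemma transfers_ball_internal:
  assumes "transfers (\<lambda>u v. P u (\<lambda>i. v (Suc i)) (v 0)) (\<lambda>u v. Q u (\<lambda>i. v (Suc i)) (v 0))"
  shows "transfers (\<lambda>u v. \<forall>f. P u v f) (\<lambda>u v. \<forall>f\<in>internal. Q u v f)"
proof -
  have "transfers (\<lambda>u v. \<not> (\<exists>f. \<not> P u v f)) (\<lambda>u v. \<not> (\<exists>f\<in>internal. \<not> Q u v f))"
    by (intro transfers_not transfers_bex_internal assms)
  then show ?thesis by (simp only: not_ex bex_simps not_not)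
qed

text \<open>A sentence does not depend on its valuation, so any internal one may be plugged in;
  applying validity to the negation as well gives both directions.\<close>

lemma transfer_sentence_iff:
  assumes "transfers (\<lambda>u v. P) (\<lambda>u v. Q :: bool)"
  shows "P \<longleftrightarrow> Q"
proof -
  have *: "range (\<lambda>_. star_fun (\<lambda>_. 0)) \<subseteq> internal" by (simp add: internal_star_fun)
  show ?thesis
    using transfers_valid[OF assms _ *] transfers_valid[OF transfers_not[OF assms] _ *] by blast
qed

lemma transfer_sentence:
  assumes P "transfers (\<lambda>u v. P) (\<lambda>u v. Q :: bool)"
  shows Q
  using assms transfer_sentence_iff by blast

section \<open>Terms and substitution\<close>

lemma transfers_term_eq:
  assumes "transfers_term t s"
  shows "transfers (\<lambda>u v. u j = t (\<lambda>i. u (\<rho> i)) v) (\<lambda>u v. u j = s (\<lambda>i. u (\<rho> i)) v)"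
  using transfers_rename[OF assms[unfolded transfers_term_def], of "case_nat j \<rho>" "\<lambda>i. i"]
  by simp

text \<open>Formulas contain no function symbols, so a term is substituted by quantifying over its
  value: \<open>\<exists>x. x = t \<and> R x\<close>. Two arguments and nested terms are treated in
  the same way.\<close>

lemma transfers_lift1:
  assumes "transfers (\<lambda>u v. R v (u 0)) (\<lambda>u v. S v (u 0))" and "transfers_term t s"
  shows "transfers (\<lambda>u v. R v (t u v)) (\<lambda>u v. S v (s u v))"
proof -
  have "transfers (\<lambda>u v. \<exists>x. x = t u v \<and> R v x) (\<lambda>u v. \<exists>x. x = s u v \<and> S v x)"
    by (intro transfers_ex transfers_conj transfers_term_eq assms)
  then show ?thesis by simp
qed

lemma transfers_lift2:
  assumes "transfers (\<lambda>u v. R v (u 0) (u (Suc 0))) (\<lambda>u v. S v (u 0) (u (Suc 0)))"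
    and "transfers_term t s" "transfers_term t' s'"
  shows "transfers (\<lambda>u v. R v (t u v) (t' u v)) (\<lambda>u v. S v (s u v) (s' u v))"
proof -
  have "transfers (\<lambda>u v. \<exists>y. y = t' u v \<and> (\<exists>x. x = t u v \<and> R v x y))
    (\<lambda>u v. \<exists>y. y = s' u v \<and> (\<exists>x. x = s u v \<and> S v x y))"
    by (intro transfers_ex transfers_conj transfers_term_eq[OF assms(2)] transfers_term_eq[OF assms(3)] assms(1))
  then show ?thesis by simp
qed

lemma transfers_term_lift1:
  assumes "transfers (\<lambda>u v. u 0 = g v (u (Suc 0))) (\<lambda>u v. u 0 = h v (u (Suc 0)))"
    and "transfers_term t s"
  shows "transfers_term (\<lambda>u v. g v (t u v)) (\<lambda>u v. h v (s u v))"
proof -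
  \<comment> \<open>The renaming \<open>1 - i\<close>, with truncated subtraction, swaps variables
    \<open>0\<close> and \<open>1\<close>: below the binder the argument is the bound variable
    \<open>0\<close> and the value has moved to \<open>1\<close>.\<close>
  have "transfers (\<lambda>u v. u (Suc 0) = g v (u 0)) (\<lambda>u v. u (Suc 0) = h v (u 0))"
    using transfers_rename[OF assms(1), of "\<lambda>i. 1 - i" "\<lambda>i. i"] by simp
  note * = transfers_rename[OF this, of "case_nat 0 (\<lambda>i. Suc 0)" "\<lambda>i. i"]
  have "transfers (\<lambda>u v. \<exists>x. x = t (\<lambda>i. u (Suc i)) v \<and> u 0 = g v x)
    (\<lambda>u v. \<exists>x. x = s (\<lambda>i. u (Suc i)) v \<and> u 0 = h v x)"
    using * by (intro transfers_ex transfers_conj transfers_term_eq[OF assms(2)]) simp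
  then show ?thesis unfolding transfers_term_def by simp
qed

lemma transfers_term_lift2:
  assumes "transfers (\<lambda>u v. u 0 = g v (u (Suc 0)) (u (Suc (Suc 0))))
      (\<lambda>u v. u 0 = h v (u (Suc 0)) (u (Suc (Suc 0))))"
    and "transfers_term t s" "transfers_term t' s'"
  shows "transfers_term (\<lambda>u v. g v (t u v) (t' u v)) (\<lambda>u v. h v (s u v) (s' u v))"
proof -
  \<comment> \<open>Under two binders the inner variable \<open>0\<close> is the second argument,
    \<open>1\<close> is the first, and the value has moved to \<open>2\<close>.\<close>
  note * = transfers_rename[OF assms(1),
      of "case_nat (Suc (Suc 0)) (case_nat (Suc 0) (\<lambda>i. 0))" "\<lambda>i. i"]
  have "transfers (\<lambda>u v. \<exists>x. x = t (\<lambda>i. u (Suc i)) v \<and>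
      (\<exists>y. y = t' (\<lambda>i. u (Suc i)) v \<and> u 0 = g v x y))
    (\<lambda>u v. \<exists>x. x = s (\<lambda>i. u (Suc i)) v \<and>
      (\<exists>y. y = s' (\<lambda>i. u (Suc i)) v \<and> u 0 = h v x y))"
    using * by (intro transfers_ex transfers_conj transfers_term_eq[OF assms(2)] transfers_term_eq[OF assms(3)]) simp
  then show ?thesis unfolding transfers_term_def by simp
qed

section \<open>Atomic relations and field operations\<close>

lemma transfers_eq_vars: "transfers (\<lambda>u v. u i = u j) (\<lambda>u v. u i = u j)"
proof -
  have "transfers (\<lambda>u v. u 0 = u (Suc 0)) (\<lambda>u v. u 0 = u (Suc 0))"
    by (rule transfersI[where n = 2 and k = 0 and R = "\<lambda>xs fs. xs ! 0 = xs ! 1"])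
      (simp_all add: star_eq[simplified] numeral_2_eq_2)
  from transfers_rename[OF this, where \<rho> = "case_nat i (\<lambda>_. j)"] show ?thesis by simp
qed

lemma transfers_le_vars: "transfers (\<lambda>u v. u i \<le> u j) (\<lambda>u v. u i \<le> u j)"
proof -
  have "transfers (\<lambda>u v. u 0 \<le> u (Suc 0)) (\<lambda>u v. u 0 \<le> u (Suc 0))"
    by (rule transfersI[where n = 2 and k = 0 and R = "\<lambda>xs fs. xs ! 0 \<le> xs ! 1"])
      (simp_all add: star_le[simplified] numeral_2_eq_2)
  from transfers_rename[OF this, where \<rho> = "case_nat i (\<lambda>_. j)"] show ?thesis by simp
qed

lemma transfers_plus_vars: "transfers (\<lambda>u v. u i + u j = u k) (\<lambda>u v. u i + u j = u k)"
proof -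
  have "transfers (\<lambda>u v. u 0 + u (Suc 0) = u (Suc (Suc 0))) (\<lambda>u v. u 0 + u (Suc 0) = u (Suc (Suc 0)))"
    by (rule transfersI[where n = 3 and k = 0 and R = "\<lambda>xs fs. xs ! 0 + xs ! 1 = xs ! 2"])
      (simp_all add: star_plus[unfolded One_nat_def numeral_2_eq_2] numeral_3_eq_3 numeral_2_eq_2)
  from transfers_rename[OF this, where \<rho> = "case_nat i (case_nat j (\<lambda>_. k))"] show ?thesis by simp
qed

lemma transfers_times_vars: "transfers (\<lambda>u v. u i * u j = u k) (\<lambda>u v. u i * u j = u k)"
proof -
  have "transfers (\<lambda>u v. u 0 * u (Suc 0) = u (Suc (Suc 0))) (\<lambda>u v. u 0 * u (Suc 0) = u (Suc (Suc 0)))"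
    by (rule transfersI[where n = 3 and k = 0 and R = "\<lambda>xs fs. xs ! 0 * xs ! 1 = xs ! 2"])
      (simp_all add: star_times[unfolded One_nat_def numeral_2_eq_2] numeral_3_eq_3 numeral_2_eq_2)
  from transfers_rename[OF this, where \<rho> = "case_nat i (case_nat j (\<lambda>_. k))"] show ?thesis by simp
qed

lemma transfers_app_vars: "transfers (\<lambda>u v. u i = v j (u k)) (\<lambda>u v. u i = v j (u k))"
proof -
  have "transfers (\<lambda>u v. v 0 (u 0) = u (Suc 0)) (\<lambda>u v. v 0 (u 0) = u (Suc 0))"
    by (rule transfersI[where n = 2 and k = 1 and R = "\<lambda>xs fs. (fs ! 0) (xs ! 0) = xs ! 1"])
      (auto simp add: star_app[simplified] numeral_2_eq_2 image_subset_iff)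
  from transfers_rename[OF this, where \<rho> = "case_nat k (\<lambda>_. i)" and \<sigma> = "\<lambda>_. j"] show ?thesis
    by (simp add: eq_commute)
qed

lemma transfers_eq:
  assumes "transfers_term t s" "transfers_term t' s'"
  shows "transfers (\<lambda>u v. t u v = t' u v) (\<lambda>u v. s u v = s' u v)"
  by (rule transfers_lift2[where R = "\<lambda>_. (=)" and S = "\<lambda>_. (=)", OF transfers_eq_vars assms])

lemma transfers_le:
  assumes "transfers_term t s" "transfers_term t' s'"
  shows "transfers (\<lambda>u v. t u v \<le> t' u v) (\<lambda>u v. s u v \<le> s' u v)"
  by (rule transfers_lift2[where R = "\<lambda>_. (\<le>)" and S = "\<lambda>_. (\<le>)", OF transfers_le_vars assms])

lemma transfers_less:
  assumes "transfers_term t s" "transfers_term t' s'"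
  shows "transfers (\<lambda>u v. t u v < t' u v) (\<lambda>u v. s u v < s' u v)"
  unfolding not_le[symmetric] by (intro transfers_not transfers_le assms)

lemma transfers_term_var: "transfers_term (\<lambda>u v. u i) (\<lambda>u v. u i)"
  unfolding transfers_term_def by (rule transfers_eq_vars)

lemma transfers_term_app:
  "transfers_term t s \<Longrightarrow> transfers_term (\<lambda>u v. v j (t u v)) (\<lambda>u v. v j (s u v))"
  by (rule transfers_term_lift1[OF transfers_app_vars])

lemma transfers_term_add:
  assumes "transfers_term t s" "transfers_term t' s'"
  shows "transfers_term (\<lambda>u v. t u v + t' u v) (\<lambda>u v. s u v + s' u v)"
proof -
  have "transfers (\<lambda>u v. u 0 = u (Suc 0) + u (Suc (Suc 0))) (\<lambda>u v. u 0 = u (Suc 0) + u (Suc (Suc 0)))"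
    using transfers_plus_vars[of "Suc 0" "Suc (Suc 0)" 0] by (simp add: eq_commute)
  from transfers_term_lift2[OF this assms] show ?thesis .
qed

lemma transfers_term_mult:
  assumes "transfers_term t s" "transfers_term t' s'"
  shows "transfers_term (\<lambda>u v. t u v * t' u v) (\<lambda>u v. s u v * s' u v)"
proof -
  have "transfers (\<lambda>u v. u 0 = u (Suc 0) * u (Suc (Suc 0))) (\<lambda>u v. u 0 = u (Suc 0) * u (Suc (Suc 0)))"
    using transfers_times_vars[of "Suc 0" "Suc (Suc 0)" 0] by (simp add: eq_commute)
  from transfers_term_lift2[OF this assms] show ?thesis .
qed

lemma transfers_term_power2:
  assumes "transfers_term t s"
  shows "transfers_term (\<lambda>u v. (t u v)\<^sup>2) (\<lambda>u v. (s u v)\<^sup>2)"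
  unfolding power2_eq_square by (intro transfers_term_mult assms)

lemma transfers_term_diff:
  assumes "transfers_term t s" "transfers_term t' s'"
  shows "transfers_term (\<lambda>u v. t u v - t' u v) (\<lambda>u v. s u v - s' u v)"
proof -
  have "transfers (\<lambda>u v. u 0 = u (Suc 0) - u (Suc (Suc 0))) (\<lambda>u v. u 0 = u (Suc 0) - u (Suc (Suc 0)))"
    using transfers_plus_vars[of 0 "Suc (Suc 0)" "Suc 0"] by (simp add: eq_diff_eq)
  from transfers_term_lift2[OF this assms] show ?thesis .
qed

lemma transfers_term_0: "transfers_term (\<lambda>u v. 0) (\<lambda>u v. 0)"
  unfolding transfers_term_def using transfers_plus_vars[of 0 0 0] by simp

text \<open>No axiom names the unit, but in any field it is the only nonzero idempotent, which is
  expressible through multiplication and \<open>0\<close>.\<close>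

lemma transfers_term_1: "transfers_term (\<lambda>u v. 1) (\<lambda>u v. 1)"
proof -
  have "transfers (\<lambda>u v. u 0 * u 0 = u 0 \<and> u 0 \<noteq> 0) (\<lambda>u v. u 0 * u 0 = u 0 \<and> u 0 \<noteq> 0)"
    by (intro transfers_conj transfers_not transfers_eq transfers_times_vars transfers_term_var
        transfers_term_0)
  moreover have eq: "x * x = x \<and> x \<noteq> 0 \<longleftrightarrow> x = 1" for x :: "'b::field"
    by auto
  ultimately show ?thesis unfolding transfers_term_def by (simp only: eq)
qed

lemma transfers_term_uminus:
  assumes "transfers_term t s"
  shows "transfers_term (\<lambda>u v. - t u v) (\<lambda>u v. - s u v)"
  using transfers_term_diff[OF transfers_term_0 assms] by simp

lemma transfers_term_numeral: "transfers_term (\<lambda>u v. numeral w) (\<lambda>u v. numeral w)"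
  by (induction w) (auto simp only: numeral.simps intro!: transfers_term_1 transfers_term_add)

lemma transfers_term_if:
  assumes "transfers P Q" "transfers_term t s" "transfers_term t' s'"
  shows "transfers_term (\<lambda>u v. if P u v then t u v else t' u v) (\<lambda>u v. if Q u v then s u v else s' u v)"
proof -
  have P: "transfers (\<lambda>u v. P (\<lambda>i. u (Suc i)) v) (\<lambda>u v. Q (\<lambda>i. u (Suc i)) v)"
    using transfers_rename[OF assms(1), of Suc "\<lambda>i. i"] .
  have "transfers (\<lambda>u v. (P (\<lambda>i. u (Suc i)) v \<longrightarrow> u 0 = t (\<lambda>i. u (Suc i)) v) \<and>
      (\<not> P (\<lambda>i. u (Suc i)) v \<longrightarrow> u 0 = t' (\<lambda>i. u (Suc i)) v))
    (\<lambda>u v. (Q (\<lambda>i. u (Suc i)) v \<longrightarrow> u 0 = s (\<lambda>i. u (Suc i)) v) \<and>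
      (\<not> Q (\<lambda>i. u (Suc i)) v \<longrightarrow> u 0 = s' (\<lambda>i. u (Suc i)) v))"
    by (intro transfers_conj transfers_imp transfers_not P assms(2,3)[unfolded transfers_term_def])
  then show ?thesis unfolding transfers_term_def by (simp only: if_split[of "\<lambda>x. _ = x"])
qed

lemma transfers_term_abs:
  assumes "transfers_term t s"
  shows "transfers_term (\<lambda>u v. \<bar>t u v\<bar>) (\<lambda>u v. \<bar>s u v\<bar>)"
  unfolding abs_if
  by (intro transfers_term_if transfers_less transfers_term_uminus transfers_term_0 assms)

text \<open>The convention \<open>x / 0 = 0\<close> holds in both fields, so the graph of division,
  zero divisors included, is definable from multiplication.\<close>

lemma transfers_term_divide:
  assumes "transfers_term t s" "transfers_term t' s'"
  shows "transfers_term (\<lambda>u v. t u v / t' u v) (\<lambda>u v. s u v / s' u v)"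
proof -
  have eq: "x = y / z \<longleftrightarrow> (if z = 0 then x = 0 else x * z = y)" for x y z :: "'b::field"
    by (simp add: eq_divide_eq)
  have "transfers (\<lambda>u v. (u 2 = 0 \<longrightarrow> u 0 = 0) \<and> (\<not> u 2 = 0 \<longrightarrow> u 0 * u 2 = u (Suc 0)))
     (\<lambda>u v. (u 2 = 0 \<longrightarrow> u 0 = 0) \<and> (\<not> u 2 = 0 \<longrightarrow> u 0 * u 2 = u (Suc 0)))"
    by (intro transfers_conj transfers_imp transfers_not transfers_eq transfers_times_vars
        transfers_term_var transfers_term_0)
  then have "transfers (\<lambda>u v. u 0 = u (Suc 0) / u (Suc (Suc 0))) (\<lambda>u v. u 0 = u (Suc 0) / u (Suc (Suc 0)))"
    unfolding eq if_bool_eq_conj numeral_2_eq_2 .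
  from transfers_term_lift2[OF this assms] show ?thesis .
qed

text \<open>Here a parameter enters: the unary relation of being equal to \<open>c\<close> is
  compared with binary equality under a valuation that holds \<open>star_real c\<close> at variable
  \<open>1\<close>, a position pinned to a standard value.\<close>

lemma transfers_term_star_real: "transfers_term (\<lambda>u v. c) (\<lambda>u v. star_real c)"
  unfolding transfers_term_def
proof (rule transfersI[where n = 1 and k = 0 and R = "\<lambda>xs fs. xs ! 0 = c"])
  fix u :: "nat \<Rightarrow> 'a" and v :: "nat \<Rightarrow> 'a \<Rightarrow> 'a"
  have "sat (Iff (Rel (\<lambda>xs fs. xs ! 0 = c) [0] []) (Rel (\<lambda>xs fs. xs ! 0 = xs ! 1) [0, 1] []))
     star_rel internal (\<lambda>i. if i = 0 then u 0 else star_real c) (\<lambda>_. star_fun (\<lambda>_. 0))"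
    by (rule transfer_valid[where n = 1 and k = 0 and c = "\<lambda>_. c" and d = "\<lambda>_ _. 0"])
      (auto simp: internal_star_fun)
  then show "u 0 = star_real c \<longleftrightarrow> star_rel (\<lambda>xs fs. xs ! 0 = c) (map u [0..<1]) (map v [0..<0])"
    by (simp add: star_eq[simplified])
qed simp

lemma transfers_term_star_fun:
  assumes "transfers_term t s"
  shows "transfers_term (\<lambda>u v. g (t u v)) (\<lambda>u v. star_fun g (s u v))"
proof -
  have "transfers (\<lambda>u v. u 0 = g (u (Suc 0))) (\<lambda>u v. (u 0 :: 'a) = star_fun g (u (Suc 0)))"
  proof (rule transfersI[where n = 2 and k = 0 and R = "\<lambda>xs fs. xs ! 0 = g (xs ! 1)"])
    fix u :: "nat \<Rightarrow> 'a" and v :: "nat \<Rightarrow> 'a \<Rightarrow> 'a"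
    have "sat (Iff (Rel (\<lambda>xs fs. xs ! 0 = g (xs ! 1)) [0, 1] [])
        (Rel (\<lambda>xs fs. (fs ! 0) (xs ! 0) = xs ! 1) [1, 0] [0]))
       star_rel internal (\<lambda>i. if i < 2 then u i else star_real 0) (\<lambda>_. star_fun g)"
      by (rule transfer_valid[where n = 2 and k = 0 and c = "\<lambda>_. 0" and d = "\<lambda>_. g"])
        (auto simp: internal_star_fun)
    then show "u 0 = star_fun g (u (Suc 0)) \<longleftrightarrow>
        star_rel (\<lambda>xs fs. xs ! 0 = g (xs ! 1)) (map u [0..<2]) (map v [0..<0])"
      by (auto simp add: star_app[simplified] internal_star_fun numeral_2_eq_2)
  qed (simp add: numeral_2_eq_2)
  from transfers_term_lift1[OF this assms] show ?thesis .
qed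

section \<open>Hypernaturals, hyperintegers and hyperfinite operations\<close>

lemma transfers_hypernats:
  assumes "transfers_term t s"
  shows "transfers (\<lambda>u v. t u v \<in> \<nat>) (\<lambda>u v. s u v \<in> hypernats)"
proof -
  have "transfers (\<lambda>u v. u 0 \<in> \<nat>) (\<lambda>u v. u 0 \<in> hypernats)"
    by (rule transfersI[where n = 1 and k = 0 and R = "\<lambda>xs fs. xs ! 0 \<in> \<nat>"])
      (simp_all add: hypernats_def)
  from transfers_lift1[OF this assms] show ?thesis .
qed

lemma transfers_hyperints:
  assumes "transfers_term t s"
  shows "transfers (\<lambda>u v. t u v \<in> \<int>) (\<lambda>u v. s u v \<in> hyperints)"
proof -
  have "transfers (\<lambda>u v. u 0 \<in> \<int>) (\<lambda>u v. u 0 \<in> hyperints)"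
    by (rule transfersI[where n = 1 and k = 0 and R = "\<lambda>xs fs. xs ! 0 \<in> \<int>"])
      (simp_all add: hyperints_def)
  from transfers_lift1[OF this assms] show ?thesis .
qed

lemma transfers_ball_hypernats:
  assumes "transfers (\<lambda>u v. P (\<lambda>i. u (Suc i)) v (u 0)) (\<lambda>u v. Q (\<lambda>i. u (Suc i)) v (u 0))"
  shows "transfers (\<lambda>u v. \<forall>x\<in>\<nat>. P u v x) (\<lambda>u v. \<forall>x\<in>hypernats. Q u v x)"
  unfolding Ball_def
  by (intro transfers_all transfers_imp transfers_hypernats transfers_term_var assms)

lemma transfers_ball_hyperints:
  assumes "transfers (\<lambda>u v. P (\<lambda>i. u (Suc i)) v (u 0)) (\<lambda>u v. Q (\<lambda>i. u (Suc i)) v (u 0))"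
  shows "transfers (\<lambda>u v. \<forall>x\<in>\<int>. P u v x) (\<lambda>u v. \<forall>x\<in>hyperints. Q u v x)"
  unfolding Ball_def
  by (intro transfers_all transfers_imp transfers_hyperints transfers_term_var assms)

lemma transfers_bex_hypernats:
  assumes "transfers (\<lambda>u v. P (\<lambda>i. u (Suc i)) v (u 0)) (\<lambda>u v. Q (\<lambda>i. u (Suc i)) v (u 0))"
  shows "transfers (\<lambda>u v. \<exists>x\<in>\<nat>. P u v x) (\<lambda>u v. \<exists>x\<in>hypernats. Q u v x)"
  unfolding Bex_def
  by (intro transfers_ex transfers_conj transfers_hypernats transfers_term_var assms)

lemma transfers_bex_hyperints:
  assumes "transfers (\<lambda>u v. P (\<lambda>i. u (Suc i)) v (u 0)) (\<lambda>u v. Q (\<lambda>i. u (Suc i)) v (u 0))"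
  shows "transfers (\<lambda>u v. \<exists>x\<in>\<int>. P u v x) (\<lambda>u v. \<exists>x\<in>hyperints. Q u v x)"
  unfolding Bex_def
  by (intro transfers_ex transfers_conj transfers_hyperints transfers_term_var assms)

text \<open>\<open>star_op\<close> is a definite description, so its graph must first be known to be
  total and single-valued. Both properties are statements about the graph of \<open>\<Phi>\<close>
  and are themselves obtained by transfer.\<close>

lemma transfers_star_op:
  "transfers (\<lambda>u v. u 0 = \<Phi> (map (\<lambda>i. u (Suc i)) [0..<n]) (map v [0..<k]))
    (\<lambda>u v. u 0 = star_op \<Phi> (map (\<lambda>i. u (Suc i)) [0..<n]) (map v [0..<k]))"
proof (rule transfersI[where n = "Suc n" and k = k and R = "\<lambda>zs gs. zs ! 0 = \<Phi> (tl zs) gs"])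
  let ?R = "\<lambda>zs gs. zs ! 0 = \<Phi> (tl zs) gs"
  have upt: "map w [0..<Suc n] = w 0 # map (\<lambda>i. w (Suc i)) [0..<n]" for w :: "nat \<Rightarrow> 'c"
  proof -
    have "case_nat (w 0) (\<lambda>i. w (Suc i)) = w" by (auto simp: fun_eq_iff split: nat.split)
    then show ?thesis using map_case_nat_upt[of "w 0" "\<lambda>i. w (Suc i)" n] by (simp only:)
  qed
  show "u 0 = \<Phi> (map (\<lambda>i. u (Suc i)) [0..<n]) (map v [0..<k]) \<longleftrightarrow> ?R (map u [0..<Suc n]) (map v [0..<k])"
    for u v unfolding upt by simp
  fix u :: "nat \<Rightarrow> 'a" and v :: "nat \<Rightarrow> 'a \<Rightarrow> 'a" assume v: "range v \<subseteq> internal"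
  have R: "transfers (\<lambda>u v. u 0 = \<Phi> (map (\<lambda>i. u (Suc i)) [0..<n]) (map v [0..<k]))
      (\<lambda>u v. star_rel ?R (map u [0..<Suc n]) (map v [0..<k]))"
    by (rule transfersI[where R = ?R and n = "Suc n" and k = k]) (simp_all add: upt del: upt_Suc)
  note R' = transfers_rename[OF R, of "case_nat (Suc 0) (\<lambda>i. Suc (Suc i))" "\<lambda>i. i"]
  note R'' = transfers_rename[OF R, of "case_nat 0 (\<lambda>i. Suc (Suc i))" "\<lambda>i. i"]
  let ?S = "\<lambda>y. star_rel ?R (y # map (\<lambda>i. u (Suc i)) [0..<n]) (map v [0..<k])"
  have "\<exists>y. ?S y"
  proof (rule transfers_valid[where P = "\<lambda>u v. \<exists>y. y = \<Phi> (map (\<lambda>i. u (Suc i)) [0..<n]) (map v [0..<k])"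
        and Q = "\<lambda>u v. \<exists>y. star_rel ?R (y # map (\<lambda>i. u (Suc i)) [0..<n]) (map v [0..<k])", OF _ _ v])
    show "transfers (\<lambda>u v. \<exists>y. y = \<Phi> (map (\<lambda>i. u (Suc i)) [0..<n]) (map v [0..<k]))
      (\<lambda>u v. \<exists>y. star_rel ?R (y # map (\<lambda>i. u (Suc i)) [0..<n]) (map v [0..<k]))"
      using R'' by (intro transfers_ex) (simp add: upt del: upt_Suc)
  qed simp
  moreover have "\<forall>y z. ?S y \<longrightarrow> ?S z \<longrightarrow> y = z"
  proof (rule transfers_valid[where P = "\<lambda>u v. \<forall>y z. y = \<Phi> (map (\<lambda>i. u (Suc i)) [0..<n]) (map v [0..<k])
        \<longrightarrow> z = \<Phi> (map (\<lambda>i. u (Suc i)) [0..<n]) (map v [0..<k]) \<longrightarrow> y = z"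
        and Q = "\<lambda>u v. \<forall>y z. star_rel ?R (y # map (\<lambda>i. u (Suc i)) [0..<n]) (map v [0..<k])
        \<longrightarrow> star_rel ?R (z # map (\<lambda>i. u (Suc i)) [0..<n]) (map v [0..<k]) \<longrightarrow> y = z", OF _ _ v])
    note R1 = transfers_rename[OF R, of "case_nat 0 (\<lambda>i. Suc (Suc (Suc i)))" "\<lambda>i. i"]
    note R2 = transfers_rename[OF R, of "case_nat (Suc 0) (\<lambda>i. Suc (Suc (Suc i)))" "\<lambda>i. i"]
    show "transfers (\<lambda>u v. \<forall>y z. y = \<Phi> (map (\<lambda>i. u (Suc i)) [0..<n]) (map v [0..<k])
        \<longrightarrow> z = \<Phi> (map (\<lambda>i. u (Suc i)) [0..<n]) (map v [0..<k]) \<longrightarrow> y = z)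
      (\<lambda>u v. \<forall>y z. star_rel ?R (y # map (\<lambda>i. u (Suc i)) [0..<n]) (map v [0..<k])
        \<longrightarrow> star_rel ?R (z # map (\<lambda>i. u (Suc i)) [0..<n]) (map v [0..<k]) \<longrightarrow> y = z)"
      using R1 R2
      by (intro transfers_all transfers_imp transfers_eq_vars) (simp_all add: upt del: upt_Suc)
  qed simp
  ultimately have S: "\<exists>!y. ?S y" by blast
  have "?S (star_op \<Phi> (map (\<lambda>i. u (Suc i)) [0..<n]) (map v [0..<k]))"
    unfolding star_op_def by (rule theI'[OF S])
  then show "u 0 = star_op \<Phi> (map (\<lambda>i. u (Suc i)) [0..<n]) (map v [0..<k]) \<longleftrightarrow>
      star_rel ?R (map u [0..<Suc n]) (map v [0..<k])"
    unfolding upt using S by auto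
qed

lemma transfers_term_hyperpow:
  assumes "transfers_term t s" "transfers_term t' s'"
  shows "transfers_term (\<lambda>u v. t u v ^ nat \<lfloor>t' u v\<rfloor>) (\<lambda>u v. hyperpow (s u v) (s' u v))"
proof -
  have "transfers (\<lambda>u v. u 0 = u (Suc 0) ^ nat \<lfloor>u (Suc (Suc 0))\<rfloor>)
      (\<lambda>u v. u 0 = hyperpow (u (Suc 0)) (u (Suc (Suc 0))))"
    using transfers_star_op[of "\<lambda>xs fs. (xs ! 0) ^ nat \<lfloor>xs ! 1\<rfloor>" "Suc (Suc 0)" 0]
    by (simp add: hyperpow_def)
  from transfers_term_lift2[OF this assms] show ?thesis .
qed

lemma transfers_term_hyperfact:
  assumes "transfers_term t s"
  shows "transfers_term (\<lambda>u v. fact (nat \<lfloor>t u v\<rfloor>)) (\<lambda>u v. hyperfact (s u v))"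
proof -
  have "transfers (\<lambda>u v. u 0 = fact (nat \<lfloor>u (Suc 0)\<rfloor>)) (\<lambda>u v. u 0 = hyperfact (u (Suc 0)))"
    using transfers_star_op[of "\<lambda>xs fs. fact (nat \<lfloor>xs ! 0\<rfloor>)" "Suc 0" 0]
    by (simp add: hyperfact_def)
  from transfers_term_lift1[OF this assms] show ?thesis .
qed

lemma transfers_term_hypersum:
  assumes "transfers_term t s" "transfers_term t' s'"
  shows "transfers_term (\<lambda>u v. \<Sum>k\<in>{\<lfloor>t u v\<rfloor>..\<lfloor>t' u v\<rfloor>}. v j (of_int k))
    (\<lambda>u v. hypersum (v j) (s u v) (s' u v))"
proof -
  have "transfers (\<lambda>u v. u 0 = (\<Sum>k\<in>{\<lfloor>u (Suc 0)\<rfloor>..\<lfloor>u (Suc (Suc 0))\<rfloor>}. v 0 (of_int k)))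
      (\<lambda>u v. u 0 = hypersum (v 0) (u (Suc 0)) (u (Suc (Suc 0))))"
    using transfers_star_op[of
        "\<lambda>xs fs. \<Sum>k\<in>{\<lfloor>xs ! 0\<rfloor>..\<lfloor>xs ! 1\<rfloor>}. (fs ! 0) (of_int k)" "Suc (Suc 0)" "Suc 0"]
    by (simp add: hypersum_def)
  from transfers_term_lift2[where g = "\<lambda>v x y. \<Sum>k\<in>{\<lfloor>x\<rfloor>..\<lfloor>y\<rfloor>}. v j (of_int k)"
      and h = "\<lambda>v. hypersum (v j)", OF transfers_rename[OF this, of "\<lambda>i. i" "\<lambda>_. j"] assms]
  show ?thesis .
qed

text \<open>The rules take a standard statement and its nonstandard counterpart apart in parallel,
  so the pair dictates how each symbol is read: \<open>c\<close> against \<open>star_real c\<close>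
  is a constant, a floor exponent against \<open>hyperpow\<close> is a hyperpower.\<close>

lemmas transfer_intros =
  transfers_not transfers_conj transfers_disj transfers_imp
  transfers_ball_hypernats transfers_ball_hyperints transfers_bex_hypernats transfers_bex_hyperints
  transfers_ball_internal transfers_bex_internal transfers_all transfers_ex
  transfers_eq transfers_le transfers_less transfers_hypernats transfers_hyperints
  transfers_term_var transfers_term_0 transfers_term_1 transfers_term_numeral
  transfers_term_app transfers_term_star_real transfers_term_star_fun
  transfers_term_add transfers_term_diff transfers_term_uminus transfers_term_mult
  transfers_term_divide transfers_term_power2 transfers_term_abs transfers_term_if
  transfers_term_hyperpow transfers_term_hyperfact transfers_term_hypersum

subsection \<open>Hyperreal numbers\<close>

text \<open>Reflexivity is read asymmetrically: \<open>x + y\<close> on the left is one standard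
  constant, on the right a sum of two. The laws for the other operations and for numerals arise in
  the same way.\<close>

lemma star_real_add: "star_real (x + y) = star_real x + star_real y"
  by (rule transfer_sentence[where 'a = 'a, OF refl[of "x + y"]], (rule transfer_intros)+)

lemma star_real_mult: "star_real (x * y) = star_real x * star_real y"
  by (rule transfer_sentence[where 'a = 'a, OF refl[of "x * y"]], (rule transfer_intros)+)

lemma star_real_diff: "star_real (x - y) = star_real x - star_real y"
  by (rule transfer_sentence[where 'a = 'a, OF refl[of "x - y"]], (rule transfer_intros)+)

lemma star_real_divide: "star_real (x / y) = star_real x / star_real y"
  by (rule transfer_sentence[where 'a = 'a, OF refl[of "x / y"]], (rule transfer_intros)+)

lemma star_real_minus: "star_real (- x) = - star_real x"
  by (rule transfer_sentence[where 'a = 'a, OF refl[of "- x"]], (rule transfer_intros)+)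

lemma star_real_abs: "star_real \<bar>x\<bar> = \<bar>star_real x\<bar>"
  by (rule transfer_sentence[where 'a = 'a, OF refl[of "\<bar>x\<bar>"]], (rule transfer_intros)+)

lemma star_real_0 [simp]: "star_real 0 = 0"
  by (rule transfer_sentence[where 'a = 'a, OF refl[of "0 :: real"]], (rule transfer_intros)+)

lemma star_real_1 [simp]: "star_real 1 = 1"
  by (rule transfer_sentence[where 'a = 'a, OF refl[of "1 :: real"]], (rule transfer_intros)+)

lemma star_real_numeral [simp]: "star_real (numeral w) = numeral w"
  by (rule transfer_sentence[where 'a = 'a, OF refl[of "numeral w :: real"]], (rule transfer_intros)+)

lemma star_real_le_iff [simp]: "star_real x \<le> star_real y \<longleftrightarrow> x \<le> y"
  by (rule transfer_sentence_iff[where 'a = 'a, symmetric], (rule transfer_intros)+)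

lemma star_real_less_iff [simp]: "star_real x < star_real y \<longleftrightarrow> x < y"
  by (rule transfer_sentence_iff[where 'a = 'a, symmetric], (rule transfer_intros)+)

lemma star_real_pos_iff [simp]: "0 < star_real x \<longleftrightarrow> 0 < x"
  using star_real_less_iff[of 0 x] by simp

lemma star_real_nonneg_iff [simp]: "0 \<le> star_real x \<longleftrightarrow> 0 \<le> x"
  using star_real_le_iff[of 0 x] by simp

lemma star_real_of_nat: "star_real (real n) = of_nat n"
  by (induction n) (simp_all add: star_real_add)

lemma star_real_mem_hypernats_iff [simp]: "star_real x \<in> hypernats \<longleftrightarrow> x \<in> \<nat>"
  by (rule transfer_sentence_iff[where 'a = 'a, symmetric], (rule transfer_intros)+)

lemma star_real_mem_hyperints_iff [simp]: "star_real x \<in> hyperints \<longleftrightarrow> x \<in> \<int>"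
  by (rule transfer_sentence_iff[where 'a = 'a, symmetric], (rule transfer_intros)+)

section \<open>Infinite hypernaturals and hyperintegers\<close>

lemma hypernats_le_succ:
  fixes m n :: "'a::nonstandard_extension"
  assumes "m \<in> hypernats" "n \<in> hypernats" "m \<le> n + 1"
  shows "m \<le> n \<or> m = n + 1"
proof -
  have *: "\<forall>m\<in>\<nat>. \<forall>n\<in>\<nat>. m \<le> n + 1 \<longrightarrow> m \<le> n \<or> m = n + (1::real)"
  proof (intro ballI impI)
    fix m n :: real assume "m \<in> \<nat>" "n \<in> \<nat>" "m \<le> n + 1"
    then obtain a b where "m = real a" "n = real b" "m \<le> n + 1" by (auto elim!: Nats_cases)
    then show "m \<le> n \<or> m = n + 1" by auto
  qed
  have "\<forall>m\<in>hypernats. \<forall>n\<in>hypernats. m \<le> n + 1 \<longrightarrow> m \<le> n \<or> m = n + (1::'a)"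
    by (rule transfer_sentence[where 'a = 'a, OF *], (rule transfer_intros)+)
  with assms show ?thesis by blast
qed

lemma hypernats_nonneg: "(m::'a::nonstandard_extension) \<in> hypernats \<Longrightarrow> 0 \<le> m"
proof -
  have *: "\<forall>m\<in>\<nat>. 0 \<le> (m::real)" by (auto elim!: Nats_cases)
  have "\<forall>m\<in>hypernats. 0 \<le> (m::'a)"
    by (rule transfer_sentence[where 'a = 'a, OF *], (rule transfer_intros)+)
  then show "m \<in> hypernats \<Longrightarrow> 0 \<le> m" by blast
qed

lemma of_nat_mem_hypernats: "of_nat n \<in> hypernats"
  by (simp flip: star_real_of_nat)

text \<open>External induction over standard \<open>n\<close>: no hypernatural lies strictly between
  \<open>n\<close> and \<open>n + 1\<close>, so one that avoids all standard values passes each of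
  them.\<close>

lemma hypernats_infinite:
  fixes m :: "'a::nonstandard_extension"
  assumes m: "m \<in> hypernats" "m \<notin> \<nat>"
  shows "star_real r < m"
proof -
  have "\<not> m \<le> of_nat n" for n
  proof (induction n)
    case 0
    then show ?case using hypernats_nonneg[OF m(1)] m(2)
      by (metis Nats_0 antisym of_nat_0)
  next
    case (Suc n)
    have "m \<le> of_nat (Suc n) \<Longrightarrow> m \<le> of_nat n \<or> m = of_nat (Suc n)"
      using hypernats_le_succ[OF m(1) of_nat_mem_hypernats, of n] by (simp add: add.commute)
    then show ?case using Suc m(2) of_nat_in_Nats[of "Suc n"] by metis
  qed
  from this[of "nat \<lceil>\<bar>r\<bar>\<rceil>"] show ?thesis
    unfolding star_real_of_nat[symmetric] not_le
    by (rule le_less_trans[rotated]) (simp, linarith)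
qed

lemma hypernats_infinite_iff:
  fixes m :: "'a::nonstandard_extension"
  assumes "m \<in> hypernats"
  shows "m \<notin> \<nat> \<longleftrightarrow> (\<forall>r. star_real r < m)"
proof
  assume *: "\<forall>r. star_real r < m"
  show "m \<notin> \<nat>"
  proof
    assume "m \<in> \<nat>"
    then obtain n where "m = of_nat n" by (rule Nats_cases)
    then show False using * by (metis less_irrefl star_real_of_nat)
  qed
qed (use hypernats_infinite[OF assms] in blast)

text \<open>The inequality \<open>n \<le> n!\<close> transfers, so the factorial of an infinite
  hypernatural exceeds every standard real.\<close>

lemma hyperfact_infinite:
  fixes n :: "'a::nonstandard_extension"
  assumes n: "n \<in> hypernats" "n \<notin> \<nat>"
  shows "hyperfact n \<in> hypernats" "hyperfact n \<notin> \<nat>"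
proof -
  have *: "\<forall>n\<in>\<nat>. (fact (nat \<lfloor>n\<rfloor>) :: real) \<in> \<nat> \<and> (n::real) \<le> fact (nat \<lfloor>n\<rfloor>)"
  proof
    fix n :: real assume "n \<in> \<nat>"
    then obtain k where k: "n = real k" by (rule Nats_cases)
    have "real k \<le> real (fact k)" by (simp only: of_nat_le_iff fact_ge_self)
    then show "(fact (nat \<lfloor>n\<rfloor>) :: real) \<in> \<nat> \<and> n \<le> fact (nat \<lfloor>n\<rfloor>)"
      using of_nat_in_Nats[of "fact k", where 'a = real] by (simp add: k)
  qed
  have "\<forall>n\<in>hypernats. hyperfact n \<in> hypernats \<and> (n::'a) \<le> hyperfact n"
    by (rule transfer_sentence[where 'a = 'a, OF *], (rule transfer_intros)+)
  then have f: "hyperfact n \<in> hypernats" "n \<le> hyperfact n" using n by auto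
  show "hyperfact n \<in> hypernats" by fact
  show "hyperfact n \<notin> \<nat>"
    using f n by (meson hypernats_infinite_iff less_le_trans)
qed

lemma hyperints_hypernats: "(m::'a::nonstandard_extension) \<in> hypernats \<Longrightarrow> m \<in> hyperints"
proof -
  have *: "\<forall>m\<in>\<nat>. (m::real) \<in> \<int>" using Nats_subset_Ints by blast
  have "\<forall>m\<in>hypernats. (m::'a) \<in> hyperints"
    by (rule transfer_sentence[where 'a = 'a, OF *], (rule transfer_intros)+)
  then show "m \<in> hypernats \<Longrightarrow> m \<in> hyperints" by blast
qed

lemma hyperints_add:
  fixes k l :: "'a::nonstandard_extension"
  assumes "k \<in> hyperints" "l \<in> hyperints"
  shows "k + l \<in> hyperints"
proof -
  have *: "\<forall>k\<in>\<int>. \<forall>l\<in>\<int>. k + l \<in> (\<int> :: real set)" by auto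
  have "\<forall>k\<in>hyperints. \<forall>l\<in>hyperints. k + l \<in> (hyperints :: 'a set)"
    by (rule transfer_sentence[where 'a = 'a, OF *], (rule transfer_intros)+)
  then show ?thesis using assms by blast
qed

lemma hyperints_0_1: "(0::'a::nonstandard_extension) \<in> hyperints" "(1::'a) \<in> hyperints"
  using star_real_mem_hyperints_iff[of 0] star_real_mem_hyperints_iff[of 1] by simp_all

lemma hyperints_discrete:
  fixes k l :: "'a::nonstandard_extension"
  assumes "k \<in> hyperints" "l \<in> hyperints" "k < l"
  shows "k + 1 \<le> l"
proof -
  have *: "\<forall>k\<in>\<int>. \<forall>l\<in>\<int>. k < l \<longrightarrow> k + 1 \<le> (l::real)" 
  proof (intro ballI impI)
    fix m n :: real assume "m \<in> \<int>" "n \<in> \<int>" "m < n"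
    then obtain a b where "m = of_int a" "n = of_int b" "m < n" by (auto elim!: Ints_cases)
    then show "m + 1 \<le> n" by auto
  qed
  have "\<forall>k\<in>hyperints. \<forall>l\<in>hyperints. k < l \<longrightarrow> k + 1 \<le> (l::'a)"
    by (rule transfer_sentence[where 'a = 'a, OF *], (rule transfer_intros)+)
  then show ?thesis using assms by blast
qed

lemma hyperfloor: "\<exists>k\<in>hyperints. k \<le> x \<and> x < k + (1::'a::nonstandard_extension)"
proof -
  have *: "\<forall>x. \<exists>k\<in>\<int>. k \<le> x \<and> x < k + (1::real)"
    by (metis Ints_of_int floor_correct of_int_add of_int_1)
  have "\<forall>x. \<exists>k\<in>hyperints. k \<le> x \<and> x < k + (1::'a)"
    by (rule transfer_sentence[where 'a = 'a, OF *], (rule transfer_intros)+)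
  then show ?thesis by blast
qed

section \<open>Infinitesimals and standard parts\<close>

lemma infinitesimalI:
  assumes "\<And>r. r > 0 \<Longrightarrow> \<bar>x\<bar> \<le> star_real r"
  shows "infinitesimal x"
  unfolding infinitesimal_def
proof (intro allI impI)
  fix r :: real assume "r > 0"
  then have "\<bar>x\<bar> \<le> star_real (r / 2)" by (intro assms) simp
  also have "\<dots> < star_real r" using \<open>r > 0\<close> by simp
  finally show "\<bar>x\<bar> < star_real r" .
qed

lemma infinitesimalD: "infinitesimal x \<Longrightarrow> r > 0 \<Longrightarrow> \<bar>x\<bar> < star_real r"
  by (simp add: infinitesimal_def)

lemma infinitesimal_0 [simp]: "infinitesimal 0"
  by (simp add: infinitesimal_def)

lemma infinitesimal_le: "infinitesimal x \<Longrightarrow> \<bar>y\<bar> \<le> \<bar>x\<bar> \<Longrightarrow> infinitesimal y"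
  unfolding infinitesimal_def using le_less_trans by blast

lemma infinitesimal_add:
  assumes "infinitesimal x" "infinitesimal y"
  shows "infinitesimal (x + y)"
proof (rule infinitesimalI)
  fix r :: real assume "r > 0"
  then have "\<bar>x\<bar> < star_real (r / 2)" "\<bar>y\<bar> < star_real (r / 2)"
    using assms by (simp_all add: infinitesimal_def)
  then have "\<bar>x + y\<bar> \<le> star_real (r / 2) + star_real (r / 2)" by linarith
  then show "\<bar>x + y\<bar> \<le> star_real r" by (simp flip: star_real_add)
qed

lemma infinitesimal_minus [simp]: "infinitesimal (- x) \<longleftrightarrow> infinitesimal x"
  by (simp add: infinitesimal_def)

lemma infinitesimal_mult_limited:
  assumes x: "infinitesimal x" and y: "limited y"
  shows "infinitesimal (x * y)"
proof (rule infinitesimalI)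
  fix r :: real assume r: "r > 0"
  obtain c where c: "\<bar>y\<bar> \<le> star_real c" using y by (auto simp: limited_def)
  then have "c \<ge> 0" by (metis abs_ge_zero order_trans star_real_nonneg_iff)
  \<comment> \<open>The bound \<open>c\<close> may be \<open>0\<close>, whereas \<open>c + 1\<close>
    can be divided by.\<close>
  then have c1: "c + 1 > 0" by simp
  have "\<bar>x\<bar> \<le> star_real (r / (c + 1))" "\<bar>y\<bar> \<le> star_real (c + 1)"
    using infinitesimalD[OF x, of "r / (c + 1)"] r c1 c
    by (auto intro: less_imp_le order_trans[OF c])
  then have "\<bar>x * y\<bar> \<le> star_real (r / (c + 1)) * star_real (c + 1)"
    unfolding abs_mult by (intro mult_mono) (use r c1 in auto)
  then show "\<bar>x * y\<bar> \<le> star_real r" using c1 by (simp flip: star_real_mult)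
qed

lemma infinitesimal_star_real: "infinitesimal (star_real r) \<longleftrightarrow> r = 0"
proof
  assume *: "infinitesimal (star_real r)"
  show "r = 0"
  proof (rule ccontr)
    assume "r \<noteq> 0"
    then show False using infinitesimalD[OF *, of "\<bar>r\<bar>"] unfolding star_real_abs by simp
  qed
qed simp

lemma infinitesimal_inverse_infinite:
  assumes "\<And>r. star_real r < m"
  shows "infinitesimal (1 / m)"
proof (rule infinitesimalI)
  fix r :: real assume r: "r > 0"
  have m: "star_real (1 / r) < m" "0 < m" using assms[of "1 / r"] assms[of 0] by simp_all
  then have "1 < m * star_real r" using r by (simp add: star_real_divide divide_simps)
  then show "\<bar>1 / m\<bar> \<le> star_real r" using m by (simp add: divide_simps mult.commute)
qed

lemma near_sym: "x near y \<Longrightarrow> y near x"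
  unfolding near_def using infinitesimal_minus[of "x - y"] by simp

lemma near_trans: "x near y \<Longrightarrow> y near z \<Longrightarrow> x near z"
  unfolding near_def using infinitesimal_add[of "x - y" "y - z"] by simp

lemma limited_star_real [simp]: "limited (star_real r)"
  unfolding limited_def using order_refl by (metis star_real_abs)

lemma infinitesimal_imp_limited: "infinitesimal x \<Longrightarrow> limited x"
  unfolding limited_def infinitesimal_def using less_imp_le zero_less_one by blast

lemma limited_add: "limited x \<Longrightarrow> limited y \<Longrightarrow> limited (x + y)"
  unfolding limited_def
proof (elim exE)
  fix r s assume "\<bar>x\<bar> \<le> star_real r" "\<bar>y\<bar> \<le> star_real s"
  then have "\<bar>x + y\<bar> \<le> star_real (r + s)" unfolding star_real_add by linarith
  then show "\<exists>r. \<bar>x + y\<bar> \<le> star_real r" ..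
qed

lemma near_limited: "x near y \<Longrightarrow> limited y \<Longrightarrow> limited x"
  using limited_add[of "x - y" y] infinitesimal_imp_limited[of "x - y"] by (simp add: near_def)

lemma near_star_real_unique: "x near star_real r \<Longrightarrow> x near star_real s \<Longrightarrow> r = s"
  using near_trans[OF near_sym] infinitesimal_star_real[of "r - s"]
  by (metis near_def star_real_diff eq_iff_diff_eq_0)

lemma st_eq: "x near star_real r \<Longrightarrow> st x = r"
  unfolding st_def using near_star_real_unique by blast

lemma near_st:
  assumes "limited x"
  shows "x near star_real (st x)"
proof -
  obtain c where c: "\<bar>x\<bar> \<le> star_real c" using assms by (auto simp: limited_def)
  \<comment> \<open>The standard part is the supremum of the standard reals below \<open>x\<close>;
    completeness of the reals makes it exist.\<close>
  define S where "S = {r. star_real r \<le> x}"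
  have S: "- c \<in> S" "\<And>r. r \<in> S \<Longrightarrow> r \<le> c"
  proof -
    show "- c \<in> S" using c by (simp add: S_def star_real_minus abs_le_iff)
    fix r assume "r \<in> S"
    then show "r \<le> c"
      using order_trans[OF _ order_trans[OF abs_ge_self c], of "star_real r"] by (simp add: S_def)
  qed
  have bdd: "bdd_above S" by (rule bdd_aboveI, rule S(2))
  have "x near star_real (Sup S)"
    unfolding near_def
  proof (rule infinitesimalI)
    fix e :: real assume e: "e > 0"
    have "Sup S + e \<notin> S" using cSup_upper[OF _ bdd, of "Sup S + e"] e by auto
    then have 1: "x < star_real (Sup S) + star_real e" by (simp add: S_def star_real_add)
    obtain r where r: "r \<in> S" "Sup S - e < r"
      using less_cSup_iff[of S "Sup S - e"] S(1) bdd e by auto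
    then have "star_real (Sup S - e) < x"
      using star_real_less_iff[of "Sup S - e" r] unfolding S_def by (metis less_le_trans mem_Collect_eq)
    then have 2: "star_real (Sup S) - star_real e < x" by (simp add: star_real_diff)
    show "\<bar>x - star_real (Sup S)\<bar> \<le> star_real e" using 1 2 by (simp add: abs_le_iff)
  qed
  then show ?thesis using st_eq by metis
qed

subsection \<open>Internal functions\<close>

lemma internal_ext: "\<exists>h\<in>internal. \<forall>x. h x = f x \<Longrightarrow> f \<in> internal"
  by (metis ext)

text \<open>Comprehension is obtained case by case, by transferring the existence of the function in
  question. Its parameters are universally quantified in the standard sentence, so that after
  transfer they may be nonstandard numbers or arbitrary internal functions.\<close>

lemma internal_const: "(\<lambda>_. c :: 'a::nonstandard_extension) \<in> internal"
proof (rule internal_ext)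
  have *: "\<forall>c. \<exists>h. \<forall>x::real. h x = (c::real)" by (intro allI exI) (rule refl)
  have "\<forall>c. \<exists>h\<in>internal. \<forall>x. h x = (c::'a)"
    by (rule transfer_sentence[where 'a = 'a, OF *], (rule transfer_intros)+)
  then show "\<exists>h\<in>internal. \<forall>x. h x = c" by blast
qed

lemma internal_id: "(\<lambda>x. x :: 'a::nonstandard_extension) \<in> internal"
proof (rule internal_ext)
  have *: "\<exists>h. \<forall>x. h x = (x::real)" by (intro allI exI) (rule refl)
  show "\<exists>h\<in>internal. \<forall>x. h x = (x::'a)"
    by (rule transfer_sentence[where 'a = 'a, OF *], (rule transfer_intros)+)
qed

context
  fixes f g :: "'a::nonstandard_extension \<Rightarrow> 'a"
  assumes fg: "f \<in> internal" "g \<in> internal"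
begin

lemma internal_add: "(\<lambda>x. f x + g x) \<in> internal"
proof (rule internal_ext)
  have *: "\<forall>f g :: real \<Rightarrow> real. \<exists>h. \<forall>x. h x = f x + g x" by (intro allI exI) (rule refl)
  have "\<forall>f\<in>internal. \<forall>g\<in>internal. \<exists>h\<in>internal. \<forall>x::'a. h x = f x + g x"
    by (rule transfer_sentence[where 'a = 'a, OF *], (rule transfer_intros)+)
  then show "\<exists>h\<in>internal. \<forall>x. h x = f x + g x" using fg by blast
qed

lemma internal_diff: "(\<lambda>x. f x - g x) \<in> internal"
proof (rule internal_ext)
  have *: "\<forall>f g :: real \<Rightarrow> real. \<exists>h. \<forall>x. h x = f x - g x" by (intro allI exI) (rule refl)
  have "\<forall>f\<in>internal. \<forall>g\<in>internal. \<exists>h\<in>internal. \<forall>x::'a. h x = f x - g x"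
    by (rule transfer_sentence[where 'a = 'a, OF *], (rule transfer_intros)+)
  then show "\<exists>h\<in>internal. \<forall>x. h x = f x - g x" using fg by blast
qed

lemma internal_mult: "(\<lambda>x. f x * g x) \<in> internal"
proof (rule internal_ext)
  have *: "\<forall>f g :: real \<Rightarrow> real. \<exists>h. \<forall>x. h x = f x * g x" by (intro allI exI) (rule refl)
  have "\<forall>f\<in>internal. \<forall>g\<in>internal. \<exists>h\<in>internal. \<forall>x::'a. h x = f x * g x"
    by (rule transfer_sentence[where 'a = 'a, OF *], (rule transfer_intros)+)
  then show "\<exists>h\<in>internal. \<forall>x. h x = f x * g x" using fg by blast
qed

lemma internal_divide: "(\<lambda>x. f x / g x) \<in> internal"
proof (rule internal_ext)
  have *: "\<forall>f g :: real \<Rightarrow> real. \<exists>h. \<forall>x. h x = f x / g x" by (intro allI exI) (rule refl)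
  have "\<forall>f\<in>internal. \<forall>g\<in>internal. \<exists>h\<in>internal. \<forall>x::'a. h x = f x / g x"
    by (rule transfer_sentence[where 'a = 'a, OF *], (rule transfer_intros)+)
  then show "\<exists>h\<in>internal. \<forall>x. h x = f x / g x" using fg by blast
qed

lemma internal_hyperpow: "(\<lambda>x. hyperpow (f x) (g x)) \<in> internal"
proof (rule internal_ext)
  have *: "\<forall>f g :: real \<Rightarrow> real. \<exists>h. \<forall>x. h x = f x ^ nat \<lfloor>g x\<rfloor>" by (intro allI exI) (rule refl)
  have "\<forall>f\<in>internal. \<forall>g\<in>internal. \<exists>h\<in>internal. \<forall>x::'a. h x = hyperpow (f x) (g x)"
    by (rule transfer_sentence[where 'a = 'a, OF *], (rule transfer_intros)+)
  then show "\<exists>h\<in>internal. \<forall>x. h x = hyperpow (f x) (g x)" using fg by blast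
qed

lemma internal_compose: "(\<lambda>x. f (g x)) \<in> internal"
proof (rule internal_ext)
  have *: "\<forall>f g :: real \<Rightarrow> real. \<exists>h. \<forall>x. h x = f (g x)" by (intro allI exI) (rule refl)
  have "\<forall>f\<in>internal. \<forall>g\<in>internal. \<exists>h\<in>internal. \<forall>x::'a. h x = f (g x)"
    by (rule transfer_sentence[where 'a = 'a, OF *], (rule transfer_intros)+)
  then show "\<exists>h\<in>internal. \<forall>x. h x = f (g x)" using fg by blast
qed

end

text \<open>The extended structure has numbers and functions but no sets as objects, so internal
  sets are coded by their indicator functions.\<close>

definition internal_pred :: "('a::nonstandard_extension \<Rightarrow> bool) \<Rightarrow> bool" where
  "internal_pred P \<longleftrightarrow> (\<lambda>x. if P x then 1 else 0) \<in> internal"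

lemma internal_if:
  fixes f g :: "'a::nonstandard_extension \<Rightarrow> 'a"
  assumes "internal_pred P" "f \<in> internal" "g \<in> internal"
  shows "(\<lambda>x. if P x then f x else g x) \<in> internal"
proof (rule internal_ext)
  have *: "\<forall>p f g :: real \<Rightarrow> real. \<exists>h. \<forall>x. h x = (if p x = 1 then f x else g x)"
    by (intro allI exI) (rule refl)
  have "\<forall>p\<in>internal. \<forall>f\<in>internal. \<forall>g\<in>internal. \<exists>h\<in>internal.
      \<forall>x::'a. h x = (if p x = 1 then f x else g x)"
    by (rule transfer_sentence[where 'a = 'a, OF *], (rule transfer_intros)+)
  from this[rule_format, OF assms[unfolded internal_pred_def]]
  show "\<exists>h\<in>internal. \<forall>x. h x = (if P x then f x else g x)" by (auto split: if_splits)
qed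

lemma if_not: "(if \<not> P then x else y) = (if P then y else x)"
  by simp

lemma internal_pred_not: "internal_pred P \<Longrightarrow> internal_pred (\<lambda>x. \<not> P x)"
  using internal_if[OF _ internal_const[of 0] internal_const[of 1], of P]
  unfolding internal_pred_def[of "\<lambda>x. \<not> P x"] if_not .

lemma internal_pred_conj:
  fixes P Q :: "'a::nonstandard_extension \<Rightarrow> bool"
  assumes "internal_pred P" "internal_pred Q"
  shows "internal_pred (\<lambda>x. P x \<and> Q x)"
proof -
  have "(\<lambda>x. if P x \<and> Q x then 1 else 0 :: 'a) = (\<lambda>x. if P x then if Q x then 1 else 0 else 0)"
    by auto
  then show ?thesis
    using internal_if[OF assms(1) assms(2)[unfolded internal_pred_def] internal_const[of 0]]
    unfolding internal_pred_def by (simp only:)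
qed

lemma internal_pred_le:
  fixes f g :: "'a::nonstandard_extension \<Rightarrow> 'a"
  assumes "f \<in> internal" "g \<in> internal"
  shows "internal_pred (\<lambda>x. f x \<le> g x)"
  unfolding internal_pred_def
proof (rule internal_ext)
  have *: "\<forall>f g :: real \<Rightarrow> real. \<exists>h. \<forall>x::real. h x = (if f x \<le> g x then 1 else (0::real))"
    by (intro allI exI) (rule refl)
  have "\<forall>f\<in>internal. \<forall>g\<in>internal. \<exists>h\<in>internal. \<forall>x::'a. h x = (if f x \<le> g x then 1 else 0)"
    by (rule transfer_sentence[where 'a = 'a, OF *], (rule transfer_intros)+)
  then show "\<exists>h\<in>internal. \<forall>x. h x = (if f x \<le> g x then 1 else 0)" using assms by blast
qed

lemma internal_pred_less:
  assumes "f \<in> internal" "g \<in> internal"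
  shows "internal_pred (\<lambda>x. f x < g x)"
  unfolding not_le[symmetric] by (intro internal_pred_not internal_pred_le assms)

lemma internal_pred_hyperints:
  fixes f :: "'a::nonstandard_extension \<Rightarrow> 'a"
  assumes "f \<in> internal"
  shows "internal_pred (\<lambda>x. f x \<in> hyperints)"
  unfolding internal_pred_def
proof (rule internal_ext)
  have *: "\<forall>f :: real \<Rightarrow> real. \<exists>h. \<forall>x::real. h x = (if f x \<in> \<int> then 1 else (0::real))"
    by (intro allI exI) (rule refl)
  have "\<forall>f\<in>internal. \<exists>h\<in>internal. \<forall>x::'a. h x = (if f x \<in> hyperints then 1 else 0)"
    by (rule transfer_sentence[where 'a = 'a, OF *], (rule transfer_intros)+)
  then show "\<exists>h\<in>internal. \<forall>x. h x = (if f x \<in> hyperints then 1 else 0)" using assms by blast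
qed

lemmas internal_intros = internal_const internal_id internal_add internal_diff internal_mult
  internal_divide internal_hyperpow internal_if internal_pred_not internal_pred_conj
  internal_pred_le internal_pred_less internal_pred_hyperints

subsection \<open>Sums over the grid\<close>

text \<open>The grid sum runs over indices of both signs, but the summands it is applied to live on
  an initial segment of the naturals. The bound is \<open>a\<^sup>2 + 1\<close> because
  \<open>k < b\<close> then still reaches at most the last index.\<close>

lemma sum_int_eq_sum_nat:
  fixes f :: "real \<Rightarrow> real"
  assumes "b \<le> a\<^sup>2 + 1"
    and "\<And>k. - int (a\<^sup>2) \<le> k \<Longrightarrow> k \<le> int (a\<^sup>2) \<Longrightarrow> k < 0 \<or> int b \<le> k \<Longrightarrow> f (of_int k) = 0"
  shows "(\<Sum>k\<in>{\<lfloor>- ((real a)\<^sup>2)\<rfloor>..\<lfloor>(real a)\<^sup>2\<rfloor>}. f (of_int k)) = (\<Sum>k<b. f (real k))"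
proof -
  have fl: "\<lfloor>(real a)\<^sup>2\<rfloor> = int (a\<^sup>2)" "\<lfloor>- ((real a)\<^sup>2)\<rfloor> = - int (a\<^sup>2)"
    by (metis floor_of_nat of_nat_power)
       (metis floor_of_int of_int_minus of_int_of_nat_eq of_nat_power)
  have "(\<Sum>k\<in>{- int (a\<^sup>2)..int (a\<^sup>2)}. f (of_int k)) = (\<Sum>k\<in>int ` {..<b}. f (of_int k))"
  proof (rule sum.mono_neutral_right)
    have "int k \<le> int (a\<^sup>2)" if "k < b" for k
      using that assms(1) unfolding of_nat_le_iff by simp
    moreover have "- int (a\<^sup>2) \<le> int k" for k
      by (rule order_trans[of _ 0]) simp_all
    ultimately show "int ` {..<b} \<subseteq> {- int (a\<^sup>2)..int (a\<^sup>2)}" by auto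
    show "\<forall>k\<in>{- int (a\<^sup>2)..int (a\<^sup>2)} - int ` {..<b}. f (of_int k) = 0"
    proof
      fix k assume k: "k \<in> {- int (a\<^sup>2)..int (a\<^sup>2)} - int ` {..<b}"
      have "k < 0 \<or> int b \<le> k"
      proof (rule ccontr)
        assume "\<not> (k < 0 \<or> int b \<le> k)"
        then have "k \<in> int ` {..<b}" by (intro image_eqI[of _ _ "nat k"]) auto
        then show False using k by simp
      qed
      then show "f (of_int k) = 0" using assms(2) k by simp
    qed
  qed simp
  also have "\<dots> = (\<Sum>k<b. f (real k))"
    by (subst sum.reindex) (auto simp: inj_on_def)
  finally show ?thesis unfolding fl .
qed

lemma sum_indicator_le:
  fixes b c :: real
  assumes "finite I" "0 \<le> b" "0 \<le> c"
  shows "(\<Sum>k\<in>I. if 0 < k \<and> of_int k \<le> b then c else 0) \<le> b * c"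
proof -
  have "(\<Sum>k\<in>I. if 0 < k \<and> of_int k \<le> b then c else 0) =
      (\<Sum>k\<in>I \<inter> {k. 0 < k \<and> of_int k \<le> b}. c)"
    unfolding sum.inter_restrict[OF assms(1)] by simp
  also have "\<dots> \<le> (\<Sum>k\<in>{1..\<lfloor>b\<rfloor>}. c)"
    using assms by (intro sum_mono2) (auto simp: le_floor_iff)
  also have "\<dots> \<le> b * c"
    using assms by (auto intro!: mult_right_mono simp: of_nat_nat)
  finally show ?thesis .
qed

text \<open>The error profile is made for the ramp: a crude bound \<open>c\<close> on the at most
  \<open>M\<close> indices of the transition, a small \<open>e\<close> on the at most
  \<open>b\<close> indices up to the end of the support, and no error elsewhere.\<close>

lemma sum_compare:
  fixes f g :: "real \<Rightarrow> real"
  assumes "0 \<le> b" "0 \<le> M" "0 \<le> c" "0 \<le> e"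
    and "\<forall>k\<in>\<int>. \<bar>f k - g k\<bar> \<le> (if k \<le> 0 \<or> b < k then 0 else if k < M then c else e)"
  shows "\<bar>(\<Sum>k\<in>{\<lfloor>x\<rfloor>..\<lfloor>y\<rfloor>}. f (of_int k)) - (\<Sum>k\<in>{\<lfloor>x\<rfloor>..\<lfloor>y\<rfloor>}. g (of_int k))\<bar> \<le> M * c + b * e"
proof -
  let ?I = "{\<lfloor>x\<rfloor>..\<lfloor>y\<rfloor>}"
  have "\<bar>(\<Sum>k\<in>?I. f (of_int k)) - (\<Sum>k\<in>?I. g (of_int k))\<bar> \<le> (\<Sum>k\<in>?I. \<bar>f (of_int k) - g (of_int k)\<bar>)"
    unfolding sum_subtractf[symmetric] by (rule sum_abs)
  \<comment> \<open>Charging \<open>e\<close> up to \<open>b\<close> with the transition included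
    lets one counting lemma serve both terms.\<close>
  also have "\<dots> \<le> (\<Sum>k\<in>?I. (if 0 < k \<and> of_int k \<le> M then c else 0) +
      (if 0 < k \<and> of_int k \<le> b then e else 0))"
  proof (rule sum_mono)
    fix k assume "k \<in> ?I"
    have "\<bar>f (of_int k) - g (of_int k)\<bar> \<le>
        (if of_int k \<le> (0::real) \<or> b < of_int k then 0 else if of_int k < M then c else e)"
      using assms(5)[rule_format, of "of_int k"] by (simp only: Ints_of_int)
    also have "\<dots> \<le> (if 0 < k \<and> of_int k \<le> M then c else 0) + (if 0 < k \<and> of_int k \<le> b then e else 0)"
      using assms(3,4) by auto
    finally show "\<bar>f (of_int k) - g (of_int k)\<bar> \<le> \<dots>" .
  qed
  also have "\<dots> \<le> M * c + b * e"
    unfolding sum.distrib using assms by (intro add_mono sum_indicator_le) auto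
  finally show ?thesis .
qed

lemma hypersum_compare:
  fixes f g :: "'a::nonstandard_extension \<Rightarrow> 'a"
  assumes "f \<in> internal" "g \<in> internal" "0 \<le> b" "0 \<le> M" "0 \<le> c" "0 \<le> e"
    and "\<forall>k\<in>hyperints. \<bar>f k - g k\<bar> \<le> (if k \<le> 0 \<or> b < k then 0 else if k < M then c else e)"
  shows "\<bar>hypersum f x y - hypersum g x y\<bar> \<le> M * c + b * e"
proof -
  have *: "\<forall>f g. \<forall>b M c e x y. 0 \<le> b \<longrightarrow> 0 \<le> M \<longrightarrow> 0 \<le> c \<longrightarrow> 0 \<le> e \<longrightarrow>
      (\<forall>k\<in>\<int>. \<bar>f k - g k\<bar> \<le> (if k \<le> 0 \<or> b < k then 0 else if k < M then c else e)) \<longrightarrow>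
      \<bar>(\<Sum>k\<in>{\<lfloor>x\<rfloor>..\<lfloor>y\<rfloor>}. f (of_int k)) - (\<Sum>k\<in>{\<lfloor>x\<rfloor>..\<lfloor>y\<rfloor>}. g (of_int k))\<bar> \<le> M * c + b * (e::real)"
    using sum_compare by blast
  have "\<forall>f\<in>internal. \<forall>g\<in>internal. \<forall>b M c e x y. 0 \<le> b \<longrightarrow> 0 \<le> M \<longrightarrow> 0 \<le> c \<longrightarrow> 0 \<le> e \<longrightarrow>
      (\<forall>k\<in>hyperints. \<bar>f k - g k\<bar> \<le> (if k \<le> 0 \<or> b < k then 0 else if k < M then c else e)) \<longrightarrow>
      \<bar>hypersum f x y - hypersum g x y\<bar> \<le> M * c + b * (e::'a)"
    by (rule transfer_sentence[where 'a = 'a, OF *], (rule transfer_intros)+)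
  with assms show ?thesis by blast
qed

text \<open>The increments of \<open>p\<close> are nonnegative weights that telescope to total 1,
  and the factor \<open>1 / real a\<close> cancels the step of the difference quotient. The sum is
  thus a weighted mean of values within \<open>e\<close> of \<open>c\<close>.\<close>

lemma sum_increments:
  fixes p q f :: "real \<Rightarrow> real" and a b :: nat
  assumes "0 < a" "b \<le> a\<^sup>2"
    and f: "\<And>k. \<bar>k\<bar> \<le> int (a\<^sup>2) \<Longrightarrow> f (of_int k) = (p (of_int k + 1) - p (of_int k)) / (1 / real a) * q (of_int k)"
    and p0: "\<And>k. k \<le> 0 \<Longrightarrow> p (of_int k) = 0"
    and p1: "\<And>k. int b \<le> k \<Longrightarrow> k \<le> int (a\<^sup>2) \<Longrightarrow> p (of_int k) = 1"
    and pq: "\<And>k. k < b \<Longrightarrow> p (real k) \<le> p (real k + 1) \<and> \<bar>q (real k) - c\<bar> \<le> e"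
    and q: "q ((real a)\<^sup>2) = 0"
  shows "\<bar>1 / real a * (\<Sum>k\<in>{\<lfloor>- ((real a)\<^sup>2)\<rfloor>..\<lfloor>(real a)\<^sup>2\<rfloor>}. f (of_int k)) - c\<bar> \<le> e"
proof -
  have "f (of_int k) = 0" if k: "- int (a\<^sup>2) \<le> k" "k \<le> int (a\<^sup>2)" "k < 0 \<or> int b \<le> k" for k
  proof (cases "k = int (a\<^sup>2)")
    \<comment> \<open>At the last index nothing is known about \<open>p (of_int k + 1)\<close>,
      which models a value off the grid; the term vanishes through \<open>q\<close>.\<close>
    case True
    then have "(of_int k :: real) = (real a)\<^sup>2" by (metis of_int_of_nat_eq of_nat_power)
    then show ?thesis using f[of k] k q by simp
  next
    case False
    have "p (of_int k + 1) = p (of_int k)"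
      using p0[of k] p0[of "k + 1"] p1[of k] p1[of "k + 1"] k False by auto
    then show ?thesis using f[of k] k by simp
  qed
  then have "(\<Sum>k\<in>{\<lfloor>- ((real a)\<^sup>2)\<rfloor>..\<lfloor>(real a)\<^sup>2\<rfloor>}. f (of_int k)) = (\<Sum>k<b. f (real k))"
    using assms(2) by (intro sum_int_eq_sum_nat) auto
  also have "1 / real a * \<dots> = (\<Sum>k<b. (p (real k + 1) - p (real k)) * q (real k))"
    unfolding sum_distrib_left
  proof (rule sum.cong)
    fix k assume "k \<in> {..<b}"
    then have "k \<le> a\<^sup>2" using assms(2) by simp
    then have "\<bar>int k\<bar> \<le> int (a\<^sup>2)" by (simp only: abs_of_nat of_nat_le_iff)
    then show "1 / real a * f (real k) = (p (real k + 1) - p (real k)) * q (real k)"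
      using f[of "int k"] \<open>0 < a\<close> by simp
  qed simp
  finally have S: "1 / real a * (\<Sum>k\<in>{\<lfloor>- ((real a)\<^sup>2)\<rfloor>..\<lfloor>(real a)\<^sup>2\<rfloor>}. f (of_int k)) =
      (\<Sum>k<b. (p (real k + 1) - p (real k)) * q (real k))" .
  have "(\<Sum>k<b. p (real k + 1) - p (real k)) = (\<Sum>k<b. p (real (Suc k)) - p (real k))"
    by (simp add: add.commute)
  also have "\<dots> = p (real b) - p 0"
    by (subst sum_lessThan_telescope) simp
  also have "\<dots> = 1"
    using p0[of 0] p1[of "int b"] assms(2) by (simp flip: of_nat_power)
  finally have one: "(\<Sum>k<b. p (real k + 1) - p (real k)) = 1" .
  have "(\<Sum>k<b. (p (real k + 1) - p (real k)) * q (real k)) - c =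
      (\<Sum>k<b. (p (real k + 1) - p (real k)) * q (real k)) - (\<Sum>k<b. p (real k + 1) - p (real k)) * c"
    using one by simp
  also have "\<dots> = (\<Sum>k<b. (p (real k + 1) - p (real k)) * (q (real k) - c))"
    by (simp only: sum_distrib_right right_diff_distrib flip: sum_subtractf)
  finally have "\<bar>(\<Sum>k<b. (p (real k + 1) - p (real k)) * q (real k)) - c\<bar> \<le>
      (\<Sum>k<b. \<bar>(p (real k + 1) - p (real k)) * (q (real k) - c)\<bar>)"
    by simp
  also have "\<dots> \<le> (\<Sum>k<b. (p (real k + 1) - p (real k)) * e)"
    using pq by (intro sum_mono) (auto simp: abs_mult intro!: mult_mono)
  also have "\<dots> = e" using one by (simp flip: sum_distrib_right)
  finally show ?thesis unfolding S .
qed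

text \<open>Only a function variable can be summed in a transferred sentence, so the summand
  \<open>f\<close> is quantified separately and tied to \<open>p\<close> and \<open>q\<close> by an
  equation at the hyperintegers of the range.\<close>

lemma hypersum_increments:
  fixes f p q :: "'a::nonstandard_extension \<Rightarrow> 'a"
  assumes "f \<in> internal" "p \<in> internal" "q \<in> internal" "N \<in> hypernats" "M \<in> hypernats"
    and "0 < N" "M \<le> N\<^sup>2"
    and "\<forall>k\<in>hyperints. \<bar>k\<bar> \<le> N\<^sup>2 \<longrightarrow> f k = (p (k + 1) - p k) / (1 / N) * q k"
    and "\<forall>k\<in>hyperints. k \<le> 0 \<longrightarrow> p k = 0"
    and "\<forall>k\<in>hyperints. M \<le> k \<longrightarrow> k \<le> N\<^sup>2 \<longrightarrow> p k = 1"
    and "\<forall>k\<in>hyperints. 0 \<le> k \<longrightarrow> k < M \<longrightarrow> p k \<le> p (k + 1) \<and> \<bar>q k - c\<bar> \<le> e"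
    and "q (N\<^sup>2) = 0"
  shows "\<bar>1 / N * hypersum f (- (N\<^sup>2)) (N\<^sup>2) - c\<bar> \<le> e"
proof -
  have *: "\<forall>f p q. \<forall>N\<in>\<nat>. \<forall>M\<in>\<nat>. \<forall>c e. 0 < N \<longrightarrow> M \<le> N\<^sup>2 \<longrightarrow>
    (\<forall>k\<in>\<int>. \<bar>k\<bar> \<le> N\<^sup>2 \<longrightarrow> f k = (p (k + 1) - p k) / (1 / N) * q k) \<longrightarrow>
    (\<forall>k\<in>\<int>. k \<le> 0 \<longrightarrow> p k = 0) \<longrightarrow>
    (\<forall>k\<in>\<int>. M \<le> k \<longrightarrow> k \<le> N\<^sup>2 \<longrightarrow> p k = 1) \<longrightarrow>
    (\<forall>k\<in>\<int>. 0 \<le> k \<longrightarrow> k < M \<longrightarrow> p k \<le> p (k + 1) \<and> \<bar>q k - c\<bar> \<le> e) \<longrightarrow>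
    q (N\<^sup>2) = 0 \<longrightarrow>
    \<bar>1 / N * (\<Sum>k\<in>{\<lfloor>- (N\<^sup>2)\<rfloor>..\<lfloor>N\<^sup>2\<rfloor>}. f (of_int k)) - c\<bar> \<le> (e::real)"
  proof (intro allI ballI impI)
    fix f p q :: "real \<Rightarrow> real" and N M c e :: real
    assume "N \<in> \<nat>" "M \<in> \<nat>" and A: "0 < N" "M \<le> N\<^sup>2"
      "\<forall>k\<in>\<int>. \<bar>k\<bar> \<le> N\<^sup>2 \<longrightarrow> f k = (p (k + 1) - p k) / (1 / N) * q k"
      "\<forall>k\<in>\<int>. k \<le> 0 \<longrightarrow> p k = 0"
      "\<forall>k\<in>\<int>. M \<le> k \<longrightarrow> k \<le> N\<^sup>2 \<longrightarrow> p k = 1"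
      "\<forall>k\<in>\<int>. 0 \<le> k \<longrightarrow> k < M \<longrightarrow> p k \<le> p (k + 1) \<and> \<bar>q k - c\<bar> \<le> e"
      "q (N\<^sup>2) = 0"
    then obtain a b where ab: "N = real a" "M = real b" by (auto elim!: Nats_cases)
    have le: "of_int k \<le> (real a)\<^sup>2 \<longleftrightarrow> k \<le> int (a\<^sup>2)" for k
      by (metis of_int_le_iff of_int_of_nat_eq of_nat_power)
    show "\<bar>1 / N * (\<Sum>k\<in>{\<lfloor>- (N\<^sup>2)\<rfloor>..\<lfloor>N\<^sup>2\<rfloor>}. f (of_int k)) - c\<bar> \<le> e"
      unfolding ab
    proof (rule sum_increments)
      show "0 < a" "b \<le> a\<^sup>2" using A(1,2) unfolding ab by (simp_all flip: of_nat_power)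
      show "f (of_int k) = (p (of_int k + 1) - p (of_int k)) / (1 / real a) * q (of_int k)"
        if "\<bar>k\<bar> \<le> int (a\<^sup>2)" for k
        using A(3) that unfolding ab by (simp add: le flip: of_int_abs)
      show "p (of_int k) = 0" if "k \<le> 0" for k using A(4) that by simp
      show "p (of_int k) = 1" if "int b \<le> k" "k \<le> int (a\<^sup>2)" for k
        using A(5)[rule_format, of "of_int k"] that unfolding ab le
        by (metis Ints_of_int of_int_le_iff of_int_of_nat_eq)
      show "p (real k) \<le> p (real k + 1) \<and> \<bar>q (real k) - c\<bar> \<le> e" if "k < b" for k
        using A(6) that unfolding ab by simp
      show "q ((real a)\<^sup>2) = 0" using A(7) unfolding ab .
    qed
  qed
  have "\<forall>f\<in>internal. \<forall>p\<in>internal. \<forall>q\<in>internal. \<forall>N\<in>hypernats. \<forall>M\<in>hypernats. \<forall>c e. 0 < N \<longrightarrow> M \<le> N\<^sup>2 \<longrightarrow>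
    (\<forall>k\<in>hyperints. \<bar>k\<bar> \<le> N\<^sup>2 \<longrightarrow> f k = (p (k + 1) - p k) / (1 / N) * q k) \<longrightarrow>
    (\<forall>k\<in>hyperints. k \<le> 0 \<longrightarrow> p k = 0) \<longrightarrow>
    (\<forall>k\<in>hyperints. M \<le> k \<longrightarrow> k \<le> N\<^sup>2 \<longrightarrow> p k = 1) \<longrightarrow>
    (\<forall>k\<in>hyperints. 0 \<le> k \<longrightarrow> k < M \<longrightarrow> p k \<le> p (k + 1) \<and> \<bar>q k - c\<bar> \<le> e) \<longrightarrow>
    q (N\<^sup>2) = 0 \<longrightarrow>
    \<bar>1 / N * hypersum f (- (N\<^sup>2)) (N\<^sup>2) - c\<bar> \<le> (e::'a)"
    by (rule transfer_sentence[where 'a = 'a, OF *], (rule transfer_intros)+)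
  from this[rule_format, of f p q N M c e] assms show ?thesis by blast
qed

section \<open>Power sums with bounds uniform in the exponent\<close>

lemma power_sum_bounds:
  "(\<Sum>k<b. real k ^ m) \<le> real b ^ Suc m / (real m + 1)"
  "real b ^ Suc m / (real m + 1) \<le> (\<Sum>k<b. real k ^ m) + real b ^ m"
proof -
  \<comment> \<open>The difference \<open>(x + 1) ^ Suc m - x ^ Suc m\<close> is a sum of
    \<open>m + 1\<close> products, each between \<open>x ^ m\<close> and \<open>(x + 1) ^ m\<close>.
    This replaces comparison with an integral; the two inductions add these increments up.\<close>
  have key: "(real m + 1) * x ^ m \<le> (x + 1) ^ Suc m - x ^ Suc m"
    "(x + 1) ^ Suc m - x ^ Suc m \<le> (real m + 1) * (x + 1) ^ m" if "0 \<le> x" for x :: real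
  proof -
    have "(x + 1) ^ Suc m - x ^ Suc m = (\<Sum>i<Suc m. x ^ (m - i) * (x + 1) ^ i)"
      using power_diff_sumr2[of "x + 1" "Suc m" x] by simp
    moreover have "(\<Sum>i<Suc m. x ^ m) \<le> (\<Sum>i<Suc m. x ^ (m - i) * (x + 1) ^ i)"
    proof (rule sum_mono)
      fix i assume "i \<in> {..<Suc m}"
      then have "x ^ m = x ^ (m - i) * x ^ i" by (simp flip: power_add)
      also have "\<dots> \<le> x ^ (m - i) * (x + 1) ^ i"
        using that by (intro mult_left_mono power_mono) auto
      finally show "x ^ m \<le> \<dots>" .
    qed
    moreover have "(\<Sum>i<Suc m. x ^ (m - i) * (x + 1) ^ i) \<le> (\<Sum>i<Suc m. (x + 1) ^ m)"
    proof (rule sum_mono)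
      fix i assume "i \<in> {..<Suc m}"
      then have "(x + 1) ^ m = (x + 1) ^ (m - i) * (x + 1) ^ i" by (simp flip: power_add)
      also have "\<dots> \<ge> x ^ (m - i) * (x + 1) ^ i"
        using that by (intro mult_right_mono power_mono) auto
      finally show "x ^ (m - i) * (x + 1) ^ i \<le> (x + 1) ^ m" .
    qed
    ultimately show "(real m + 1) * x ^ m \<le> (x + 1) ^ Suc m - x ^ Suc m"
      "(x + 1) ^ Suc m - x ^ Suc m \<le> (real m + 1) * (x + 1) ^ m"
      by (simp_all add: add.commute del: power_Suc)
  qed
  have "(real m + 1) * (\<Sum>k<b. real k ^ m) \<le> real b ^ Suc m"
  proof (induction b)
    case (Suc b)
    have "(real m + 1) * (\<Sum>k<Suc b. real k ^ m) =
        (real m + 1) * (\<Sum>k<b. real k ^ m) + (real m + 1) * real b ^ m"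
      by (simp add: distrib_left)
    also have "\<dots> \<le> real b ^ Suc m + ((real b + 1) ^ Suc m - real b ^ Suc m)"
      by (intro add_mono Suc.IH key) simp
    finally show ?case by (simp add: add.commute del: power_Suc)
  qed simp
  then show "(\<Sum>k<b. real k ^ m) \<le> real b ^ Suc m / (real m + 1)"
    by (simp add: pos_le_divide_eq mult.commute del: power_Suc)
  have "real b ^ Suc m \<le> (real m + 1) * ((\<Sum>k<b. real k ^ m) + real b ^ m)"
  proof (induction b)
    case (Suc b)
    have "real (Suc b) ^ Suc m = real b ^ Suc m + ((real b + 1) ^ Suc m - real b ^ Suc m)"
      by (simp add: add.commute del: power_Suc)
    also have "\<dots> \<le> (real m + 1) * ((\<Sum>k<b. real k ^ m) + real b ^ m) + (real m + 1) * (real b + 1) ^ m"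
      by (intro add_mono Suc.IH key) simp
    also have "\<dots> = (real m + 1) * ((\<Sum>k<Suc b. real k ^ m) + real (Suc b) ^ m)"
      by (simp add: distrib_left add.commute)
    finally show ?case .
  qed (simp del: power_Suc)
  then show "real b ^ Suc m / (real m + 1) \<le> (\<Sum>k<b. real k ^ m) + real b ^ m"
    by (simp add: pos_divide_le_eq mult.commute del: power_Suc)
qed

text \<open>After division by \<open>b ^ Suc m\<close> the gap \<open>b ^ m\<close> between the two
  bounds becomes \<open>1 / b\<close>, from which the exponent has disappeared.\<close>

lemma power_mean_bounds:
  assumes "0 < b"
  shows "(\<Sum>k<b. (real k / real b) ^ m) / real b \<le> 1 / (real m + 1)"
    and "1 / (real m + 1) - 1 / real b \<le> (\<Sum>k<b. (real k / real b) ^ m) / real b"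
proof -
  have eq: "(\<Sum>k<b. (real k / real b) ^ m) / real b = (\<Sum>k<b. real k ^ m) / real b ^ Suc m"
    by (simp add: power_divide sum_divide_distrib mult.commute)
  have pos: "real b ^ Suc m > 0" using assms by simp
  show "(\<Sum>k<b. (real k / real b) ^ m) / real b \<le> 1 / (real m + 1)"
    using divide_right_mono[OF power_sum_bounds(1)[of m b], of "real b ^ Suc m"] pos
    unfolding eq by (simp del: power_Suc)
  have "1 / (real m + 1) \<le> ((\<Sum>k<b. real k ^ m) + real b ^ m) / real b ^ Suc m"
    using divide_right_mono[OF power_sum_bounds(2)[of b m], of "real b ^ Suc m"] pos
    by (simp del: power_Suc)
  also have "\<dots> = (\<Sum>k<b. real k ^ m) / real b ^ Suc m + 1 / real b"
    using assms by (simp add: add_divide_distrib)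
  finally show "1 / (real m + 1) - 1 / real b \<le> (\<Sum>k<b. (real k / real b) ^ m) / real b"
    unfolding eq by linarith
qed

text \<open>The factor \<open>real a / real b\<close> is the slope of the ramp; together with the
  step \<open>1 / real a\<close> it leaves the weight \<open>1 / real b\<close>. Each mean falls
  short of \<open>1 / (m + 1)\<close> or \<open>1 / (n + 1)\<close> by an amount in
  \<open>[0, 1 / b]\<close>, so the two errors do not add up in the difference.\<close>

lemma sum_power_difference:
  fixes f :: "real \<Rightarrow> real" and a b m n :: nat
  assumes "0 < a" "0 < b" "b \<le> a\<^sup>2"
    and f: "\<And>k. \<bar>k\<bar> \<le> int (a\<^sup>2) \<Longrightarrow> f (of_int k) = (if 0 \<le> k \<and> k < int b
      then ((of_int k / real b) ^ m - (of_int k / real b) ^ n) * (real a / real b) else 0)"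
  shows "\<bar>1 / real a * (\<Sum>k\<in>{\<lfloor>- ((real a)\<^sup>2)\<rfloor>..\<lfloor>(real a)\<^sup>2\<rfloor>}. f (of_int k)) -
    (1 / (real m + 1) - 1 / (real n + 1))\<bar> \<le> 1 / real b"
proof -
  have "(\<Sum>k\<in>{\<lfloor>- ((real a)\<^sup>2)\<rfloor>..\<lfloor>(real a)\<^sup>2\<rfloor>}. f (of_int k)) = (\<Sum>k<b. f (real k))"
    using assms(3) f by (intro sum_int_eq_sum_nat) auto
  also have "1 / real a * \<dots> = (\<Sum>k<b. ((real k / real b) ^ m - (real k / real b) ^ n) / real b)"
    unfolding sum_distrib_left
  proof (rule sum.cong)
    fix k assume k: "k \<in> {..<b}"
    then have "\<bar>int k\<bar> \<le> int (a\<^sup>2)"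
      using assms(3) unfolding abs_of_nat of_nat_le_iff by simp
    then show "1 / real a * f (real k) = ((real k / real b) ^ m - (real k / real b) ^ n) / real b"
      using f[of "int k"] k \<open>0 < a\<close> by simp
  qed simp
  also have "\<dots> = (\<Sum>k<b. (real k / real b) ^ m) / real b - (\<Sum>k<b. (real k / real b) ^ n) / real b"
    by (simp add: sum_divide_distrib sum_subtractf diff_divide_distrib)
  finally show ?thesis
    using power_mean_bounds[OF assms(2), of m] power_mean_bounds[OF assms(2), of n]
    by (simp only: abs_le_iff) linarith
qed

text \<open>The exponents are quantified inside the transferred sentence, with
  \<open>nat \<lfloor>m\<rfloor>\<close> on the real side turning into \<open>hyperpow\<close>; that
  is what admits infinite \<open>m\<close> and \<open>n\<close>.\<close>

lemma hypersum_power_difference: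
  fixes f :: "'a::nonstandard_extension \<Rightarrow> 'a"
  assumes "f \<in> internal" "N \<in> hypernats" "M \<in> hypernats" "m \<in> hypernats" "n \<in> hypernats"
    and "0 < N" "0 < M" "M \<le> N\<^sup>2"
    and "\<forall>k\<in>hyperints. \<bar>k\<bar> \<le> N\<^sup>2 \<longrightarrow> f k = (if 0 \<le> k \<and> k < M
      then (hyperpow (k / M) m - hyperpow (k / M) n) * (N / M) else 0)"
  shows "\<bar>1 / N * hypersum f (- (N\<^sup>2)) (N\<^sup>2) - (1 / (m + 1) - 1 / (n + 1))\<bar> \<le> 1 / M"
proof -
  have *: "\<forall>f. \<forall>N\<in>\<nat>. \<forall>M\<in>\<nat>. \<forall>m\<in>\<nat>. \<forall>n\<in>\<nat>. 0 < N \<longrightarrow> 0 < M \<longrightarrow> M \<le> N\<^sup>2 \<longrightarrow>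
    (\<forall>k\<in>\<int>. \<bar>k\<bar> \<le> N\<^sup>2 \<longrightarrow> f k = (if 0 \<le> k \<and> k < M
      then ((k / M) ^ nat \<lfloor>m\<rfloor> - (k / M) ^ nat \<lfloor>n\<rfloor>) * (N / M) else 0)) \<longrightarrow>
    \<bar>1 / N * (\<Sum>k\<in>{\<lfloor>- (N\<^sup>2)\<rfloor>..\<lfloor>N\<^sup>2\<rfloor>}. f (of_int k)) - (1 / (m + 1) - 1 / (n + 1))\<bar> \<le> 1 / (M::real)"
  proof (intro allI ballI impI)
    fix f :: "real \<Rightarrow> real" and N M m n :: real
    assume "N \<in> \<nat>" "M \<in> \<nat>" "m \<in> \<nat>" "n \<in> \<nat>" and A: "0 < N" "0 < M" "M \<le> N\<^sup>2"
      "\<forall>k\<in>\<int>. \<bar>k\<bar> \<le> N\<^sup>2 \<longrightarrow> f k = (if 0 \<le> k \<and> k < M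
        then ((k / M) ^ nat \<lfloor>m\<rfloor> - (k / M) ^ nat \<lfloor>n\<rfloor>) * (N / M) else 0)"
    then obtain a b m' n' where ab: "N = real a" "M = real b" "m = real m'" "n = real n'"
      by (auto elim!: Nats_cases)
    have le: "of_int k \<le> (real a)\<^sup>2 \<longleftrightarrow> k \<le> int (a\<^sup>2)" for k
      by (metis of_int_le_iff of_int_of_nat_eq of_nat_power)
    have less: "of_int k < real b \<longleftrightarrow> k < int b" for k
      by (metis of_int_less_iff of_int_of_nat_eq)
    show "\<bar>1 / N * (\<Sum>k\<in>{\<lfloor>- (N\<^sup>2)\<rfloor>..\<lfloor>N\<^sup>2\<rfloor>}. f (of_int k)) - (1 / (m + 1) - 1 / (n + 1))\<bar> \<le> 1 / M"
      unfolding ab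
    proof (rule sum_power_difference)
      show "0 < a" "0 < b" "b \<le> a\<^sup>2" using A(1-3) unfolding ab by (simp_all flip: of_nat_power)
      show "f (of_int k) = (if 0 \<le> k \<and> k < int b
          then ((of_int k / real b) ^ m' - (of_int k / real b) ^ n') * (real a / real b) else 0)"
        if "\<bar>k\<bar> \<le> int (a\<^sup>2)" for k
        using A(4)[rule_format, of "of_int k"] that unfolding ab
        by (simp add: le less flip: of_int_abs)
    qed
  qed
  have "\<forall>f\<in>internal. \<forall>N\<in>hypernats. \<forall>M\<in>hypernats. \<forall>m\<in>hypernats. \<forall>n\<in>hypernats.
    0 < N \<longrightarrow> 0 < M \<longrightarrow> M \<le> N\<^sup>2 \<longrightarrow>
    (\<forall>k\<in>hyperints. \<bar>k\<bar> \<le> N\<^sup>2 \<longrightarrow> f k = (if 0 \<le> k \<and> k < M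
      then (hyperpow (k / M) m - hyperpow (k / M) n) * (N / M) else 0)) \<longrightarrow>
    \<bar>1 / N * hypersum f (- (N\<^sup>2)) (N\<^sup>2) - (1 / (m + 1) - 1 / (n + 1))\<bar> \<le> 1 / (M::'a)"
    by (rule transfer_sentence[where 'a = 'a, OF *], (rule transfer_intros)+)
  from this[rule_format, of f N M m n] assms show ?thesis by blast
qed

section \<open>Riemann sums with right end points\<close>

lemma riemann_sum_tendsto:
  fixes g :: "real \<Rightarrow> real" and R :: nat
  assumes cont: "continuous_on UNIV g" and supp: "\<And>x. real R < x \<Longrightarrow> g x = 0" and e: "0 < e"
  shows "\<exists>n\<^sub>0. \<forall>n\<ge>n\<^sub>0. \<bar>1 / real n * (\<Sum>k<n * R + 1. if 0 < k then g (real k * (1 / real n)) else 0) -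
    integral {0..real R} g\<bar> \<le> e"
proof -
  \<comment> \<open>The error \<open>e'\<close> per unit length accumulates over length
    \<open>R\<close>; the denominator \<open>R + 1\<close> stays positive when
    \<open>R = 0\<close>.\<close>
  define e' where "e' = e / (real R + 1)"
  have e': "e' > 0" using e by (simp add: e'_def)
  have "uniformly_continuous_on {0..real R} g"
    by (rule compact_uniformly_continuous) (auto intro: continuous_on_subset[OF cont])
  then obtain d where d: "d > 0"
    "\<And>x y. x \<in> {0..real R} \<Longrightarrow> y \<in> {0..real R} \<Longrightarrow> dist y x < d \<Longrightarrow> dist (g y) (g x) < e'"
    using e' unfolding uniformly_continuous_on_def by metis
  show ?thesis
  proof (intro exI allI impI)
    fix n assume "n \<ge> nat \<lceil>1 / d\<rceil> + 1"
    then have "1 / d < real n" "0 < n" by linarith+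
    then have n: "0 < real n" "1 / real n < d" using d(1) by (simp_all add: field_simps)
    have gint: "g integrable_on {a..b}" for a b
      by (rule integrable_continuous_real) (rule continuous_on_subset[OF cont subset_UNIV])
    have split: "integral {0..real j / real n} g =
        (\<Sum>k<j. integral {real k / real n..real (Suc k) / real n} g)" for j
    proof (induction j)
      case (Suc j)
      have "integral {0..real j / real n} g + integral {real j / real n..real (Suc j) / real n} g =
          integral {0..real (Suc j) / real n} g"
        using n by (intro Henstock_Kurzweil_Integration.integral_combine gint) (auto simp: divide_right_mono)
      then show ?case using Suc by simp
    qed simp
    \<comment> \<open>The index \<open>0\<close> contributes nothing because of the guard
      \<open>0 < k\<close>; shifting the rest by one attaches to each cell its right end
      point.\<close>
    have "(\<Sum>k<n * R + 1. if 0 < k then g (real k * (1 / real n)) else 0) =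
        (\<Sum>k<n * R. g (real (Suc k) / real n))"
      unfolding add.commute[of "n * R"] plus_1_eq_Suc sum.lessThan_Suc_shift by simp
    then have "1 / real n * (\<Sum>k<n * R + 1. if 0 < k then g (real k * (1 / real n)) else 0) -
        integral {0..real R} g =
        (\<Sum>k<n * R. 1 / real n * g (real (Suc k) / real n) - integral {real k / real n..real (Suc k) / real n} g)"
      using split[of "n * R"] n by (simp add: sum_distrib_left sum_subtractf)
    also have "\<bar>\<dots>\<bar> \<le> (\<Sum>k<n * R. e' * (1 / real n))"
    proof (rule order_trans[OF sum_abs], rule sum_mono)
      fix k assume k: "k \<in> {..<n * R}"
      let ?a = "real k / real n" and ?b = "real (Suc k) / real n"
      have ab: "?b - ?a = 1 / real n" by (simp add: diff_divide_distrib[symmetric])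
      have "Suc k \<le> n * R" using k by simp
      then have "real (Suc k) \<le> real n * real R" unfolding of_nat_mult[symmetric] of_nat_le_iff .
      then have bR: "?b \<le> real R" using n by (simp add: field_simps)
      have "norm (integral {?a..?b} (\<lambda>x. g ?b - g x)) \<le> e' * (?b - ?a)"
      proof (rule integral_bound)
        show "?a \<le> ?b" using n by (simp add: divide_right_mono)
        show "continuous_on {?a..?b} (\<lambda>x. g ?b - g x)"
          by (intro continuous_intros continuous_on_subset[OF cont subset_UNIV])
        fix t assume t: "t \<in> {?a..?b}"
        then have "dist ?b t < d" using n ab by (auto simp: dist_real_def)
        then have "dist (g ?b) (g t) < e'"
          using t bR n by (intro d(2)) (auto intro: order_trans[of _ ?a])
        then show "norm (g ?b - g t) \<le> e'" by (simp add: dist_real_def)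
      qed
      also have "integral {?a..?b} (\<lambda>x. g ?b - g x) = 1 / real n * g ?b - integral {?a..?b} g"
        using ab n by (subst integral_diff) (auto intro: gint simp: divide_right_mono)
      finally show "\<bar>1 / real n * g ?b - integral {?a..?b} g\<bar> \<le> e' * (1 / real n)"
        by (simp only: ab real_norm_def)
    qed
    also have "\<dots> = real R * e'" using n by simp
    also have "\<dots> \<le> e" using e by (simp add: e'_def field_simps)
    finally show "\<bar>1 / real n * (\<Sum>k<n * R + 1. if 0 < k then g (real k * (1 / real n)) else 0) -
      integral {0..real R} g\<bar> \<le> e" .
  qed
qed

text \<open>For each standard \<open>e\<close> the finite Riemann sums are within \<open>e\<close>
  of the integral from a standard threshold on, and an infinite \<open>N\<close> lies beyond all
  such thresholds.\<close>

lemma hypersum_riemann: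
  fixes N :: "'a::nonstandard_extension" and g :: "real \<Rightarrow> real" and R :: nat
  assumes cont: "continuous_on UNIV g" and supp: "\<And>x. real R < x \<Longrightarrow> g x = 0"
    and N: "N \<in> hypernats" "N \<notin> \<nat>"
  shows "1 / N * hypersum (\<lambda>k. if 0 < k then star_fun g (k * (1 / N)) else 0) (- (N\<^sup>2)) (N\<^sup>2)
    near star_real (integral {0..real R} g)"
  unfolding near_def
proof (rule infinitesimalI)
  fix e :: real assume e: "e > 0"
  obtain n0 where n0: "\<And>n. n \<ge> n0 \<Longrightarrow> \<bar>1 / real n * (\<Sum>k<n * R + 1. if 0 < k then g (real k * (1 / real n)) else 0) -
    integral {0..real R} g\<bar> \<le> e"
    using riemann_sum_tendsto[OF cont supp e] by blast
  \<comment> \<open>The second threshold \<open>R + 1\<close> gives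
    \<open>n * R \<le> n\<^sup>2\<close>, so the positive part of the support of \<open>g\<close>
    fits into the summation range.\<close>
  have *: "\<forall>f. \<forall>n\<in>\<nat>. real (max n0 (R + 1)) \<le> n \<longrightarrow>
      (\<forall>k\<in>\<int>. f k = (if 0 < k then g (k * (1 / n)) else 0)) \<longrightarrow>
      \<bar>1 / n * (\<Sum>k\<in>{\<lfloor>- (n\<^sup>2)\<rfloor>..\<lfloor>n\<^sup>2\<rfloor>}. f (of_int k)) - integral {0..real R} g\<bar> \<le> e"
  proof (intro allI ballI impI)
    fix f :: "real \<Rightarrow> real" and n :: real
    assume "n \<in> \<nat>" and n: "real (max n0 (R + 1)) \<le> n"
      and f: "\<forall>k\<in>\<int>. f k = (if 0 < k then g (k * (1 / n)) else 0)"
    then obtain a where a: "n = real a" by (auto elim: Nats_cases)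
    have a': "n0 \<le> a" "R + 1 \<le> a" using n unfolding a of_nat_le_iff by simp_all
    have "a * R + 1 \<le> a\<^sup>2 + 1" using a' by (simp add: power2_eq_square)
    then have "(\<Sum>k\<in>{\<lfloor>- (n\<^sup>2)\<rfloor>..\<lfloor>n\<^sup>2\<rfloor>}. f (of_int k)) = (\<Sum>k<a * R + 1. f (real k))"
      unfolding a
    proof (rule sum_int_eq_sum_nat)
      fix k assume k: "k < 0 \<or> int (a * R + 1) \<le> k"
      have "g (of_int k * (1 / real a)) = 0" if "0 < k"
      proof (rule supp)
        have "int (a * R) < k" using k that by simp
        then have "real (a * R) < of_int k" by linarith
        then show "real R < of_int k * (1 / real a)" using a' by (simp add: field_simps)
      qed
      then show "f (of_int k) = 0" using f a by simp
    qed
    also have "\<dots> = (\<Sum>k<a * R + 1. if 0 < k then g (real k * (1 / real a)) else 0)"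
      using f unfolding a by (intro sum.cong) auto
    finally show "\<bar>1 / n * (\<Sum>k\<in>{\<lfloor>- (n\<^sup>2)\<rfloor>..\<lfloor>n\<^sup>2\<rfloor>}. f (of_int k)) - integral {0..real R} g\<bar> \<le> e"
      using n0[OF a'(1)] a by simp
  qed
  have **: "\<forall>f\<in>internal. \<forall>n\<in>hypernats. star_real (real (max n0 (R + 1))) \<le> n \<longrightarrow>
      (\<forall>k\<in>hyperints. f k = (if 0 < k then star_fun g (k * (1 / n)) else 0)) \<longrightarrow>
      \<bar>1 / n * hypersum f (- (n\<^sup>2)) (n\<^sup>2) - star_real (integral {0..real R} g)\<bar> \<le> (star_real e :: 'a)"
    by (rule transfer_sentence[where 'a = 'a, OF *], (rule transfer_intros)+)
  have int: "(\<lambda>k. if 0 < k then star_fun g (k * (1 / N)) else 0) \<in> internal"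
    by (intro internal_intros internal_compose[OF internal_star_fun])
  show "\<bar>1 / N * hypersum (\<lambda>k. if 0 < k then star_fun g (k * (1 / N)) else 0) (- (N\<^sup>2)) (N\<^sup>2) -
      star_real (integral {0..real R} g)\<bar> \<le> star_real e"
    using hypernats_infinite[OF N] by (intro **[rule_format, OF int N(1)]) (auto intro: less_imp_le)
qed

subsection \<open>Distributions\<close>

text \<open>Turns the Lebesgue integral of the definition into the gauge integral approximated by
  the Riemann sums. At \<open>0\<close> the indicator of the closed interval is 1 while
  \<open>heaviside\<close> is 0, so the integrands are compared almost everywhere.\<close>

lemma regular_distribution_heaviside:
  assumes cont: "continuous_on UNIV \<phi>" and supp: "\<And>x. R < x \<Longrightarrow> \<phi> x = 0"
  shows "regular_distribution heaviside \<phi> = integral {0..R} \<phi>"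
proof -
  have "regular_distribution heaviside \<phi> = (LINT x:{0..R}|lborel. \<phi> x)"
    unfolding regular_distribution_def set_lebesgue_integral_def
  proof (rule integral_cong_AE)
    have [measurable]: "\<phi> \<in> borel_measurable borel"
      using cont by (rule borel_measurable_continuous_onI)
    show "(\<lambda>x. heaviside x * \<phi> x) \<in> borel_measurable lborel"
      unfolding heaviside_def by measurable
    show "(\<lambda>x. indicator {0..R} x *\<^sub>R \<phi> x) \<in> borel_measurable lborel"
      by measurable
    show "AE x in lborel. heaviside x * \<phi> x = indicator {0..R} x *\<^sub>R \<phi> x"
      using AE_lborel_singleton[of 0]
      by eventually_elim (use supp in \<open>auto simp: heaviside_def indicator_def not_le\<close>)
  qed
  also have "\<dots> = integral {0..R} \<phi>"
    by (intro set_borel_integral_eq_integral borel_integrable_atLeastAtMost'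
        continuous_on_subset[OF cont subset_UNIV])
  finally show ?thesis .
qed

lemma std_test_functions_continuous: "\<phi> \<in> std_test_functions \<Longrightarrow> continuous_on A \<phi>"
  unfolding std_test_functions_def
  by (auto intro!: continuous_at_imp_continuous_on field_differentiable_imp_continuous_at
      dest: spec[of _ 0])

lemma distribution_regular_heaviside: "distribution (regular_distribution heaviside)"
  unfolding distribution_def
proof (intro conjI ballI allI impI)
  fix \<phi> \<psi> :: "real \<Rightarrow> real" and a b :: real
  assume \<phi>: "\<phi> \<in> std_test_functions" and \<psi>: "\<psi> \<in> std_test_functions"
  note cont = std_test_functions_continuous[OF \<phi>] std_test_functions_continuous[OF \<psi>]
  obtain r s where rs: "\<And>x. r < \<bar>x\<bar> \<Longrightarrow> \<phi> x = 0" "\<And>x. s < \<bar>x\<bar> \<Longrightarrow> \<psi> x = 0"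
    using \<phi> \<psi> unfolding std_test_functions_def by blast
  define R where "R = max r s"
  have R: "\<phi> x = 0" "\<psi> x = 0" if "R < x" for x
    using that rs[of x] by (auto simp: R_def)
  have int: "\<phi> integrable_on {0..R}" "\<psi> integrable_on {0..R}"
    by (intro integrable_continuous_real cont)+
  have "regular_distribution heaviside (\<lambda>x. a * \<phi> x + b * \<psi> x) = integral {0..R} (\<lambda>x. a * \<phi> x + b * \<psi> x)"
    by (intro regular_distribution_heaviside continuous_intros cont) (simp add: R)
  also have "\<dots> = a * integral {0..R} \<phi> + b * integral {0..R} \<psi>"
    using int by (subst integral_add) (auto intro: integrable_on_mult_right)
  finally show "regular_distribution heaviside (\<lambda>x. a * \<phi> x + b * \<psi> x) =
      a * regular_distribution heaviside \<phi> + b * regular_distribution heaviside \<psi>"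
    using regular_distribution_heaviside[OF cont(1), of R] regular_distribution_heaviside[OF cont(2), of R] R
    by simp
next
  fix \<phi> \<psi> assume "test_convergent \<phi> \<psi>"
  then obtain r where \<phi>: "\<And>k. \<phi> k \<in> std_test_functions" and \<psi>: "\<psi> \<in> std_test_functions"
    and r: "\<And>k x. r < \<bar>x\<bar> \<Longrightarrow> \<phi> k x = 0"
    and lim: "\<And>n. uniform_limit UNIV (\<lambda>k. (deriv ^^ n) (\<phi> k)) ((deriv ^^ n) \<psi>) sequentially"
    unfolding test_convergent_def by blast
  \<comment> \<open>Order \<open>0\<close> of the convergence of derivatives is uniform convergence
    of the functions themselves, which allows passing to the limit in integrals over the common
    interval \<open>{0..R}\<close>.\<close>
  have "uniform_limit UNIV \<phi> \<psi> sequentially" using lim[of 0] by simp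
  then have ulim: "uniform_limit A \<phi> \<psi> sequentially" for A
    by (rule uniform_limit_on_subset) simp
  obtain s where s: "\<And>x. s < \<bar>x\<bar> \<Longrightarrow> \<psi> x = 0"
    using \<psi> unfolding std_test_functions_def by blast
  define R where "R = max r s"
  have R: "regular_distribution heaviside (\<phi> k) = integral {0..R} (\<phi> k)"
    "regular_distribution heaviside \<psi> = integral {0..R} \<psi>" for k
    by (intro regular_distribution_heaviside std_test_functions_continuous \<phi> \<psi>;
        auto simp: R_def intro: r s)+
  obtain I J where IJ: "\<And>n. (\<phi> n has_integral I n) {0..R}" "(\<psi> has_integral J) {0..R}" "I \<longlonglongrightarrow> J"
    using uniform_limit_integral[OF ulim std_test_functions_continuous[OF \<phi>], of 0 R] by auto
  then have "I = (\<lambda>k. regular_distribution heaviside (\<phi> k))" "J = regular_distribution heaviside \<psi>"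
    unfolding R by (auto simp: fun_eq_iff intro!: integral_unique[symmetric])
  then show "(\<lambda>k. regular_distribution heaviside (\<phi> k)) \<longlonglongrightarrow> regular_distribution heaviside \<psi>"
    using IJ(3) by simp
qed

lemma distribution_dirac: "distribution (dirac a)"
  unfolding distribution_def dirac_def
proof (intro conjI ballI allI impI)
  fix \<phi> \<psi> assume "test_convergent \<phi> \<psi>"
  then have "\<And>n. uniform_limit UNIV (\<lambda>k. (deriv ^^ n) (\<phi> k)) ((deriv ^^ n) \<psi>) sequentially"
    unfolding test_convergent_def by blast
  from this[of 0] show "(\<lambda>k. \<phi> k a) \<longlonglongrightarrow> \<psi> a"
    by (auto intro: tendsto_uniform_limitI)
qed simp

subsection \<open>Test functions on the grid\<close>

text \<open>Least number principle in a form that transfers once \<open>P\<close> is instantiated by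
  a formula: minimality is expressed through failure at the predecessor alone.\<close>

lemma least_Nats:
  fixes P :: "real \<Rightarrow> bool"
  assumes "\<exists>n\<in>\<nat>. P n"
  shows "\<exists>n\<in>\<nat>. P n \<and> (n = 0 \<or> n - 1 \<in> \<nat> \<and> \<not> P (n - 1))"
proof -
  obtain j where "P (real j)" using assms by (auto elim: Nats_cases)
  then have P: "P (real (LEAST j. P (real j)))" by (rule LeastI)
  show ?thesis
  proof (cases "LEAST j. P (real j)")
    case 0
    then show ?thesis using P by auto
  next
    case (Suc i)
    then have "\<not> P (real i)" by (metis lessI not_less_Least)
    then show ?thesis using P Suc by (intro bexI[of _ "real (Suc i)"]) auto
  qed
qed

locale infinite_grid =
  fixes N :: "'a::nonstandard_extension"
  assumes hypernat: "N \<in> hypernats" and infinite: "N \<notin> \<nat>"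
begin

lemma gt_star_real: "star_real r < N"
  using hypernats_infinite[OF hypernat infinite] .

lemma pos: "0 < N"
  using gt_star_real[of 0] by simp

lemma le_square: "N \<le> N\<^sup>2"
  using gt_star_real[of 1] pos by (simp add: power2_eq_square)

text \<open>Multiplying by \<open>N\<close> removes the existential quantifier of
  \<open>grid\<close>, leaving conditions that the closure rules for internal predicates can
  handle.\<close>

lemma grid_iff: "x \<in> grid N \<longleftrightarrow> x * N \<in> hyperints \<and> - (N\<^sup>2) \<le> x * N \<and> x * N \<le> N\<^sup>2"
proof
  assume "x \<in> grid N"
  then show "x * N \<in> hyperints \<and> - (N\<^sup>2) \<le> x * N \<and> x * N \<le> N\<^sup>2"
    using pos by (auto simp: grid_def)
next
  assume "x * N \<in> hyperints \<and> - (N\<^sup>2) \<le> x * N \<and> x * N \<le> N\<^sup>2"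
  moreover have "x = x * N * (1 / N)" using pos by simp
  ultimately show "x \<in> grid N" unfolding grid_def by blast
qed

lemma grid_mult_iff: "k * (1 / N) \<in> grid N \<longleftrightarrow> k \<in> hyperints \<and> - (N\<^sup>2) \<le> k \<and> k \<le> N\<^sup>2"
  using pos by (simp add: grid_iff)

text \<open>The grid reaches up to \<open>N\<close>, beyond every standard bound, so a limited
  multiple of the step cannot leave it.\<close>

lemma grid_limited:
  assumes "k \<in> hyperints" "limited (k * (1 / N))"
  shows "k * (1 / N) \<in> grid N"
proof -
  obtain r where "\<bar>k * (1 / N)\<bar> \<le> star_real r" using assms(2) by (auto simp: limited_def)
  also have "\<dots> < N" by (rule gt_star_real)
  finally have "\<bar>k\<bar> \<le> N\<^sup>2"
    using pos by (simp add: abs_mult power2_eq_square divide_simps)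
  then show ?thesis using assms(1) unfolding grid_mult_iff by (auto simp: abs_le_iff minus_le_iff)
qed

lemma step_infinitesimal: "infinitesimal (1 / N)"
  by (rule infinitesimal_inverse_infinite) (rule gt_star_real)

lemma grid_dense: "\<exists>x\<in>grid N. x near star_real t"
proof -
  obtain k where k: "k \<in> hyperints" "k \<le> star_real t * N" "star_real t * N < k + 1"
    using hyperfloor[of "star_real t * N"] by blast
  have "\<bar>k * (1 / N) - star_real t\<bar> \<le> 1 / N"
  proof -
    have "k * (1 / N) - star_real t = (k - star_real t * N) * (1 / N)"
      using pos by (simp add: field_simps)
    also have "\<bar>\<dots>\<bar> \<le> 1 * (1 / N)"
      unfolding abs_mult using k pos by (intro mult_mono) (auto simp: abs_le_iff)
    finally show ?thesis by simp
  qed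
  then have near: "k * (1 / N) near star_real t"
    unfolding near_def using pos by (intro infinitesimal_le[OF step_infinitesimal]) simp
  then have "k * (1 / N) \<in> grid N"
    using k(1) near_limited[OF near] by (intro grid_limited) simp_all
  then show ?thesis using near by blast
qed

lemma internal_pred_grid: "internal_pred (\<lambda>x. x \<in> grid N)"
  unfolding grid_iff by (intro internal_intros)

lemma internal_fdiff:
  assumes "f \<in> internal"
  shows "fdiff N f \<in> internal"
proof -
  have "(\<lambda>x. if x \<in> grid N then (f (x + 1 / N) - f x) / (1 / N) else 0) \<in> internal"
    by (intro internal_if internal_pred_grid internal_divide internal_diff internal_const assms
        internal_compose[OF assms] internal_add internal_id)
  then show ?thesis by (simp add: fdiff_def[abs_def])
qed

context
  fixes \<phi> :: "'a \<Rightarrow> 'a"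
  assumes test: "\<phi> \<in> grid_test_functions N"
begin

lemma test_internal: "\<phi> \<in> internal"
  using test by (simp add: grid_test_functions_def grid_functions_def)

lemma test_outside: "x \<notin> grid N \<Longrightarrow> \<phi> x = 0"
  using test by (simp add: grid_test_functions_def grid_functions_def)

text \<open>A natural radius \<open>R\<close> falls on the index \<open>n * R\<close> for every mesh
  \<open>1 / n\<close>, as the Riemann sums require. Off the grid the extension by \<open>0\<close>
  takes over.\<close>

lemma test_support: obtains R :: nat where "\<And>x. star_real (real R) \<le> \<bar>x\<bar> \<Longrightarrow> \<phi> x = 0"
proof -
  obtain r where r: "\<forall>x\<in>grid N. star_real r < \<bar>x\<bar> \<longrightarrow> \<phi> x = 0"
    using test by (auto simp: grid_test_functions_def)
  obtain R :: nat where R: "r < real R" using reals_Archimedean2 by blast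
  show ?thesis
  proof (rule that)
    fix x :: 'a assume "star_real (real R) \<le> \<bar>x\<bar>"
    then have "star_real r < \<bar>x\<bar>" using R by (meson star_real_less_iff less_le_trans)
    then show "\<phi> x = 0" using r test_outside by blast
  qed
qed

lemma test_limited: "x \<in> grid N \<Longrightarrow> limited x \<Longrightarrow> limited (\<phi> x)"
proof -
  have "\<forall>n. \<forall>x\<in>grid N. limited x \<longrightarrow> limited ((fdiff N ^^ n) \<phi> x)"
    using test unfolding grid_test_functions_def by blast
  from this[rule_format, of x 0] show "x \<in> grid N \<Longrightarrow> limited x \<Longrightarrow> limited (\<phi> x)" by simp
qed

lemma test_near:
  assumes "x \<in> grid N" "y \<in> grid N" "limited x" "limited y" "x near y"
  shows "\<phi> x near \<phi> y"
proof -
  have "\<forall>n. \<forall>x\<in>grid N. \<forall>y\<in>grid N. limited x \<and> limited y \<and> x near y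
            \<longrightarrow> (fdiff N ^^ n) \<phi> x near (fdiff N ^^ n) \<phi> y"
    using test unfolding grid_test_functions_def by blast
  from this[rule_format, of x y 0] assms show ?thesis by simp
qed

text \<open>The definite description in \<open>std_part_fun\<close> is meaningful because near
  limited grid points have near values; \<open>x\<close> itself supplies the value.\<close>

lemma test_near_std_part:
  assumes x: "x \<in> grid N" "x near star_real t"
  shows "\<phi> x near star_real (std_part_fun N \<phi> t)"
proof -
  have lim: "limited x" using near_limited[OF x(2)] by simp
  have "std_part_fun N \<phi> t = st (\<phi> x)"
    unfolding std_part_fun_def
  proof (rule the_equality)
    show "\<forall>y\<in>grid N. limited y \<and> st y = t \<longrightarrow> st (\<phi> y) = st (\<phi> x)"
    proof (intro ballI impI)
      fix y assume y: "y \<in> grid N" "limited y \<and> st y = t"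
      then have "y near x" using near_trans[OF _ near_sym[OF x(2)]] near_st by blast
      then have "\<phi> y near \<phi> x" using x(1) y lim by (intro test_near) auto
      then show "st (\<phi> y) = st (\<phi> x)"
        using near_trans[OF _ near_st[OF test_limited[OF x(1) lim]]] st_eq by blast
    qed
    show "s = st (\<phi> x)" if "\<forall>x\<in>grid N. limited x \<and> st x = t \<longrightarrow> st (\<phi> x) = s" for s
      using that x(1) lim st_eq[OF x(2)] by auto
  qed
  then show ?thesis using near_st[OF test_limited[OF x(1) lim]] by simp
qed

text \<open>The strict inequality leaves the standard gap \<open>\<bar>t\<bar> - R\<close>, which an
  infinitesimal displacement to a grid point cannot bridge.\<close>

lemma std_part_support:
  assumes "\<And>x. star_real R \<le> \<bar>x\<bar> \<Longrightarrow> \<phi> x = 0" "R < \<bar>t\<bar>"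
  shows "std_part_fun N \<phi> t = 0"
proof -
  obtain x where x: "x \<in> grid N" "x near star_real t" using grid_dense by blast
  have "\<bar>x - star_real t\<bar> < star_real (\<bar>t\<bar> - R)"
    using x(2) assms(2) unfolding near_def by (intro infinitesimalD) simp_all
  then have "star_real R \<le> \<bar>x\<bar>"
    unfolding star_real_diff star_real_abs by linarith
  then have "\<phi> x = 0" by (rule assms(1))
  then have "(0 :: 'a) near star_real (std_part_fun N \<phi> t)"
    using test_near_std_part[OF x] by simp
  then show ?thesis by (simp add: near_def infinitesimal_star_real)
qed

text \<open>
  Underspill: the estimate holds for all infinite \<open>n\<close>, so the least \<open>n\<close> for which it holds
  is standard.
\<close>

lemma test_modulus:
  assumes x: "x \<in> grid N" "limited x" and e: "0 < e"
  shows "\<exists>j::nat. \<forall>y\<in>grid N. \<bar>y - x\<bar> \<le> star_real (2 / (real j + 1)) \<longrightarrow> \<bar>\<phi> y - \<phi> x\<bar> \<le> star_real e"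
proof -
  \<comment> \<open>The \<open>+ 1\<close> avoids a zero denominator at \<open>n = 0\<close>; the
    numerator \<open>2\<close> leaves room, in the continuity proof, for moving from two reals to
    grid points close to them.\<close>
  define B where "B n \<longleftrightarrow> (\<forall>k\<in>hyperints. \<bar>k * (1 / N) - x\<bar> \<le> 2 / (n + 1) \<longrightarrow>
      \<bar>\<phi> (k * (1 / N)) - \<phi> x\<bar> \<le> star_real e)" for n
  have *: "\<forall>\<phi> :: real \<Rightarrow> real. \<forall>N x e.
      (\<exists>n\<in>\<nat>. \<forall>k\<in>\<int>. \<bar>k * (1 / N) - x\<bar> \<le> 2 / (n + 1) \<longrightarrow> \<bar>\<phi> (k * (1 / N)) - \<phi> x\<bar> \<le> e) \<longrightarrow>
      (\<exists>n\<in>\<nat>. (\<forall>k\<in>\<int>. \<bar>k * (1 / N) - x\<bar> \<le> 2 / (n + 1) \<longrightarrow> \<bar>\<phi> (k * (1 / N)) - \<phi> x\<bar> \<le> e) \<and>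
        (n = 0 \<or> n - 1 \<in> \<nat> \<and>
          \<not> (\<forall>k\<in>\<int>. \<bar>k * (1 / N) - x\<bar> \<le> 2 / (n - 1 + 1) \<longrightarrow> \<bar>\<phi> (k * (1 / N)) - \<phi> x\<bar> \<le> e)))"
    by (intro allI impI) (rule least_Nats)
  have "\<forall>\<phi>\<in>internal. \<forall>N x e.
      (\<exists>n\<in>hypernats. \<forall>k\<in>hyperints. \<bar>k * (1 / N) - x\<bar> \<le> 2 / (n + 1) \<longrightarrow> \<bar>\<phi> (k * (1 / N)) - \<phi> x\<bar> \<le> e) \<longrightarrow>
      (\<exists>n\<in>hypernats. (\<forall>k\<in>hyperints. \<bar>k * (1 / N) - x\<bar> \<le> 2 / (n + 1) \<longrightarrow> \<bar>\<phi> (k * (1 / N)) - \<phi> x\<bar> \<le> (e::'a)) \<and>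
        (n = 0 \<or> n - 1 \<in> hypernats \<and>
          \<not> (\<forall>k\<in>hyperints. \<bar>k * (1 / N) - x\<bar> \<le> 2 / (n - 1 + 1) \<longrightarrow> \<bar>\<phi> (k * (1 / N)) - \<phi> x\<bar> \<le> e)))"
    by (rule transfer_sentence[where 'a = 'a, OF *], (rule transfer_intros)+)
  then have least: "(\<exists>n\<in>hypernats. B n) \<longrightarrow>
      (\<exists>n\<in>hypernats. B n \<and> (n = 0 \<or> n - 1 \<in> hypernats \<and> \<not> B (n - 1)))"
    unfolding B_def using test_internal by blast
  have inf: "B n" if n: "\<And>r. star_real r < n" for n
    unfolding B_def
  proof (intro ballI impI)
    fix k assume k: "k \<in> hyperints" "\<bar>k * (1 / N) - x\<bar> \<le> 2 / (n + 1)"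
    have "infinitesimal (1 / (n + 1))"
    proof (rule infinitesimal_inverse_infinite)
      show "star_real r < n + 1" for r using n[of "r - 1"] by (simp add: star_real_diff)
    qed
    then have "infinitesimal (1 / (n + 1) * star_real 2)"
      by (rule infinitesimal_mult_limited) (rule limited_star_real)
    moreover have "2 / (n + 1) \<ge> 0" using n[of 0] by simp
    ultimately have near: "k * (1 / N) near x"
      unfolding near_def using k(2) by (elim infinitesimal_le) simp
    have lim: "limited (k * (1 / N))" using near_limited[OF near x(2)] .
    have "\<phi> (k * (1 / N)) near \<phi> x"
      using x near lim grid_limited[OF k(1) lim] by (intro test_near)
    then show "\<bar>\<phi> (k * (1 / N)) - \<phi> x\<bar> \<le> star_real e"
      using infinitesimalD[of _ e] e unfolding near_def by (auto intro: less_imp_le)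
  qed
  have "B N" by (rule inf) (rule gt_star_real)
  then obtain n where n: "n \<in> hypernats" "B n" "n = 0 \<or> n - 1 \<in> hypernats \<and> \<not> B (n - 1)"
    using least hypernat by blast
  have "n \<in> \<nat>"
  proof (rule ccontr)
    assume "n \<notin> \<nat>"
    then have inf_n: "star_real r < n" for r using hypernats_infinite[OF n(1)] by blast
    have "star_real r < n - 1" for r
      using inf_n[of "r + 1"] by (simp add: star_real_add less_diff_eq)
    then have "B (n - 1)" by (rule inf)
    then show False using n(3) inf_n[of 0] by simp
  qed
  then obtain j where j: "n = of_nat j" by (rule Nats_cases)
  have eq: "star_real (2 / (real j + 1)) = 2 / (n + 1)"
    by (simp add: j star_real_divide star_real_add star_real_of_nat)
  show ?thesis
  proof (intro exI ballI impI)
    fix y assume y: "y \<in> grid N" "\<bar>y - x\<bar> \<le> star_real (2 / (real j + 1))"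
    have "y = y * N * (1 / N)" using pos by simp
    then show "\<bar>\<phi> y - \<phi> x\<bar> \<le> star_real e"
      using n(2) y unfolding B_def eq grid_iff by metis
  qed
qed

lemma std_part_continuous: "continuous_on A (std_part_fun N \<phi>)"
proof (rule continuous_at_imp_continuous_on, intro ballI)
  fix t
  let ?g = "std_part_fun N \<phi>"
  show "isCont ?g t"
    unfolding continuous_at_eps_delta
  proof (intro allI impI)
    fix e :: real assume e: "e > 0"
    obtain x where x: "x \<in> grid N" "x near star_real t" using grid_dense by blast
    have "limited x" using near_limited[OF x(2)] by simp
    then obtain j :: nat where j: "\<And>y. y \<in> grid N \<Longrightarrow> \<bar>y - x\<bar> \<le> star_real (2 / (real j + 1)) \<Longrightarrow>
        \<bar>\<phi> y - \<phi> x\<bar> \<le> star_real (e / 4)"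
      using test_modulus[OF x(1), of "e / 4"] e by auto
    \<comment> \<open>Half of the radius found for \<open>x\<close>: grid points near
      \<open>s\<close> and near \<open>t\<close> lie within \<open>2 * d\<close> of one another,
      since \<open>dist s t < d\<close> and each replacement costs at most
      \<open>d / 2\<close>.\<close>
    define d where "d = 1 / (real j + 1)"
    have d: "d > 0" "(star_real (2 / (real j + 1)) :: 'a) = star_real d + star_real d"
      by (simp_all add: d_def flip: star_real_add)
    show "\<exists>d>0. \<forall>s. dist s t < d \<longrightarrow> dist (?g s) (?g t) < e"
    proof (intro exI[of _ d] conjI allI impI d(1))
      fix s assume s: "dist s t < d"
      obtain y where y: "y \<in> grid N" "y near star_real s" using grid_dense by blast
      have "\<bar>y - star_real s\<bar> < star_real (d / 2)" "\<bar>x - star_real t\<bar> < star_real (d / 2)"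
        using x(2) y(2) d(1) by (auto simp: near_def intro!: infinitesimalD)
      moreover have "\<bar>star_real s - star_real t\<bar> < (star_real d :: 'a)"
        using s unfolding star_real_diff[symmetric] star_real_abs[symmetric] by (simp add: dist_real_def)
      moreover have "(star_real d :: 'a) = star_real (d / 2) + star_real (d / 2)"
        by (simp flip: star_real_add)
      ultimately have "\<bar>y - x\<bar> \<le> star_real d + star_real d" by linarith
      then have yx: "\<bar>\<phi> y - \<phi> x\<bar> \<le> star_real (e / 4)" using j[OF y(1)] d(2) by simp
      have "\<bar>\<phi> y - star_real (?g s)\<bar> < star_real (e / 4)" "\<bar>\<phi> x - star_real (?g t)\<bar> < star_real (e / 4)"
        using test_near_std_part[OF x] test_near_std_part[OF y] e
        by (auto simp: near_def intro!: infinitesimalD)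
      \<comment> \<open>Three quarters are spent on the detour through \<open>\<phi> y\<close> and
        \<open>\<phi> x\<close>; the last one is spare.\<close>
      moreover have "(star_real e :: 'a) = star_real (e / 4) + star_real (e / 4) + star_real (e / 4) + star_real (e / 4)"
        by (simp flip: star_real_add)
      moreover have "(0 :: 'a) < star_real (e / 4)" using e by simp
      ultimately have "\<bar>star_real (?g s) - star_real (?g t)\<bar> < (star_real e :: 'a)"
        using yx by linarith
      then show "dist (?g s) (?g t) < e"
        unfolding star_real_diff[symmetric] star_real_abs[symmetric] by (simp add: dist_real_def)
    qed
  qed
qed

text \<open>Both sides are near the value of the standard part at \<open>st x\<close>: the left by
  construction of that value, the right by transferring the epsilon-delta statement of continuity
  there.\<close>

lemma test_near_star_std_part:
  assumes x: "x \<in> grid N" "limited x"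
  shows "\<phi> x near star_fun (std_part_fun N \<phi>) x"
proof -
  let ?g = "std_part_fun N \<phi>"
  define t where "t = st x"
  have xt: "x near star_real t" using near_st[OF x(2)] by (simp add: t_def)
  have "star_fun ?g x near star_real (?g t)"
    unfolding near_def
  proof (rule infinitesimalI)
    fix e :: real assume e: "e > 0"
    have "isCont ?g t" using std_part_continuous[of UNIV] by (simp add: continuous_on_eq_continuous_at)
    then obtain d where d: "d > 0" "\<And>s. dist s t < d \<Longrightarrow> dist (?g s) (?g t) < e"
      using e unfolding continuous_at_eps_delta by blast
    have *: "\<forall>s. \<bar>s - t\<bar> < d \<longrightarrow> \<bar>?g s - ?g t\<bar> < e" using d(2) by (simp add: dist_real_def)
    have "\<forall>s. \<bar>s - star_real t\<bar> < star_real d \<longrightarrow> \<bar>star_fun ?g s - star_real (?g t)\<bar> < (star_real e :: 'a)"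
      by (rule transfer_sentence[where 'a = 'a, OF *], (rule transfer_intros)+)
    then show "\<bar>star_fun ?g x - star_real (?g t)\<bar> \<le> star_real e"
      using xt infinitesimalD[of "x - star_real t" d] d(1) unfolding near_def by (auto intro: less_imp_le)
  qed
  then show ?thesis using near_trans[OF test_near_std_part[OF x(1) xt] near_sym] by blast
qed

end

end

subsection \<open>Powers of the ramp\<close>

context
  fixes m :: "'a::nonstandard_extension"
  assumes m: "m \<in> hypernats" "1 \<le> m"
begin

lemma hyperpow_0: "hyperpow 0 m = 0"
proof -
  have *: "\<forall>m\<in>\<nat>. 1 \<le> m \<longrightarrow> (0::real) ^ nat \<lfloor>m\<rfloor> = 0" by (auto elim!: Nats_cases)
  have "\<forall>m\<in>hypernats. 1 \<le> m \<longrightarrow> hyperpow (0::'a) m = 0"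
    by (rule transfer_sentence[where 'a = 'a, OF *], (rule transfer_intros)+)
  with m show ?thesis by blast
qed

lemma hyperpow_1: "hyperpow 1 m = 1"
proof -
  have *: "\<forall>m. (1::real) ^ nat \<lfloor>m\<rfloor> = 1" by simp
  have "\<forall>m. hyperpow (1::'a) m = 1"
    by (rule transfer_sentence[where 'a = 'a, OF *], (rule transfer_intros)+)
  then show ?thesis by blast
qed

lemma hyperpow_mono: "0 \<le> x \<Longrightarrow> x \<le> y \<Longrightarrow> hyperpow x m \<le> hyperpow y m"
proof -
  have *: "\<forall>m x y. 0 \<le> x \<longrightarrow> x \<le> y \<longrightarrow> x ^ nat \<lfloor>m\<rfloor> \<le> (y::real) ^ nat \<lfloor>m\<rfloor>"
    by (auto intro: power_mono)
  have "\<forall>m x y. 0 \<le> x \<longrightarrow> x \<le> y \<longrightarrow> hyperpow x m \<le> hyperpow (y::'a) m"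
    by (rule transfer_sentence[where 'a = 'a, OF *], (rule transfer_intros)+)
  then show "0 \<le> x \<Longrightarrow> x \<le> y \<Longrightarrow> hyperpow x m \<le> hyperpow y m" by blast
qed

end

lemma hyperpow_inject:
  fixes x :: "'a::nonstandard_extension"
  assumes "m \<in> hypernats" "n \<in> hypernats" "0 < x" "x < 1" "hyperpow x m = hyperpow x n"
  shows "m = n"
proof -
  have *: "\<forall>m\<in>\<nat>. \<forall>n\<in>\<nat>. \<forall>x. 0 < x \<longrightarrow> x < 1 \<longrightarrow> x ^ nat \<lfloor>m\<rfloor> = (x::real) ^ nat \<lfloor>n\<rfloor> \<longrightarrow> m = n"
    by (auto elim!: Nats_cases simp: power_inject_exp')
  have "\<forall>m\<in>hypernats. \<forall>n\<in>hypernats. \<forall>x. 0 < x \<longrightarrow> x < 1 \<longrightarrow> hyperpow x m = hyperpow (x::'a) n \<longrightarrow> m = n"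
    by (rule transfer_sentence[where 'a = 'a, OF *], (rule transfer_intros)+)
  with assms show ?thesis by blast
qed

section \<open>Values of the ramp at the grid points\<close>

locale ramp = infinite_grid +
  fixes M :: "'a::nonstandard_extension" and h :: "'a \<Rightarrow> 'a"
  assumes M: "M \<in> hypernats" "M \<notin> \<nat>" "M * (1 / N) near 0"
    and h: "h = (\<lambda>x. if x \<notin> grid N then 0
                     else if x \<le> 0 then 0
                     else if x < M * (1 / N) then x / (M * (1 / N))
                     else 1)"
begin

lemma M_gt_star_real: "star_real r < M"
  using hypernats_infinite[OF M(1,2)] .

lemma M_pos: "0 < M"
  using M_gt_star_real[of 0] by simp

lemma M_infinitesimal: "infinitesimal (M / N)"
  using M(3) by (simp add: near_def)

lemma M_le_square: "M \<le> N\<^sup>2"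
proof -
  have "\<bar>M / N\<bar> < star_real 1" using M_infinitesimal by (rule infinitesimalD) simp
  then have "M < N" using pos by (simp add: abs_less_iff)
  then show ?thesis using le_square by simp
qed

lemma h_grid:
  assumes "k * (1 / N) \<in> grid N"
  shows "h (k * (1 / N)) = (if k \<le> 0 then 0 else if k < M then k / M else 1)"
proof -
  have "0 < 1 / N" using pos by simp
  then have "k * (1 / N) \<le> 0 \<longleftrightarrow> k \<le> 0" "k * (1 / N) < M * (1 / N) \<longleftrightarrow> k < M"
    "k * (1 / N) / (M * (1 / N)) = k / M"
    using mult_le_cancel_right_pos[of "1 / N" k 0] mult_less_cancel_right_pos[of "1 / N" k M]
      nonzero_mult_divide_mult_cancel_right[of "1 / N" k M]
    by (simp_all only: mult_zero_left)
  then show ?thesis using assms unfolding h by (simp only: not_True_eq_False if_False)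
qed

lemma h_nonpos: "k \<le> 0 \<Longrightarrow> h (k * (1 / N)) = 0"
  using h_grid[of k] by (cases "k * (1 / N) \<in> grid N") (simp_all add: h)

text \<open>At \<open>k = M\<close> the linear formula agrees with the constant branch. Including
  this point makes it valid at both ends of every step of the ramp, the last one included.\<close>

lemma h_linear:
  assumes "k \<in> hyperints" "0 \<le> k" "k \<le> M"
  shows "h (k * (1 / N)) = k / M"
proof -
  have "- (N\<^sup>2) \<le> k" using assms(2) by (auto intro: order_trans[of _ 0])
  then have "k * (1 / N) \<in> grid N"
    unfolding grid_mult_iff using assms M_le_square order_trans by blast
  from h_grid[OF this] have "h (k * (1 / N)) = (if k \<le> 0 then 0 else if k < M then k / M else 1)" .
  moreover have "k = 0 \<or> 0 < k \<and> k < M \<or> k = M" using assms by (auto simp: le_less)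
  ultimately show ?thesis using M_pos by (elim disjE conjE) simp_all
qed

lemma h_one:
  assumes "k \<in> hyperints" "M \<le> k" "k \<le> N\<^sup>2"
  shows "h (k * (1 / N)) = 1"
proof -
  have "- (N\<^sup>2) \<le> k" using assms(2) M_pos less_le_trans[OF M_pos assms(2)] by (auto intro: order_trans[of _ 0])
  then have "k * (1 / N) \<in> grid N"
    unfolding grid_mult_iff using assms M_le_square order_trans by blast
  from h_grid[OF this] show ?thesis
    using assms(2) less_le_trans[OF M_pos assms(2)] by (simp add: not_le not_less)
qed

lemma h_bounds: "0 \<le> h x" "h x \<le> 1"
proof -
  have "0 < M * (1 / N)" using pos M_pos by simp
  then have "0 \<le> x / (M * (1 / N)) \<and> x / (M * (1 / N)) \<le> 1" if "0 < x" "x < M * (1 / N)"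
    using that less_imp_le by (simp only: divide_le_eq_1_pos zero_le_divide_iff) blast
  then show "0 \<le> h x" "h x \<le> 1" unfolding h by (simp_all only: not_le not_less split: if_split) auto
qed

lemma h_step:
  assumes "k \<in> hyperints" "0 \<le> k" "k < M"
  shows "h (k * (1 / N)) = k / M" "h ((k + 1) * (1 / N)) = (k + 1) / M"
proof -
  have "k + 1 \<in> hyperints" using hyperints_add[OF assms(1) hyperints_0_1(2)] .
  moreover have "k + 1 \<le> M" using hyperints_discrete[OF assms(1) hyperints_hypernats[OF M(1)] assms(3)] .
  ultimately show "h ((k + 1) * (1 / N)) = (k + 1) / M" using assms(2) by (intro h_linear) simp_all
  show "h (k * (1 / N)) = k / M" using assms(3) by (intro h_linear assms(1,2)) simp
qed

lemma internal_on_grid: "f \<in> internal \<Longrightarrow> (\<lambda>k. f (k * (1 / N))) \<in> internal"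
  by (erule internal_compose) (intro internal_intros)

lemma h_internal: "h \<in> internal"
  unfolding h by (intro internal_intros internal_pred_grid)

section \<open>A single power and the distributions represented by it and its difference\<close>

context
  fixes m :: 'a
  assumes m: "m \<in> hypernats" "1 \<le> m"
begin

lemma power_internal: "grid_pow h m \<in> internal"
  unfolding grid_pow_def by (intro internal_hyperpow internal_const h_internal)

lemma power_grid_function: "grid_pow h m \<in> grid_functions N"
  using power_internal by (auto simp: grid_functions_def grid_pow_def h hyperpow_0[OF m])

lemma fdiff_power_grid_function: "fdiff N (grid_pow h m) \<in> grid_functions N"
  using internal_fdiff[OF power_internal] by (auto simp: grid_functions_def fdiff_def)

lemma power_nonpos: "k \<le> 0 \<Longrightarrow> grid_pow h m (k * (1 / N)) = 0"
  unfolding grid_pow_def by (subst h_nonpos) (simp_all add: hyperpow_0[OF m])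

lemma power_one: "k \<in> hyperints \<Longrightarrow> M \<le> k \<Longrightarrow> k \<le> N\<^sup>2 \<Longrightarrow> grid_pow h m (k * (1 / N)) = 1"
  unfolding grid_pow_def by (subst h_one) (simp_all add: hyperpow_1[OF m])

lemma power_bounds: "0 \<le> grid_pow h m x" "grid_pow h m x \<le> 1"
  using hyperpow_mono[OF m, of 0 "h x"] hyperpow_mono[OF m, of "h x" 1] h_bounds[of x]
  by (simp_all add: grid_pow_def hyperpow_0[OF m] hyperpow_1[OF m])

lemma power_step_mono:
  assumes "k \<in> hyperints" "0 \<le> k" "k < M"
  shows "grid_pow h m (k * (1 / N)) \<le> grid_pow h m ((k + 1) * (1 / N))"
  unfolding grid_pow_def h_step[OF assms]
  using assms M_pos by (intro hyperpow_mono[OF m]) (simp_all add: divide_right_mono)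

text \<open>The summands \<open>F\<close> and \<open>G\<close> differ in two ways. On the ramp their
  difference is merely bounded, but this concerns fewer than \<open>M\<close> indices and
  \<open>M / N\<close> is infinitesimal. From the ramp up to \<open>R\<close> it is below any
  standard \<open>e\<close>, over a standard length. Elsewhere both vanish.\<close>

lemma grid_inner_power_near:
  assumes test: "\<phi> \<in> grid_test_functions N"
    and R: "\<And>x. star_real (real R) \<le> \<bar>x\<bar> \<Longrightarrow> \<phi> x = 0"
  shows "grid_inner N (grid_pow h m) \<phi> near star_real (integral {0..real R} (std_part_fun N \<phi>))"
proof -
  let ?g = "std_part_fun N \<phi>"
  have supp: "?g t = 0" if "real R < \<bar>t\<bar>" for t
    using std_part_support[OF test R that] .
  have supp_star: "star_fun ?g x = 0" if "star_real (real R) < x" for x :: 'a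
  proof -
    have *: "\<forall>x. real R < x \<longrightarrow> ?g x = 0" using supp by auto
    have "\<forall>x::'a. star_real (real R) < x \<longrightarrow> star_fun ?g x = 0"
      by (rule transfer_sentence[where 'a = 'a, OF *], (rule transfer_intros)+)
    with that show ?thesis by blast
  qed
  \<comment> \<open>The bound must be standard for its product with \<open>M / N\<close> to be
    infinitesimal; compactness supplies one.\<close>
  have "bounded (?g ` {- real R..real R})"
    by (intro compact_imp_bounded compact_continuous_image std_part_continuous[OF test] compact_Icc)
  then obtain C where C: "0 < C" "\<And>x. x \<in> {- real R..real R} \<Longrightarrow> \<bar>?g x\<bar> \<le> C"
    unfolding bounded_pos by auto
  have bound: "\<bar>?g x\<bar> \<le> C" for x
    using C(2)[of x] supp[of x] C(1) by (cases "real R < \<bar>x\<bar>") (auto simp: not_less abs_le_iff)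
  have bound_star: "\<bar>star_fun ?g x\<bar> \<le> star_real C" for x :: 'a
  proof -
    have *: "\<forall>x. \<bar>?g x\<bar> \<le> C" using bound by blast
    have "\<forall>x::'a. \<bar>star_fun ?g x\<bar> \<le> star_real C"
      by (rule transfer_sentence[where 'a = 'a, OF *], (rule transfer_intros)+)
    then show ?thesis by blast
  qed
  define F where "F k = grid_pow h m (k * (1 / N)) * \<phi> (k * (1 / N))" for k
  define G where "G k = (if 0 < k then star_fun ?g (k * (1 / N)) else 0)" for k
  have F: "F \<in> internal" unfolding F_def
    by (intro internal_mult internal_on_grid[OF power_internal] internal_on_grid[OF test_internal[OF test]])
  have G: "G \<in> internal" unfolding G_def
    by (intro internal_intros internal_compose[OF internal_star_fun])
  have "infinitesimal (1 / N * hypersum F (- (N\<^sup>2)) (N\<^sup>2) - 1 / N * hypersum G (- (N\<^sup>2)) (N\<^sup>2))"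
  proof (rule infinitesimalI)
    fix r :: real assume r: "r > 0"
    \<comment> \<open>The ramp will cost at most \<open>e\<close> and the remainder at most
      \<open>R * e\<close>, together at most \<open>r\<close>; the cap \<open>1\<close> serves the
      crude bound \<open>2 * C + 1\<close>.\<close>
    define e where "e = min 1 (r / (real R + 1))"
    have e: "0 < e" "e \<le> 1" "e * (real R + 1) \<le> r"
    proof -
      show "0 < e" "e \<le> 1" using r by (simp_all add: e_def)
      have "e \<le> r / (real R + 1)" by (simp add: e_def)
      then show "e * (real R + 1) \<le> r" by (simp add: pos_le_divide_eq)
    qed
    let ?c = "star_real (2 * C + 1) :: 'a"
    have "\<bar>hypersum F (- (N\<^sup>2)) (N\<^sup>2) - hypersum G (- (N\<^sup>2)) (N\<^sup>2)\<bar> \<le>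
        M * ?c + star_real (real R) * N * star_real e"
    proof (rule hypersum_compare[OF F G])
      show "0 \<le> star_real (real R) * N" "0 \<le> M" "0 \<le> ?c" "0 \<le> (star_real e :: 'a)"
        using pos M_pos C(1) e(1) by simp_all
      show "\<forall>k\<in>hyperints. \<bar>F k - G k\<bar> \<le>
          (if k \<le> 0 \<or> star_real (real R) * N < k then 0 else if k < M then ?c else star_real e)"
      proof
        fix k :: 'a assume k: "k \<in> hyperints"
        let ?x = "k * (1 / N)"
        consider "k \<le> 0" | "0 < k" "star_real (real R) * N < k" | "0 < k" "k \<le> star_real (real R) * N"
          by linarith
        then show "\<bar>F k - G k\<bar> \<le>
          (if k \<le> 0 \<or> star_real (real R) * N < k then 0 else if k < M then ?c else star_real e)"
        proof cases
          case 1
          then show ?thesis using power_nonpos[OF 1] by (simp add: F_def G_def)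
        next
          case 2
          then have x: "star_real (real R) < ?x" using pos by (simp add: field_simps)
          then have "star_real (real R) \<le> \<bar>?x\<bar>" by (rule order_trans[OF less_imp_le abs_ge_self])
          then have "\<phi> ?x = 0" by (rule R)
          then show ?thesis using 2 supp_star[OF x] by (simp add: F_def G_def)
        next
          case 3
          then have "0 \<le> ?x" "?x \<le> star_real (real R)" using pos by (simp_all add: field_simps)
          then have "\<bar>?x\<bar> \<le> star_real (real R)" by (simp only: abs_of_nonneg)
          then have lim: "limited ?x" by (auto simp: limited_def)
          have grid: "?x \<in> grid N" using grid_limited[OF k lim] .
          have near: "\<bar>\<phi> ?x - star_fun ?g ?x\<bar> < star_real e"
            using test_near_star_std_part[OF test grid lim] e(1)
            unfolding near_def by (rule infinitesimalD)
          show ?thesis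
          proof (cases "k < M")
            case True
            \<comment> \<open>On the ramp \<open>\<phi>\<close> is bounded by \<open>C + e\<close>,
              the power does not exceed 1, and subtracting the standard part adds another
              \<open>C\<close>.\<close>
            have "\<bar>grid_pow h m ?x * \<phi> ?x\<bar> \<le> 1 * \<bar>\<phi> ?x\<bar>"
              unfolding abs_mult using power_bounds by (intro mult_right_mono) simp_all
            moreover have "(star_real e :: 'a) \<le> 1" using star_real_le_iff[of e 1] e(2) by simp
            moreover have "?c = star_real C + star_real C + 1"
              by (simp add: star_real_add star_real_mult)
            ultimately have "\<bar>grid_pow h m ?x * \<phi> ?x - star_fun ?g ?x\<bar> \<le> ?c"
              using near bound_star[of ?x] by linarith
            then show ?thesis using 3 True by (simp add: F_def G_def)
          next
            case False
            then have "grid_pow h m ?x = 1"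
              using k grid by (intro power_one) (simp_all only: grid_mult_iff not_less)
            then show ?thesis using 3 False near by (simp add: F_def G_def)
          qed
        qed
      qed
    qed
    then have "1 / N * \<bar>hypersum F (- (N\<^sup>2)) (N\<^sup>2) - hypersum G (- (N\<^sup>2)) (N\<^sup>2)\<bar> \<le>
        1 / N * (M * ?c + star_real (real R) * N * star_real e)"
      using pos by (intro mult_left_mono) simp_all
    also have "\<dots> = M / N * ?c + star_real (real R) * star_real e"
      using pos by (simp add: field_simps)
    also have "\<dots> \<le> star_real e + star_real (real R) * star_real e"
      using infinitesimalD[OF infinitesimal_mult_limited[OF M_infinitesimal limited_star_real] e(1)]
      by (intro add_right_mono) (meson abs_ge_self less_imp_le order_trans)
    also have "\<dots> = star_real (e * (real R + 1))"
      by (simp add: star_real_add star_real_mult algebra_simps)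
    also have "\<dots> \<le> star_real r" using e(3) by simp
    finally have "1 / N * \<bar>hypersum F (- (N\<^sup>2)) (N\<^sup>2) - hypersum G (- (N\<^sup>2)) (N\<^sup>2)\<bar> \<le> star_real r" .
    moreover have "\<bar>1 / N\<bar> = 1 / N" using pos by simp
    ultimately show "\<bar>1 / N * hypersum F (- (N\<^sup>2)) (N\<^sup>2) - 1 / N * hypersum G (- (N\<^sup>2)) (N\<^sup>2)\<bar> \<le> star_real r"
      by (simp only: abs_mult flip: right_diff_distrib)
  qed
  then have "1 / N * hypersum F (- (N\<^sup>2)) (N\<^sup>2) near 1 / N * hypersum G (- (N\<^sup>2)) (N\<^sup>2)"
    by (simp only: near_def)
  moreover have "1 / N * hypersum G (- (N\<^sup>2)) (N\<^sup>2) near star_real (integral {0..real R} ?g)"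
    unfolding G_def[abs_def]
    by (rule hypersum_riemann[OF std_part_continuous[OF test] supp hypernat infinite]) simp
  ultimately have "1 / N * hypersum F (- (N\<^sup>2)) (N\<^sup>2) near star_real (integral {0..real R} ?g)"
    by (rule near_trans)
  then show ?thesis unfolding grid_inner_def F_def[abs_def] .
qed

lemma power_represents_heaviside: "represents N (grid_pow h m) (regular_distribution heaviside)"
  unfolding represents_def
proof (intro conjI ballI power_grid_function distribution_regular_heaviside)
  fix \<phi> assume test: "\<phi> \<in> grid_test_functions N"
  obtain R :: nat where R: "\<And>x. star_real (real R) \<le> \<bar>x\<bar> \<Longrightarrow> \<phi> x = 0"
    using test_support[OF test] by blast
  note near = grid_inner_power_near[OF test R]
  show "limited (grid_inner N (grid_pow h m) \<phi>)"
    using near_limited[OF near] by simp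
  have "regular_distribution heaviside (std_part_fun N \<phi>) = integral {0..real R} (std_part_fun N \<phi>)"
    using std_part_support[OF test R]
    by (intro regular_distribution_heaviside std_part_continuous[OF test]) simp
  then show "st (grid_inner N (grid_pow h m) \<phi>) = regular_distribution heaviside (std_part_fun N \<phi>)"
    using st_eq[OF near] by simp
qed

text \<open>
  The increments of \<open>h\<^sup>m\<close> are nonnegative with sum \<open>1\<close> and live infinitely close to \<open>0\<close>, where
  \<open>\<phi>\<close> is nearly constant.
\<close>

lemma grid_inner_fdiff_power_near:
  assumes test: "\<phi> \<in> grid_test_functions N"
  shows "grid_inner N (fdiff N (grid_pow h m)) \<phi> near \<phi> 0"
  unfolding near_def
proof (rule infinitesimalI)
  fix e :: real assume e: "e > 0"
  have zero: "0 \<in> grid N" "limited (0 :: 'a)"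
    using hyperints_0_1(1) limited_star_real[of 0] by (simp_all add: grid_iff)
  show "\<bar>grid_inner N (fdiff N (grid_pow h m)) \<phi> - \<phi> 0\<bar> \<le> star_real e"
    unfolding grid_inner_def
  proof (rule hypersum_increments[where p = "\<lambda>k. grid_pow h m (k * (1 / N))"
        and q = "\<lambda>k. \<phi> (k * (1 / N))" and M = M])
    show "\<forall>k\<in>hyperints. \<bar>k\<bar> \<le> N\<^sup>2 \<longrightarrow> fdiff N (grid_pow h m) (k * (1 / N)) * \<phi> (k * (1 / N)) =
        (grid_pow h m ((k + 1) * (1 / N)) - grid_pow h m (k * (1 / N))) / (1 / N) * \<phi> (k * (1 / N))"
    proof (intro ballI impI)
      fix k assume k: "k \<in> hyperints" "\<bar>k\<bar> \<le> N\<^sup>2"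
      then have "k * (1 / N) \<in> grid N" unfolding grid_mult_iff by (auto simp: abs_le_iff minus_le_iff)
      moreover have "k * (1 / N) + 1 / N = (k + 1) * (1 / N)" by (simp only: distrib_right mult_1)
      ultimately show "fdiff N (grid_pow h m) (k * (1 / N)) * \<phi> (k * (1 / N)) =
        (grid_pow h m ((k + 1) * (1 / N)) - grid_pow h m (k * (1 / N))) / (1 / N) * \<phi> (k * (1 / N))"
        by (simp only: fdiff_def if_True)
    qed
    show "\<forall>k\<in>hyperints. 0 \<le> k \<longrightarrow> k < M \<longrightarrow>
        grid_pow h m (k * (1 / N)) \<le> grid_pow h m ((k + 1) * (1 / N)) \<and>
        \<bar>\<phi> (k * (1 / N)) - \<phi> 0\<bar> \<le> star_real e"
    proof (intro ballI impI conjI power_step_mono)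
      fix k assume k: "k \<in> hyperints" "0 \<le> k" "k < M"
      have "infinitesimal (k * (1 / N))"
        using k pos by (intro infinitesimal_le[OF M_infinitesimal]) (simp add: divide_right_mono)
      then have near: "k * (1 / N) near 0" "limited (k * (1 / N))"
        by (simp_all only: near_def diff_0_right infinitesimal_imp_limited)
      then have "\<phi> (k * (1 / N)) near \<phi> 0"
        using grid_limited[OF k(1) near(2)] zero by (intro test_near[OF test])
      then show "\<bar>\<phi> (k * (1 / N)) - \<phi> 0\<bar> \<le> star_real e"
        using infinitesimalD[of _ e] e unfolding near_def by (auto intro: less_imp_le)
    qed
    obtain R :: nat where R: "\<And>x. star_real (real R) \<le> \<bar>x\<bar> \<Longrightarrow> \<phi> x = 0"
      using test_support[OF test] by blast
    \<comment> \<open>The right end point \<open>N\<close> exceeds any standard radius, so the fall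
      of h^m to \<open>0\<close> just beyond it is multiplied by \<open>0\<close>.\<close>
    show "\<phi> (N\<^sup>2 * (1 / N)) = 0"
      using gt_star_real[of "real R"] pos by (intro R) (simp add: power2_eq_square)
    show "\<forall>k\<in>hyperints. k \<le> 0 \<longrightarrow> grid_pow h m (k * (1 / N)) = 0"
      using power_nonpos by blast
    show "\<forall>k\<in>hyperints. M \<le> k \<longrightarrow> k \<le> N\<^sup>2 \<longrightarrow> grid_pow h m (k * (1 / N)) = 1"
      using power_one by blast
    note internal = internal_on_grid[OF test_internal[OF test]] internal_on_grid[OF power_internal]
    show "(\<lambda>k. fdiff N (grid_pow h m) (k * (1 / N)) * \<phi> (k * (1 / N))) \<in> internal"
      by (intro internal_mult internal internal_on_grid[OF internal_fdiff[OF power_internal]])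
    show "(\<lambda>k. grid_pow h m (k * (1 / N))) \<in> internal" "(\<lambda>k. \<phi> (k * (1 / N))) \<in> internal"
      by (fact internal)+
  qed (fact hypernat M(1) pos M_le_square)+
qed

lemma fdiff_power_represents_dirac: "represents N (fdiff N (grid_pow h m)) (dirac 0)"
  unfolding represents_def
proof (intro conjI ballI fdiff_power_grid_function distribution_dirac)
  fix \<phi> assume test: "\<phi> \<in> grid_test_functions N"
  have "0 \<in> grid N" using hyperints_0_1(1) by (simp add: grid_iff)
  then have "\<phi> 0 near star_real (std_part_fun N \<phi> 0)"
    by (rule test_near_std_part[OF test]) (simp add: near_def)
  with grid_inner_fdiff_power_near[OF test]
  have near: "grid_inner N (fdiff N (grid_pow h m)) \<phi> near star_real (std_part_fun N \<phi> 0)"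
    by (rule near_trans)
  show "limited (grid_inner N (fdiff N (grid_pow h m)) \<phi>)"
    using near_limited[OF near] by simp
  show "st (grid_inner N (fdiff N (grid_pow h m)) \<phi>) = dirac 0 (std_part_fun N \<phi>)"
    using st_eq[OF near] by (simp add: dirac_def)
qed

end

text \<open>At the first positive grid point \<open>h\<close> takes the value \<open>1 / M\<close>,
  strictly between 0 and 1, and there a power determines its exponent.\<close>

lemma power_inject:
  assumes "m \<in> hypernats" "n \<in> hypernats" "grid_pow h m = grid_pow h n"
  shows "m = n"
proof -
  have "1 < M" using M_gt_star_real[of 1] by simp
  then have "h (1 * (1 / N)) = 1 / M" by (intro h_linear hyperints_0_1) simp_all
  then have "hyperpow (1 / M) m = hyperpow (1 / M) n"
    using fun_cong[OF assms(3), of "1 * (1 / N)"] by (simp only: grid_pow_def)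
  then show ?thesis
    using assms(1,2) \<open>1 < M\<close> by (intro hyperpow_inject[of m n "1 / M"]) simp_all
qed

text \<open>Off the ramp the two powers coincide, both 0 or both 1, so only the indices
  \<open>0 \<le> k < M\<close> count, where \<open>h\<close> has slope \<open>N / M\<close>. What
  remains is a difference of power means of mesh \<open>1 / M\<close>, and the error
  \<open>1 / M\<close> is infinitesimal.\<close>

lemma grid_inner_power_diff_fdiff_near:
  assumes m: "m \<in> hypernats" "1 \<le> m" and n: "n \<in> hypernats" "1 \<le> n"
  shows "grid_inner N (\<lambda>x. grid_pow h m x - grid_pow h n x) (fdiff N h)
    near (1 / (m + 1) - 1 / (n + 1))"
proof -
  have "\<bar>grid_inner N (\<lambda>x. grid_pow h m x - grid_pow h n x) (fdiff N h) - (1 / (m + 1) - 1 / (n + 1))\<bar> \<le> 1 / M"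
    unfolding grid_inner_def
  proof (rule hypersum_power_difference[OF _ hypernat M(1) m(1) n(1) pos M_pos M_le_square])
    show "(\<lambda>k. (grid_pow h m (k * (1 / N)) - grid_pow h n (k * (1 / N))) * fdiff N h (k * (1 / N))) \<in> internal"
      by (intro internal_mult internal_diff internal_on_grid[OF power_internal[OF m]]
          internal_on_grid[OF power_internal[OF n]] internal_on_grid[OF internal_fdiff[OF h_internal]])
    show "\<forall>k\<in>hyperints. \<bar>k\<bar> \<le> N\<^sup>2 \<longrightarrow>
        (grid_pow h m (k * (1 / N)) - grid_pow h n (k * (1 / N))) * fdiff N h (k * (1 / N)) =
        (if 0 \<le> k \<and> k < M then (hyperpow (k / M) m - hyperpow (k / M) n) * (N / M) else 0)"
    proof (intro ballI impI)
      fix k assume k: "k \<in> hyperints" "\<bar>k\<bar> \<le> N\<^sup>2"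
      consider "k < 0" | "0 \<le> k" "k < M" | "M \<le> k" by linarith
      then show "(grid_pow h m (k * (1 / N)) - grid_pow h n (k * (1 / N))) * fdiff N h (k * (1 / N)) =
        (if 0 \<le> k \<and> k < M then (hyperpow (k / M) m - hyperpow (k / M) n) * (N / M) else 0)"
      proof cases
        case 1
        then show ?thesis using power_nonpos[OF m, of k] power_nonpos[OF n, of k] by simp
      next
        case 2
        have grid: "k * (1 / N) \<in> grid N"
          using k unfolding grid_mult_iff by (auto simp: abs_le_iff minus_le_iff)
        have step: "k * (1 / N) + 1 / N = (k + 1) * (1 / N)" by (simp only: distrib_right mult_1)
        have "fdiff N h (k * (1 / N)) = ((k + 1) / M - k / M) / (1 / N)"
          using grid unfolding fdiff_def step h_step[OF k(1) 2] by simp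
        also have "\<dots> = N / M" by (simp add: add_divide_distrib)
        finally have "fdiff N h (k * (1 / N)) = N / M" .
        then show ?thesis
          using 2 unfolding grid_pow_def h_step(1)[OF k(1) 2] by simp
      next
        \<comment> \<open>This range includes \<open>k = N\<^sup>2\<close>, where
          \<open>fdiff N h\<close> is \<open>- N\<close>; both powers equal 1 there, so the product
          is still \<open>0\<close>.\<close>
        case 3
        moreover have "k \<le> N\<^sup>2" using k(2) by (simp add: abs_le_iff)
        ultimately show ?thesis
          using power_one[OF m k(1)] power_one[OF n k(1)] M_pos by simp
      qed
    qed
  qed
  moreover have "infinitesimal (1 / M)"
    by (rule infinitesimal_inverse_infinite) (rule M_gt_star_real)
  ultimately show ?thesis
    unfolding near_def using M_pos by (elim infinitesimal_le) simp
qed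

end

theorem lemma6p1:
  fixes N\<^sub>0 N \<epsilon> M :: "'a::nonstandard_extension"
    and h :: "'a \<Rightarrow> 'a"
  assumes N\<^sub>0: "N\<^sub>0 \<in> hypernats" "N\<^sub>0 \<notin> \<nat>"
    and N: "N = hyperfact N\<^sub>0"
    and \<epsilon>: "\<epsilon> = 1 / N"
    and M: "M \<in> hypernats" "M \<notin> \<nat>" "M * \<epsilon> near 0"
    and h: "h = (\<lambda>x. if x \<notin> grid N then 0
                     else if x \<le> 0 then 0
                     else if x < M * \<epsilon> then x / (M * \<epsilon>)
                     else 1)"
  shows "(\<forall>m\<in>hypernats. 1 \<le> m \<longrightarrow>
            represents N (grid_pow h m) (regular_distribution heaviside) \<and>
            represents N (fdiff N (grid_pow h m)) (dirac 0)) \<and>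
         (\<forall>m\<in>hypernats. \<forall>n\<in>hypernats. 1 \<le> m \<longrightarrow> 1 \<le> n \<longrightarrow> m \<noteq> n \<longrightarrow>
            grid_pow h m \<noteq> grid_pow h n) \<and>
         (\<forall>m\<in>hypernats. \<forall>n\<in>hypernats. 1 \<le> m \<longrightarrow> 1 \<le> n \<longrightarrow>
            grid_inner N (\<lambda>x. grid_pow h m x - grid_pow h n x) (fdiff N h)
              near (1 / (m + 1) - 1 / (n + 1)))"
proof -
  interpret ramp N M h
  proof
    show "N \<in> hypernats" "N \<notin> \<nat>"
      unfolding N using hyperfact_infinite[OF N\<^sub>0] .
  qed (use M h in \<open>unfold \<epsilon>, blast+\<close>)
  show ?thesis
    using power_represents_heaviside fdiff_power_represents_dirac power_inject
      grid_inner_power_diff_fdiff_near by blast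
qed

end
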